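(* Let $n\ge 2$. There exists a constant $d>0$ (depending only on $n$) such that for any domain $\Omega\subset\mathbb{R}^n$, $$\sup_{u\in H_0^{1,n}(\Omega),\ \|u\|_{H^{1,n}(\Omega)}\leq 1}\int_\Omega\Phi\big(\alpha_n|u|^{\frac{n}{n-1}}\big)\,dx\leq d .$$ The inequality is sharp: for any $\alpha>\alpha_n$, the supremum $$\sup_{u\in H_0^{1,n}(\Omega),\ \|u\|_{H^{1,n}(\Omega)}\leq 1}\int_\Omega\Phi\big(\alpha|u|^{\frac{n}{n-1}}\big)\,dx$$ is $+\infty$.
   Context: $\Omega$ is a nonempty open connected set, bounded or unbounded. $\|u\|_{H^{1,n}(\Omega)}=\left(\int_\Omega(|\nabla u|^n+|u|^n)\,dx\right)^{1/n}$, and $H_0^{1,n}(\Omega)$ is the completion of $C_0^\infty(\Omega)$ in this norm. $\alpha_n=n\,\omega_{n-1}^{1/(n-1)}$, where $\omega_{n-1}$ is the measure of the unit sphere in $\mathbb{R}^n$. $\Phi(t)=e^t-\sum_{j=0}^{n-2}\frac{t^j}{j!}$. *)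

theory Defs
  imports "HOL-Analysis.Analysis"
begin

definition is_domain :: "'a::topological_space set \<Rightarrow> bool" where
  "is_domain \<Omega> \<longleftrightarrow> open \<Omega> \<and> connected \<Omega> \<and> \<Omega> \<noteq> {}"

primrec k_times_cont_diff :: "nat \<Rightarrow> ('a::euclidean_space \<Rightarrow> real) \<Rightarrow> bool" where
  "k_times_cont_diff 0 f \<longleftrightarrow> continuous_on UNIV f"
| "k_times_cont_diff (Suc k) f \<longleftrightarrow>
     (\<forall>x. f differentiable (at x)) \<and>
     (\<forall>b\<in>Basis. k_times_cont_diff k (\<lambda>x. frechet_derivative f (at x) b))"

text \<open>The space \<open>C\<^sub>0\<^sup>\<infinity>(\<Omega>)\<close>; its elements are regarded as functions on the
  whole space that vanish outside their compact support in \<open>\<Omega>\<close>.\<close>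

definition test_functions :: "'a::euclidean_space set \<Rightarrow> ('a \<Rightarrow> real) set" where
  "test_functions \<Omega> =
     {\<phi>. (\<forall>k. k_times_cont_diff k \<phi>) \<and>
         compact (closure {x. \<phi> x \<noteq> 0}) \<and> closure {x. \<phi> x \<noteq> 0} \<subseteq> \<Omega>}"

definition locally_integrable_on ::
    "('a::euclidean_space \<Rightarrow> 'b::euclidean_space) \<Rightarrow> 'a set \<Rightarrow> bool" where
  "locally_integrable_on f \<Omega> \<longleftrightarrow>
     (\<forall>K. compact K \<and> K \<subseteq> \<Omega> \<longrightarrow> f absolutely_integrable_on K)"

definition has_weak_gradient ::
    "('a::euclidean_space \<Rightarrow> real) \<Rightarrow> ('a \<Rightarrow> 'a) \<Rightarrow> 'a set \<Rightarrow> bool" where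
  "has_weak_gradient u g \<Omega> \<longleftrightarrow>
     locally_integrable_on u \<Omega> \<and> locally_integrable_on g \<Omega> \<and>
     (\<forall>\<phi>\<in>test_functions \<Omega>. \<forall>b\<in>Basis.
        (\<integral>x. u x * frechet_derivative \<phi> (at x) b \<partial>lebesgue_on \<Omega>) =
        - (\<integral>x. (g x \<bullet> b) * \<phi> x \<partial>lebesgue_on \<Omega>))"

text \<open>Weak gradients are unique up to null sets, so the choice made here does not affect
  the integrals below. For functions without a weak gradient the value is arbitrary.\<close>

definition weak_gradient ::
    "'a::euclidean_space set \<Rightarrow> ('a \<Rightarrow> real) \<Rightarrow> 'a \<Rightarrow> 'a" where
  "weak_gradient \<Omega> u = (SOME g. has_weak_gradient u g \<Omega>)"

text \<open>Elements of the function spaces below are representatives, not classes modulo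
  equality almost everywhere, and their values outside \<open>\<Omega>\<close> are irrelevant.\<close>

definition Lp_space ::
    "nat \<Rightarrow> 'a::euclidean_space set \<Rightarrow> ('a \<Rightarrow> 'b::euclidean_space) set" where
  "Lp_space p \<Omega> =
     {f \<in> borel_measurable (lebesgue_on \<Omega>). integrable (lebesgue_on \<Omega>) (\<lambda>x. norm (f x) ^ p)}"

definition sobolev_space :: "nat \<Rightarrow> 'a::euclidean_space set \<Rightarrow> ('a \<Rightarrow> real) set" where
  "sobolev_space p \<Omega> = {u \<in> Lp_space p \<Omega>. \<exists>g\<in>Lp_space p \<Omega>. has_weak_gradient u g \<Omega>}"

text \<open>The norm is only meaningful on \<open>sobolev_space p \<Omega>\<close>: elsewhere the Bochner integral may
  default to zero.\<close>

definition sobolev_norm :: "nat \<Rightarrow> 'a::euclidean_space set \<Rightarrow> ('a \<Rightarrow> real) \<Rightarrow> real" where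
  "sobolev_norm p \<Omega> u =
     root p (\<integral>x. norm (weak_gradient \<Omega> u x) ^ p + \<bar>u x\<bar> ^ p \<partial>lebesgue_on \<Omega>)"

text \<open>The completion of \<open>C\<^sub>0\<^sup>\<infinity>(\<Omega>)\<close>, realized as its closure in the complete space
  \<open>sobolev_space p \<Omega>\<close>.\<close>

definition sobolev_space_0 :: "nat \<Rightarrow> 'a::euclidean_space set \<Rightarrow> ('a \<Rightarrow> real) set" where
  "sobolev_space_0 p \<Omega> =
     {u \<in> sobolev_space p \<Omega>. \<exists>\<phi>. (\<forall>k. \<phi> k \<in> test_functions \<Omega>) \<and>
        (\<lambda>k. sobolev_norm p \<Omega> (\<lambda>x. u x - \<phi> k x)) \<longlonglongrightarrow> 0}"

text \<open>Surface measure on the unit sphere, obtained from Lebesgue measure by polar coordinates: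
  the surface measure of \<open>A\<close> is \<open>n\<close> times the volume of the cone over \<open>A\<close>.\<close>

definition sphere_measure :: "'a::euclidean_space set \<Rightarrow> real" where
  "sphere_measure A =
     real DIM('a) * measure lebesgue {r *\<^sub>R x | r x. 0 < r \<and> r \<le> 1 \<and> x \<in> A}"

definition moser_const :: "'a::euclidean_space itself \<Rightarrow> real" where
  "moser_const _ =
     real DIM('a) * sphere_measure (sphere (0::'a) 1) powr (1 / (real DIM('a) - 1))"

definition trunc_exp :: "nat \<Rightarrow> real \<Rightarrow> real" where
  "trunc_exp n t = exp t - (\<Sum>j = 0..n - 2. t ^ j / fact j)"

definition moser_sup :: "real \<Rightarrow> 'a::euclidean_space set \<Rightarrow> ennreal" where
  "moser_sup \<alpha> \<Omega> =
     (SUP u\<in>{u \<in> sobolev_space_0 DIM('a) \<Omega>. sobolev_norm DIM('a) \<Omega> u \<le> 1}.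
        \<integral>\<^sup>+x. ennreal (trunc_exp DIM('a)
          (\<alpha> * \<bar>u x\<bar> powr (real DIM('a) / (real DIM('a) - 1)))) \<partial>lebesgue_on \<Omega>)"

end

theory Submission
  imports Defs
begin

text \<open>
  Write \<open>n\<close> for the dimension, \<open>q = n / (n - 1)\<close>, \<open>\<omega>\<close> for the area of the unit sphere and
  \<open>\<alpha>\<^sub>n = n \<omega>\<^bsup>1/(n-1)\<^esup>\<close>.

  The upper bound is proved without symmetrization. In the place of the isoperimetric inequality
  stands a lower bound for the energy that a function needs to climb between two levels. Let \<open>u\<close> be
  continuously differentiable with compact support and \<open>0 \<le> a < b\<close>. Along every ray that starts at
  a point \<open>x\<close> with \<open>|u x| \<ge> b\<close>, the value \<open>|u|\<close> falls from \<open>b\<close> to \<open>a\<close>, so that \<open>b - a\<close> is at most the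
  integral of \<open>|\<nabla>u|\<close> over the part of the ray in the layer \<open>{a < |u| < b}\<close>. The mean over all
  directions bounds \<open>\<omega> (b - a)\<close> by the Riesz potential of \<open>|\<nabla>u|\<close> restricted to the layer
  (\<open>level_gap_le_riesz_potential\<close>). The mean over all \<open>x\<close> in \<open>E = {|u| \<ge> b}\<close> and Hoelder's inequality
  give (\<open>capacity_estimate\<close>)

  \<open>\<alpha>\<^sub>n (b - a)\<^bsup>q\<^esup> \<le> e\<^bsup>1/(n-1)\<^esup> (ln (M / |E|) + C)\<close>,

  where \<open>e\<close> is the energy of \<open>u\<close> in the layer, \<open>M\<close> bounds the measures of \<open>E\<close> and of the layer, and
  \<open>C\<close> depends on \<open>n\<close> only. Two features carry the proof: the coefficient of the logarithm is sharp,
  the loss \<open>C\<close> being additive, and the energies of disjoint layers add up.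

  Suppose that the Sobolev norm of \<open>u\<close> is at most \<open>1\<close>. Start at the level \<open>s\<^sub>0\<close> equal to the
  \<open>L\<^sup>n\<close> norm of \<open>u\<close>; by Chebyshev, \<open>|u|\<close> exceeds it on a set of measure at most \<open>1\<close>, however large the
  domain. Let \<open>s\<^sub>k\<close> be the least level above \<open>s\<^sub>0\<close> that \<open>|u|\<close> exceeds on a set of measure at most
  \<open>exp (- k)\<close>. The height \<open>s\<^sub>0\<close> is paid for by the \<open>L\<^sup>n\<close> part of the norm and the further climb by the
  gradient part. The numbers \<open>\<tau>\<^sub>k = \<alpha>\<^sub>n\<^bsup>1/q\<^esup> s\<^sub>k\<close> then satisfy the numerical conditions
  \<open>moser_admissible\<close>, and under these conditions alone the sum of \<open>exp (\<tau>\<^sub>k\<^bsup>q\<^esup> - k)\<close> is bounded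
  (\<open>moser_sequence_bound\<close>). This sum controls the integral where \<open>|u| > s\<^sub>0\<close>; elsewhere \<open>|u| \<le> 1\<close>, and
  the integrand is at most a multiple of \<open>|u|\<^sup>n\<close>. Hence \<open>moser_bound_c1_compact\<close>. Test functions are dense
  and weak gradients are unique almost everywhere, so Fatou's lemma extends the bound to the Sobolev space
  (\<open>moser_sup_bounded\<close>).

  For sharpness (\<open>moser_sup_eq_infinity\<close>), a smooth truncation of \<open>ln (R / |x - a|)\<close> that levels off for
  \<open>|x - a| < r\<close> has energy at most \<open>\<omega> (L + C)\<close> with \<open>L = ln (R / r)\<close>, and it is at least \<open>L - 2\<close> on the ball
  of radius \<open>r\<close>. If \<open>\<alpha> > \<alpha>\<^sub>n\<close>, then after normalization the exponent is at least \<open>\<gamma> n L\<close> on this ball for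
  a fixed \<open>\<gamma> > 1\<close> and all large \<open>L\<close>, while the volume of the ball is a multiple of \<open>exp (- n L)\<close>; so the
  integrals are unbounded.
\<close>

section \<open>A numerical lemma on sequences of levels\<close>

lemma weighted_am_gm:
  fixes a b s t :: real
  assumes "0 \<le> a" "0 \<le> b" "0 < s" "0 < t" "s + t = 1"
  shows "a powr s * b powr t \<le> s * a + t * b"
proof (cases "a = 0 \<or> b = 0")
  case True
  with assms show ?thesis by auto
next
  case False
  with assms show ?thesis by (intro Youngs_inequality_0) auto
qed

text \<open>
  Hoelder's inequality for two terms, with the powers taken outside: it merges a height paid for by the budget
  \<open>x\<^sub>1\<close> over the distance \<open>y\<^sub>1\<close> with a height paid for by \<open>x\<^sub>2\<close> over \<open>y\<^sub>2\<close>.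
\<close>

lemma holder_two_terms:
  fixes s t :: real
  assumes "0 \<le> x1" "0 \<le> x2" "0 \<le> y1" "0 \<le> y2" "0 < s" "0 < t" "s + t = 1"
  shows "x1 powr s * y1 powr t + x2 powr s * y2 powr t \<le> (x1 + x2) powr s * (y1 + y2) powr t"
proof (cases "x1 + x2 = 0 \<or> y1 + y2 = 0")
  case True
  then have "(x1 = 0 \<and> x2 = 0) \<or> (y1 = 0 \<and> y2 = 0)" using assms by auto
  with assms show ?thesis by auto
next
  case False
  define S T where "S = x1 + x2" and "T = y1 + y2"
  have pos: "S > 0" "T > 0" using False assms by (auto simp: S_def T_def)
  have normalized: "(x / S) powr s * (y / T) powr t \<le> s * (x / S) + t * (y / T)" if "0 \<le> x" "0 \<le> y" for x y
    using that pos assms by (intro weighted_am_gm) auto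
  have "(x1 / S) powr s * (y1 / T) powr t + (x2 / S) powr s * (y2 / T) powr t
      \<le> (s * (x1 / S) + t * (y1 / T)) + (s * (x2 / S) + t * (y2 / T))"
    using assms by (intro add_mono normalized) auto
  also have "\<dots> = s * ((x1 + x2) / S) + t * ((y1 + y2) / T)"
    by (simp add: add_divide_distrib algebra_simps)
  also have "\<dots> = 1" using pos assms by (simp add: S_def T_def)
  finally have "(x1 powr s * y1 powr t + x2 powr s * y2 powr t) / (S powr s * T powr t) \<le> 1"
    using pos assms by (simp add: powr_divide add_divide_distrib)
  then show ?thesis using pos by (simp add: S_def[symmetric] T_def[symmetric] divide_simps)
qed

lemma bernoulli_powr:
  fixes x r :: real
  assumes "-1 \<le> x" "0 < r" "r \<le> 1"
  shows "(1 + x) powr r \<le> 1 + r * x"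
proof (cases "r = 1")
  case False
  then have "(1 + x) powr r * 1 powr (1 - r) \<le> r * (1 + x) + (1 - r) * 1"
    using assms by (intro weighted_am_gm) auto
  then show ?thesis by (simp add: algebra_simps)
qed (use assms in auto)

text \<open>
  Here \<open>s = 1/n\<close> and \<open>t = 1/q\<close>. An index is good if the height reached there nearly exhausts the bound
  \<open>X\<^bsup>t\<^esup>\<close> that holds for the whole energy \<open>1\<close>. If an index at distance \<open>X\<close> is good, then by \<open>a_le\<close> it has used
  nearly the whole energy: the rest \<open>1 - e\<close> is of order \<open>\<Lambda> / X\<close>. With so little energy left, the height cannot
  keep pace over a long further distance \<open>Y\<close>, so that a later good index is close.
\<close>

lemma gap_between_good_indices:
  fixes s t c \<Lambda> X Y e a b :: real
  assumes s: "0 < s" "s \<le> 1/2" "s + t = 1"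
    and nonneg: "0 \<le> c" "0 \<le> \<Lambda>" "0 < X" "0 < Y" "0 \<le> e" "e \<le> 1" "0 \<le> a" "0 \<le> b"
    and a_le: "a \<le> e powr s * X powr t"
    and b_le: "b \<le> e powr s * X powr t + (1 - e) powr s * Y powr t"
    and a_good: "X - \<Lambda> \<le> a powr (1/t)"
    and b_good: "X + Y - \<Lambda> - c \<le> b powr (1/t)"
    and X_large: "2 * 2 powr (t/s) * \<Lambda> \<le> X"
  shows "Y \<le> 4 * ((1 + 2 powr (t/s)) * \<Lambda> + c)"
proof -
  define \<sigma> K \<epsilon> where "\<sigma> = s / t" and "K = 2 powr (t/s)" and "\<epsilon> = 1 - e"
  have t: "0 < t" "t < 1" using s by auto
  have \<sigma>: "0 < \<sigma>" "\<sigma> \<le> 1" using s t by (auto simp: \<sigma>_def field_simps)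
  have K: "0 < K" by (simp add: K_def)
  have e01: "0 \<le> \<epsilon>" "\<epsilon> \<le> 1" using nonneg by (auto simp: \<epsilon>_def)
  have pow: "(x powr s * y powr t) powr (1/t) = x powr \<sigma> * y" if "0 \<le> x" "0 \<le> y" for x y
    using that t by (simp add: powr_mult powr_powr \<sigma>_def)
  have "X - \<Lambda> \<le> (e powr s * X powr t) powr (1/t)"
    using a_good a_le nonneg t by (intro order_trans[OF a_good] powr_mono2) auto
  also have "\<dots> = (1 + (- \<epsilon>)) powr \<sigma> * X" using nonneg by (simp add: pow \<epsilon>_def)
  also have "\<dots> \<le> (1 + \<sigma> * (- \<epsilon>)) * X"
    using nonneg e01 \<sigma> by (intro mult_right_mono bernoulli_powr) auto
  finally have \<epsilon>X: "\<sigma> * \<epsilon> * X \<le> \<Lambda>" by (simp add: algebra_simps)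
  \<comment> \<open>The distance \<open>Y\<close> is halved at the price of a factor \<open>K\<close> before the remaining energy. Plain Hoelder would give the bound \<open>X + Y\<close> and no contradiction; with \<open>X + Y/2\<close>, a quarter of \<open>Y\<close> is left over.\<close>
  have half: "(1 - e) powr s * Y powr t = (K * \<epsilon>) powr s * (Y/2) powr t"
  proof -
    have "K powr s = 2 powr t" using s by (simp add: K_def powr_powr)
    then show ?thesis using nonneg e01 K by (simp add: powr_mult powr_divide \<epsilon>_def)
  qed
  have "b \<le> e powr s * X powr t + (K * \<epsilon>) powr s * (Y/2) powr t"
    using b_le half by simp
  also have "\<dots> \<le> (e + K * \<epsilon>) powr s * (X + Y/2) powr t"
    using nonneg e01 K s t by (intro holder_two_terms) auto
  finally have b_le': "b \<le> (e + K * \<epsilon>) powr s * (X + Y/2) powr t" .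
  have "X + Y - \<Lambda> - c \<le> ((e + K * \<epsilon>) powr s * (X + Y/2) powr t) powr (1/t)"
    using b_le' nonneg t by (intro order_trans[OF b_good] powr_mono2) auto
  also have "\<dots> = (e + K * \<epsilon>) powr \<sigma> * (X + Y/2)" using nonneg e01 K by (intro pow) auto
  also have "\<dots> \<le> (1 + K * \<epsilon>) powr \<sigma> * (X + Y/2)"
    using nonneg e01 K \<sigma> by (intro mult_right_mono powr_mono2) auto
  also have "\<dots> \<le> (1 + \<sigma> * (K * \<epsilon>)) * (X + Y/2)"
  proof (intro mult_right_mono bernoulli_powr)
    have "0 \<le> K * \<epsilon>" using K e01 by simp
    then show "-1 \<le> K * \<epsilon>" by linarith
  qed (use nonneg \<sigma> in auto)
  finally have 1: "Y/2 \<le> \<Lambda> + c + K * (\<sigma> * \<epsilon> * X) + K * (\<sigma> * \<epsilon>) * (Y/2)"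
    by (simp add: algebra_simps)
  have "2 * K * (\<sigma> * \<epsilon>) * X \<le> 2 * K * \<Lambda>" using mult_left_mono[OF \<epsilon>X, of "2 * K"] K by (simp add: algebra_simps)
  also have "\<dots> \<le> 1 * X" using X_large by (simp add: K_def)
  finally have "2 * K * (\<sigma> * \<epsilon>) \<le> 1" using \<open>0 < X\<close> by (metis mult_right_le_imp_le)
  then have "K * (\<sigma> * \<epsilon>) * (Y/2) \<le> (1/2) * (Y/2)" using nonneg by (intro mult_right_mono) auto
  moreover have "K * (\<sigma> * \<epsilon> * X) \<le> K * \<Lambda>" using \<epsilon>X K by (intro mult_left_mono) auto
  ultimately show ?thesis using 1 by (simp add: K_def[symmetric] algebra_simps)
qed

text \<open>
  The indices of \<open>N\<close> below \<open>A\<close> are few, and those from \<open>A\<close> on lie within distance \<open>B\<close> of the first of them.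
\<close>

lemma card_le_of_gaps:
  fixes N :: "nat set" and A B :: real
  assumes gap: "\<And>j k. j \<in> N \<Longrightarrow> k \<in> N \<Longrightarrow> j < k \<Longrightarrow> A \<le> real j \<Longrightarrow> real k - real j \<le> B"
    and "0 \<le> A" "0 \<le> B"
  shows "finite N \<and> real (card N) \<le> A + B + 2"
proof -
  have fin_below: "finite {k \<in> N. real k < A}" and card_below: "real (card {k \<in> N. real k < A}) \<le> A + 1"
  proof -
    have sub: "{k \<in> N. real k < A} \<subseteq> {..<nat \<lceil>A\<rceil>}"
      using \<open>0 \<le> A\<close> by (auto simp: zless_nat_eq_int_zless less_ceiling_iff)
    then show "finite {k \<in> N. real k < A}" by (rule finite_subset) auto
    have "card {k \<in> N. real k < A} \<le> nat \<lceil>A\<rceil>" using card_mono[OF _ sub] by simp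
    then show "real (card {k \<in> N. real k < A}) \<le> A + 1" using \<open>0 \<le> A\<close> by linarith
  qed
  have above: "finite {k \<in> N. A \<le> real k} \<and> real (card {k \<in> N. A \<le> real k}) \<le> B + 1"
  proof (cases "{k \<in> N. A \<le> real k} = {}")
    case True
    with \<open>0 \<le> B\<close> show ?thesis by (metis add_increasing card.empty finite.emptyI of_nat_0 zero_le_one)
  next
    case False
    define j where "j = (LEAST k. k \<in> N \<and> A \<le> real k)"
    have j: "j \<in> N" "A \<le> real j"
      using LeastI_ex[of "\<lambda>k. k \<in> N \<and> A \<le> real k"] False by (auto simp: j_def)
    have sub: "{k \<in> N. A \<le> real k} \<subseteq> {j..j + nat \<lfloor>B\<rfloor>}"
    proof
      fix k assume k: "k \<in> {k \<in> N. A \<le> real k}"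
      then have "j \<le> k" by (auto simp: j_def intro: Least_le)
      moreover have "real k - real j \<le> B"
        using gap[of j k] j k \<open>j \<le> k\<close> \<open>0 \<le> B\<close> by (cases "j = k") auto
      then have "k \<le> j + nat \<lfloor>B\<rfloor>" using \<open>j \<le> k\<close> \<open>0 \<le> B\<close> by linarith
      ultimately show "k \<in> {j..j + nat \<lfloor>B\<rfloor>}" by auto
    qed
    have "card {k \<in> N. A \<le> real k} \<le> nat \<lfloor>B\<rfloor> + 1" using card_mono[OF _ sub] by simp
    then show ?thesis using finite_subset[OF sub] \<open>0 \<le> B\<close> by (auto, linarith)
  qed
  have N: "N = {k \<in> N. real k < A} \<union> {k \<in> N. A \<le> real k}" by auto
  have "card N \<le> card {k \<in> N. real k < A} + card {k \<in> N. A \<le> real k}"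
    by (subst N) (rule card_Un_le)
  with fin_below card_below above show ?thesis
    by (subst N) (auto simp: card_gt_0_iff)
qed

text \<open>
  Cavalieri's principle: \<open>exp (- F k)\<close> is at most the term with \<open>m = \<lceil>F k + c\<rceil>\<close> of a series over all
  sublevel sets that contain \<open>k\<close>, and these sets grow only linearly in \<open>m\<close>.
\<close>

lemma suminf_exp_le_of_card:
  fixes F :: "nat \<Rightarrow> real" and c K :: real
  assumes F: "\<And>k. - c \<le> F k" and "0 \<le> K"
    and fin: "\<And>m. finite {k. F k \<le> real m - c}"
    and card: "\<And>m. real (card {k. F k \<le> real m - c}) \<le> K * (real m + 1)"
  shows "(\<Sum>k. ennreal (exp (- F k))) \<le> ennreal (exp (c + 1) * K * (\<Sum>m. (real m + 1) * exp (-1) ^ m))"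
proof -
  let ?T = "\<lambda>m k. ennreal (exp (c + 1 - real m)) * indicator {k. F k \<le> real m - c} k"
  have summable: "summable (\<lambda>m. (real m + 1) * exp (-1::real) ^ m)"
  proof -
    have "norm (exp (-1::real)) < 1" by simp
    from geometric_deriv_sums[OF this] show ?thesis by (auto simp: sums_iff add.commute)
  qed
  have le: "ennreal (exp (- F k)) \<le> (\<Sum>m. ?T m k)" for k
  proof -
    define m where "m = nat \<lceil>F k + c\<rceil>"
    have m: "F k \<le> real m - c" "real m - 1 - c \<le> F k"
      using F[of k] by (auto simp: m_def) linarith+
    have "ennreal (exp (- F k)) \<le> ?T m k" using m by (auto intro!: ennreal_leI)
    also have "\<dots> = sum (\<lambda>m. ?T m k) {m}" by (simp only: sum.insert sum.empty finite.emptyI empty_iff not_False_eq_True add_0_right)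
    also have "\<dots> \<le> (\<Sum>m. ?T m k)" by (rule sum_le_suminf) auto
    finally show ?thesis .
  qed
  have "(\<Sum>k. ennreal (exp (- F k))) \<le> (\<Sum>k. \<Sum>m. ?T m k)"
    by (rule suminf_le[OF le]) auto
  also have "\<dots> = (\<integral>\<^sup>+k. (\<Sum>m. ?T m k) \<partial>count_space UNIV)"
    by (rule nn_integral_count_space_nat[symmetric])
  also have "\<dots> = (\<Sum>m. \<integral>\<^sup>+k. ?T m k \<partial>count_space UNIV)"
    by (rule nn_integral_suminf) auto
  also have "\<dots> \<le> (\<Sum>m. ennreal (exp (c + 1) * K * ((real m + 1) * exp (-1) ^ m)))"
  proof (rule suminf_le)
    fix m
    have "(\<integral>\<^sup>+k. ?T m k \<partial>count_space UNIV) = ennreal (exp (c + 1 - real m)) * of_nat (card {k. F k \<le> real m - c})"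
      using fin[of m] by (subst nn_integral_cmult) auto
    also have "\<dots> = ennreal (exp (c + 1 - real m) * real (card {k. F k \<le> real m - c}))"
      by (simp add: ennreal_mult ennreal_of_nat_eq_real_of_nat)
    also have "\<dots> \<le> ennreal (exp (c + 1 - real m) * (K * (real m + 1)))"
      using card[of m] by (intro ennreal_leI mult_left_mono) auto
    also have "exp (c + 1 - real m) * (K * (real m + 1)) = exp (c + 1) * K * ((real m + 1) * exp (-1) ^ m)"
    proof -
      have "exp (c + 1 - real m) = exp (c + 1) * exp (-1) ^ m"
        by (simp add: exp_diff exp_minus power_inverse exp_of_nat_mult[of m 1, simplified, symmetric] divide_inverse)
      then show ?thesis by simp
    qed
    finally show "(\<integral>\<^sup>+k. ?T m k \<partial>count_space UNIV) \<le> ennreal (exp (c + 1) * K * ((real m + 1) * exp (-1) ^ m))" .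
  qed auto
  also have "\<dots> = ennreal (\<Sum>m. exp (c + 1) * K * ((real m + 1) * exp (-1) ^ m))"
    using \<open>0 \<le> K\<close> by (intro suminf_ennreal2 summable_mult summable) auto
  also have "(\<Sum>m. exp (c + 1) * K * ((real m + 1) * exp (-1) ^ m)) =
      exp (c + 1) * K * (\<Sum>m. (real m + 1) * exp (-1) ^ m)"
    by (rule suminf_mult[OF summable])
  finally show ?thesis .
qed

text \<open>
  The index \<open>k\<close> stands for the measure \<open>exp (- k)\<close> of a superlevel set, \<open>\<tau> k\<close> for the scaled level and \<open>E k\<close> for
  the part of the norm used up to this level. The additive \<open>c\<close> is present for every pair of indices, so these are
  the conditions that Moser puts on an absolutely continuous function, weakened to a bounded error at each scale.
\<close>

definition moser_admissible :: "real \<Rightarrow> real \<Rightarrow> real \<Rightarrow> (nat \<Rightarrow> real) \<Rightarrow> (nat \<Rightarrow> real) \<Rightarrow> bool" where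
  "moser_admissible s t c \<tau> E \<longleftrightarrow>
     (\<forall>k. 0 \<le> \<tau> k \<and> 0 \<le> E k \<and> E k \<le> 1 \<and> \<tau> k \<le> E k powr s * (real k + c) powr t) \<and>
     (\<forall>j k. j < k \<longrightarrow> E j \<le> E k \<and> \<tau> k - \<tau> j \<le> (E k - E j) powr s * (real k - real j + c) powr t)"

text \<open>
  A discrete form of the one-dimensional lemmas of Moser and Adams. With \<open>F k = k - \<tau> k\<^bsup>q\<^esup>\<close>, two indices at
  which \<open>F\<close> is at most \<open>\<lambda>\<close> are close by \<open>gap_between_good_indices\<close>, apart from those of size \<open>O(\<lambda>)\<close>. So
  \<open>F k \<le> \<lambda>\<close> holds for \<open>O(\<lambda>)\<close> indices only, and the sum of \<open>exp (- F k)\<close> converges uniformly.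
\<close>

proposition moser_sequence_bound:
  fixes s t c :: real
  assumes s: "0 < s" "s \<le> 1/2" "s + t = 1" and "0 < c"
  obtains D :: real where "\<And>\<tau> E. moser_admissible s t c \<tau> E \<Longrightarrow>
    (\<Sum>k. ennreal (exp (\<tau> k powr (1/t) - real k))) \<le> ennreal D"
proof
  define K0 K where "K0 = (2::real) powr (t/s)" and "K = 2 * K0 + 4 * (1 + K0) + 4 * c + 2"
  define D where "D = exp (c + 1) * K * (\<Sum>m. (real m + 1) * exp (-1) ^ m)"
  have t: "0 < t" "t < 1" using s by auto
  fix \<tau> E :: "nat \<Rightarrow> real"
  assume "moser_admissible s t c \<tau> E"
  then have \<tau>: "\<And>k. 0 \<le> \<tau> k" and E: "\<And>k. 0 \<le> E k" "\<And>k. E k \<le> 1"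
    and \<tau>_le: "\<And>k. \<tau> k \<le> E k powr s * (real k + c) powr t"
    and incr: "\<And>j k. j < k \<Longrightarrow> \<tau> k - \<tau> j \<le> (E k - E j) powr s * (real k - real j + c) powr t"
    and mono: "\<And>j k. j < k \<Longrightarrow> E j \<le> E k"
    by (auto simp: moser_admissible_def)
  define F where "F = (\<lambda>k. real k - \<tau> k powr (1/t))"
  have K0: "K0 > 0" by (simp add: K0_def)
  have F_ge: "- c \<le> F k" for k
  proof -
    have "\<tau> k \<le> 1 * (real k + c) powr t"
      using \<tau>_le[of k] E[of k] s \<open>0 < c\<close>
      by (intro order_trans[OF \<tau>_le] mult_right_mono powr_le1) auto
    then have "\<tau> k powr (1/t) \<le> (1 * (real k + c) powr t) powr (1/t)"
      using \<tau> t by (intro powr_mono2) auto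
    then show ?thesis using t \<open>0 < c\<close> by (simp add: powr_powr F_def)
  qed
  have gaps: "finite {k. F k \<le> real m - c} \<and>
      real (card {k. F k \<le> real m - c}) \<le> 2 * K0 * m + 4 * ((1 + K0) * m + c) + 2" for m :: nat
  proof (rule card_le_of_gaps)
    fix j k assume jk: "j \<in> {k. F k \<le> real m - c}" "k \<in> {k. F k \<le> real m - c}" "j < k" "2 * K0 * m \<le> real j"
    have "real k - real j + c \<le> 4 * ((1 + 2 powr (t/s)) * real m + c)"
    proof (rule gap_between_good_indices[where X = "real j + c" and a = "\<tau> j" and b = "\<tau> k" and e = "E j" and s = s and t = t])
      have "(E k - E j) powr s \<le> (1 - E j) powr s"
        using E[of k] mono[OF jk(3)] s by (intro powr_mono2) auto
      then have "(E k - E j) powr s * (real k - real j + c) powr t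
          \<le> (1 - E j) powr s * (real k - real j + c) powr t"
        by (intro mult_right_mono) auto
      then show "\<tau> k \<le> E j powr s * (real j + c) powr t + (1 - E j) powr s * (real k - real j + c) powr t"
        using \<tau>_le[of j] incr[OF jk(3)] by linarith
    qed (use s \<open>0 < c\<close> jk \<tau> E \<tau>_le in \<open>auto simp: F_def K0_def\<close>)
    then show "real k - real j \<le> 4 * ((1 + K0) * m + c)" using \<open>0 < c\<close> by (simp add: K0_def)
  qed (use K0 \<open>0 < c\<close> in auto)
  have card_le: "real (card {k. F k \<le> real m - c}) \<le> K * (real m + 1)" for m :: nat
  proof -
    have "2 * K0 * m + 4 * ((1 + K0) * m + c) + 2 \<le> K * (real m + 1)"
      using K0 \<open>0 < c\<close> by (simp add: K_def algebra_simps)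
    with gaps[of m] show ?thesis by linarith
  qed
  have "(\<Sum>k. ennreal (exp (- F k))) \<le> ennreal D"
    unfolding D_def using F_ge gaps card_le K0 \<open>0 < c\<close>
    by (intro suminf_exp_le_of_card) (auto simp: K_def)
  then show "(\<Sum>k. ennreal (exp (\<tau> k powr (1/t) - real k))) \<le> ennreal D"
    by (simp add: F_def)
qed

section \<open>Polar coordinates\<close>

definition sphere_area :: "nat \<Rightarrow> real" where
  "sphere_area n = real n * unit_ball_vol (real n)"

lemma sphere_area_pos: "0 < n \<Longrightarrow> 0 < sphere_area n"
  by (simp add: sphere_area_def)

lemma nn_integral_lborel_affine:
  fixes f :: "'a::euclidean_space \<Rightarrow> ennreal"
  assumes [measurable]: "f \<in> borel_measurable borel" and c: "c \<noteq> 0"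
  shows "(\<integral>\<^sup>+x. f x \<partial>lborel) = ennreal (\<bar>c\<bar> ^ DIM('a)) * (\<integral>\<^sup>+x. f (t + c *\<^sub>R x) \<partial>lborel)"
  by (subst lborel_affine[OF c, of t])
     (simp add: nn_integral_density nn_integral_distr nn_integral_cmult)

lemma AE_lborel_neq: "AE z in lborel. z \<noteq> (x::'a::euclidean_space)"
  using AE_lborel_singleton[of x] by simp

lemma nn_integral_inverse_power_atLeast:
  fixes a :: real
  assumes "0 < a" "0 < n"
  shows "(\<integral>\<^sup>+r. ennreal (a / r ^ (n + 1)) * indicator {a..} r \<partial>lborel) = ennreal (1 / (real n * a ^ (n - 1)))"
proof -
  have n: "a ^ n = a * a ^ (n - 1)" using assms by (cases n) auto
  have "(\<integral>\<^sup>+r. ennreal (a / r ^ (n + 1)) * indicator {a..} r \<partial>lborel) = ennreal (0 - (- (a / real n) / a ^ n))"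
  proof (rule nn_integral_FTC_atLeast[where F = "\<lambda>r. - (a / real n) / r ^ n"])
    fix r assume "a \<le> r"
    with assms have r: "r > 0" by simp
    have "r ^ n = r * r ^ (n - 1)" using assms by (cases n) auto
    then show "((\<lambda>r. - (a / real n) / r ^ n) has_real_derivative a / r ^ (n + 1)) (at r)"
      using r assms by (auto intro!: derivative_eq_intros simp: field_simps power2_eq_square)
  next
    show "((\<lambda>r. - (a / real n) / r ^ n) \<longlongrightarrow> 0) at_top"
      using assms by (intro tendsto_divide_0[OF tendsto_const] filterlim_at_top_imp_at_infinity filterlim_pow_at_top filterlim_ident)
  qed (use assms in auto)
  also have "0 - (- (a / real n) / a ^ n) = 1 / (real n * a ^ (n - 1))" using assms n by simp
  finally show ?thesis .
qed

lemma borel_measurable_lborel_pair: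
  "f \<in> borel_measurable (borel \<Otimes>\<^sub>M borel) \<Longrightarrow> f \<in> borel_measurable (lborel \<Otimes>\<^sub>M lborel)"
  by (simp cong: measurable_cong_sets sets_pair_measure_cong)

text \<open>
  This replaces integration in polar coordinates. After exchanging the integrals and substituting
  \<open>z = x + r y\<close>, the remaining integral over \<open>r \<ge> |z - x|\<close> is elementary and yields the Riesz kernel. The weight
  \<open>|y|\<close> makes \<open>|y| dr\<close> the length element of the ray.
\<close>

proposition nn_integral_along_rays:
  fixes h :: "'a::euclidean_space \<Rightarrow> ennreal"
  assumes [measurable]: "h \<in> borel_measurable borel"
  shows "(\<integral>\<^sup>+y. indicator (cball 0 1) y * ennreal (norm y) *
            (\<integral>\<^sup>+r. indicator {0<..} r * h (x + r *\<^sub>R y) \<partial>lborel) \<partial>lborel) =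
         ennreal (1 / DIM('a)) * (\<integral>\<^sup>+z. h z * ennreal (1 / norm (z - x) ^ (DIM('a) - 1)) \<partial>lborel)"
proof -
  let ?n = "DIM('a)"
  have [measurable]: "cball 0 1 \<in> sets (borel :: 'a measure)" by simp
  have "(\<integral>\<^sup>+y. indicator (cball 0 1) y * ennreal (norm y) *
            (\<integral>\<^sup>+r. indicator {0<..} r * h (x + r *\<^sub>R y) \<partial>lborel) \<partial>lborel)
      = (\<integral>\<^sup>+y. (\<integral>\<^sup>+r. indicator {0<..} r * (indicator (cball 0 1) y * ennreal (norm y) * h (x + r *\<^sub>R y)) \<partial>lborel) \<partial>lborel)"
    by (subst nn_integral_cmult[symmetric]) (auto intro!: nn_integral_cong simp: mult_ac)
  also have "\<dots> = (\<integral>\<^sup>+r. (\<integral>\<^sup>+y. indicator {0<..} r * (indicator (cball 0 1) y * ennreal (norm y) * h (x + r *\<^sub>R y)) \<partial>lborel) \<partial>lborel)"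
    by (intro lborel_pair.Fubini' borel_measurable_lborel_pair) measurable
  also have "\<dots> = (\<integral>\<^sup>+r. (\<integral>\<^sup>+z. indicator {0<..} r * ((if norm (z - x) \<le> r then 1 else 0) * ennreal (norm (z - x) / r ^ (?n + 1)) * h z) \<partial>lborel) \<partial>lborel)"
  proof (rule nn_integral_cong)
    fix r :: real
    show "(\<integral>\<^sup>+y. indicator {0<..} r * (indicator (cball 0 1) y * ennreal (norm y) * h (x + r *\<^sub>R y)) \<partial>lborel) =
      (\<integral>\<^sup>+z. indicator {0<..} r * ((if norm (z - x) \<le> r then 1 else 0) * ennreal (norm (z - x) / r ^ (?n + 1)) * h z) \<partial>lborel)"
    proof (cases "0 < r")
      case True
      have "(\<integral>\<^sup>+z. (if norm (z - x) \<le> r then 1 else 0) * ennreal (norm (z - x) / r ^ (?n + 1)) * h z \<partial>lborel)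
        = ennreal (\<bar>r\<bar> ^ ?n) * (\<integral>\<^sup>+y. (if norm (x + r *\<^sub>R y - x) \<le> r then 1 else 0) * ennreal (norm (x + r *\<^sub>R y - x) / r ^ (?n + 1)) * h (x + r *\<^sub>R y) \<partial>lborel)"
        using True by (intro nn_integral_lborel_affine) auto
      also have "\<dots> = (\<integral>\<^sup>+y. ennreal (\<bar>r\<bar> ^ ?n) * ((if norm (x + r *\<^sub>R y - x) \<le> r then 1 else 0) * ennreal (norm (x + r *\<^sub>R y - x) / r ^ (?n + 1)) * h (x + r *\<^sub>R y)) \<partial>lborel)"
        by (intro nn_integral_cmult[symmetric]) measurable
      also have "\<dots> = (\<integral>\<^sup>+y. indicator (cball 0 1) y * ennreal (norm y) * h (x + r *\<^sub>R y) \<partial>lborel)"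
      proof (rule nn_integral_cong)
        fix y :: 'a
        have "r * norm y \<le> r \<longleftrightarrow> norm y \<le> 1" using True by simp
        moreover have "ennreal (r ^ ?n) * ennreal (r * norm y / (r * r ^ ?n)) = ennreal (norm y)"
          using True by (subst ennreal_mult[symmetric]) auto
        ultimately show "ennreal (\<bar>r\<bar> ^ ?n) * ((if norm (x + r *\<^sub>R y - x) \<le> r then 1 else 0) * ennreal (norm (x + r *\<^sub>R y - x) / r ^ (?n + 1)) * h (x + r *\<^sub>R y))
          = indicator (cball 0 1) y * ennreal (norm y) * h (x + r *\<^sub>R y)"
          using True by (auto simp: indicator_def mult.assoc[symmetric])
      qed
      finally show ?thesis using True by simp
    qed auto
  qed
  also have "\<dots> = (\<integral>\<^sup>+z. (\<integral>\<^sup>+r. indicator {0<..} r * ((if norm (z - x) \<le> r then 1 else 0) * ennreal (norm (z - x) / r ^ (?n + 1)) * h z) \<partial>lborel) \<partial>lborel)"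
    by (intro lborel_pair.Fubini' borel_measurable_lborel_pair) measurable
  also have "\<dots> = (\<integral>\<^sup>+z. ennreal (1 / ?n) * (h z * ennreal (1 / norm (z - x) ^ (?n - 1))) \<partial>lborel)"
  proof (intro nn_integral_cong_AE eventually_mono[OF AE_lborel_neq[of x]])
    fix z :: 'a assume "z \<noteq> x"
    define a where "a = norm (z - x)"
    have a: "0 < a" using \<open>z \<noteq> x\<close> by (simp add: a_def)
    have "(\<integral>\<^sup>+r. indicator {0<..} r * ((if a \<le> r then 1 else 0) * ennreal (a / r ^ (?n + 1)) * h z) \<partial>lborel)
      = (\<integral>\<^sup>+r. h z * (ennreal (a / r ^ (?n + 1)) * indicator {a..} r) \<partial>lborel)"
      using a by (intro nn_integral_cong) (auto simp: indicator_def mult_ac)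
    also have "\<dots> = h z * (\<integral>\<^sup>+r. ennreal (a / r ^ (?n + 1)) * indicator {a..} r \<partial>lborel)"
      by (rule nn_integral_cmult) measurable
    also have "\<dots> = h z * ennreal (1 / (?n * a ^ (?n - 1)))"
      using a by (subst nn_integral_inverse_power_atLeast) auto
    also have "ennreal (1 / (?n * a ^ (?n - 1))) = ennreal (1 / ?n) * ennreal (1 / a ^ (?n - 1))"
      using a by (subst ennreal_mult[symmetric]) auto
    finally show "(\<integral>\<^sup>+r. indicator {0<..} r * ((if norm (z - x) \<le> r then 1 else 0) * ennreal (norm (z - x) / r ^ (?n + 1)) * h z) \<partial>lborel) =
      ennreal (1 / ?n) * (h z * ennreal (1 / norm (z - x) ^ (?n - 1)))"
      by (simp add: a_def mult_ac)
  qed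
  also have "\<dots> = ennreal (1 / ?n) * (\<integral>\<^sup>+z. h z * ennreal (1 / norm (z - x) ^ (?n - 1)) \<partial>lborel)"
    by (rule nn_integral_cmult) measurable
  finally show ?thesis .
qed

text \<open>
  For \<open>h z = g (|z|) |z|\<^bsup>n-1\<^esup>\<close> the ray integrals in \<open>nn_integral_along_rays\<close> do not depend on the direction, and
  the kernel cancels the factor \<open>|z|\<^bsup>n-1\<^esup>\<close>.
\<close>

proposition nn_integral_radial:
  fixes g :: "real \<Rightarrow> ennreal"
  assumes [measurable]: "g \<in> borel_measurable borel"
  shows "(\<integral>\<^sup>+z. g (norm (z::'a::euclidean_space)) \<partial>lborel) =
    ennreal (sphere_area DIM('a)) * (\<integral>\<^sup>+t. indicator {0<..} t * (g t * ennreal (t ^ (DIM('a) - 1))) \<partial>lborel)"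
proof -
  let ?n = "DIM('a)"
  let ?I = "\<integral>\<^sup>+t. indicator {0<..} t * (g t * ennreal (t ^ (?n - 1))) \<partial>lborel"
  let ?h = "\<lambda>z::'a. g (norm z) * ennreal (norm z ^ (?n - 1))"
  have "(\<integral>\<^sup>+z. g (norm (z::'a)) \<partial>lborel) = (\<integral>\<^sup>+z. ?h z * ennreal (1 / norm (z - 0) ^ (?n - 1)) \<partial>lborel)"
    by (intro nn_integral_cong_AE eventually_mono[OF AE_lborel_neq[of 0]])
       (auto simp: mult.assoc ennreal_mult[symmetric])
  also have "\<dots> = ennreal ?n * (ennreal (1 / ?n) * (\<integral>\<^sup>+z. ?h z * ennreal (1 / norm (z - 0) ^ (?n - 1)) \<partial>lborel))"
    by (subst mult.assoc[symmetric], subst ennreal_mult[symmetric]) auto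
  also have "ennreal (1 / ?n) * (\<integral>\<^sup>+z. ?h z * ennreal (1 / norm (z - 0) ^ (?n - 1)) \<partial>lborel) =
    (\<integral>\<^sup>+y. indicator (cball 0 1) y * ennreal (norm y) *
            (\<integral>\<^sup>+r. indicator {0<..} r * ?h (0 + r *\<^sub>R y) \<partial>lborel) \<partial>lborel)"
    by (rule nn_integral_along_rays[symmetric]) measurable
  also have "\<dots> = (\<integral>\<^sup>+y. ?I * indicator (cball 0 1) (y::'a) \<partial>lborel)"
  proof (intro nn_integral_cong_AE eventually_mono[OF AE_lborel_neq[of 0]])
    fix y :: 'a assume "y \<noteq> 0"
    then have "?I = ennreal \<bar>norm y\<bar> * (\<integral>\<^sup>+r. indicator {0<..} (0 + norm y * r) * (g (0 + norm y * r) * ennreal ((0 + norm y * r) ^ (?n - 1))) \<partial>lborel)"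
      by (intro nn_integral_real_affine) auto
    also have "(\<integral>\<^sup>+r. indicator {0<..} (0 + norm y * r) * (g (0 + norm y * r) * ennreal ((0 + norm y * r) ^ (?n - 1))) \<partial>lborel)
       = (\<integral>\<^sup>+r. indicator {0<..} r * ?h (0 + r *\<^sub>R y) \<partial>lborel)"
      using \<open>y \<noteq> 0\<close> by (intro nn_integral_cong) (auto simp: indicator_def zero_less_mult_iff mult.commute)
    finally show "indicator (cball 0 1) y * ennreal (norm y) * (\<integral>\<^sup>+r. indicator {0<..} r * ?h (0 + r *\<^sub>R y) \<partial>lborel)
      = ?I * indicator (cball 0 1) y"
      by (simp add: indicator_def)
  qed
  also have "\<dots> = ?I * emeasure lborel (cball (0::'a) 1)"
    by (subst nn_integral_cmult_indicator) auto
  also have "emeasure lborel (cball (0::'a) 1) = ennreal (unit_ball_vol ?n)"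
    by (subst emeasure_cball) auto
  also have "ennreal ?n * (?I * ennreal (unit_ball_vol ?n)) = ennreal (sphere_area ?n) * ?I"
    by (simp add: sphere_area_def ennreal_mult mult_ac)
  finally show ?thesis .
qed

lemma nn_integral_riesz_kernel_cball:
  assumes "0 \<le> \<rho>"
  shows "(\<integral>\<^sup>+z. indicator (cball 0 \<rho>) z * ennreal (1 / norm (z::'a::euclidean_space) ^ (DIM('a) - 1)) \<partial>lborel)
    = ennreal (sphere_area DIM('a) * \<rho>)"
proof -
  let ?n = "DIM('a)"
  have "(\<integral>\<^sup>+z. indicator (cball 0 \<rho>) z * ennreal (1 / norm (z::'a) ^ (?n - 1)) \<partial>lborel)
    = (\<integral>\<^sup>+z. (\<lambda>t. indicator {..\<rho>} t * ennreal (1 / t ^ (?n - 1))) (norm (z::'a)) \<partial>lborel)"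
    by (intro nn_integral_cong) (auto simp: indicator_def)
  also have "\<dots> = ennreal (sphere_area ?n) * (\<integral>\<^sup>+t. indicator {0<..} t * ((indicator {..\<rho>} t * ennreal (1 / t ^ (?n - 1))) * ennreal (t ^ (?n - 1))) \<partial>lborel)"
    by (rule nn_integral_radial) measurable
  also have "(\<integral>\<^sup>+t. indicator {0<..} t * ((indicator {..\<rho>} t * ennreal (1 / t ^ (?n - 1))) * ennreal (t ^ (?n - 1))) \<partial>lborel)
    = (\<integral>\<^sup>+t. indicator {0<..\<rho>} t \<partial>lborel)"
    by (intro nn_integral_cong) (auto simp: indicator_def ennreal_mult[symmetric])
  also have "\<dots> = ennreal \<rho>" using assms by simp
  finally show ?thesis using assms sphere_area_pos[of ?n] by (simp add: ennreal_mult)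
qed

lemma nn_integral_inverse_norm_annulus:
  assumes "0 < \<rho>" "\<rho> \<le> R"
  shows "(\<integral>\<^sup>+z. indicator {\<rho>..R} (norm z) * ennreal (1 / norm (z::'a::euclidean_space) ^ DIM('a)) \<partial>lborel)
    = ennreal (sphere_area DIM('a) * ln (R / \<rho>))"
proof -
  let ?n = "DIM('a)"
  have n: "t ^ ?n = t * t ^ (?n - 1)" for t :: real using DIM_positive[where 'a='a] by (cases ?n) auto
  have "(\<integral>\<^sup>+z. indicator {\<rho>..R} (norm z) * ennreal (1 / norm (z::'a) ^ ?n) \<partial>lborel)
    = ennreal (sphere_area ?n) * (\<integral>\<^sup>+t. indicator {0<..} t * ((indicator {\<rho>..R} t * ennreal (1 / t ^ ?n)) * ennreal (t ^ (?n - 1))) \<partial>lborel)"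
    by (rule nn_integral_radial) measurable
  also have "(\<integral>\<^sup>+t. indicator {0<..} t * ((indicator {\<rho>..R} t * ennreal (1 / t ^ ?n)) * ennreal (t ^ (?n - 1))) \<partial>lborel)
    = (\<integral>\<^sup>+t. ennreal (1 / t) * indicator {\<rho>..R} t \<partial>lborel)"
    using assms by (intro nn_integral_cong) (auto simp: indicator_def ennreal_mult[symmetric] n)
  also have "\<dots> = ennreal (ln R - ln \<rho>)"
    using assms by (intro nn_integral_FTC_Icc) (auto intro!: derivative_eq_intros)
  finally show ?thesis using assms sphere_area_pos[of ?n] by (simp add: ennreal_mult ln_div)
qed

section \<open>Level sets and Riesz potentials\<close>

text \<open>
  Young's inequality, integrated after normalizing by \<open>A\<close> and \<open>B\<close>; the case that one of them vanishes follows by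
  letting them decrease.
\<close>

lemma nn_integral_holder:
  fixes f g :: "'b \<Rightarrow> real" and s t A B :: real
  assumes [measurable]: "f \<in> borel_measurable M" "g \<in> borel_measurable M"
    and nonneg: "\<And>x. 0 \<le> f x" "\<And>x. 0 \<le> g x" "0 \<le> A" "0 \<le> B"
    and st: "0 < s" "0 < t" "s + t = 1"
    and f: "(\<integral>\<^sup>+x. ennreal (f x powr (1/s)) \<partial>M) \<le> ennreal A"
    and g: "(\<integral>\<^sup>+x. ennreal (g x powr (1/t)) \<partial>M) \<le> ennreal B"
  shows "(\<integral>\<^sup>+x. ennreal (f x * g x) \<partial>M) \<le> ennreal (A powr s * B powr t)"
proof -
  have pos: "(\<integral>\<^sup>+x. ennreal (f x * g x) \<partial>M) \<le> ennreal (A' powr s * B' powr t)"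
    if A': "0 < A'" "A \<le> A'" and B': "0 < B'" "B \<le> B'" for A' B'
  proof -
    let ?c = "A' powr s * B' powr t"
    have "(\<integral>\<^sup>+x. ennreal (f x * g x) \<partial>M) \<le>
      (\<integral>\<^sup>+x. ennreal (?c * s / A') * ennreal (f x powr (1/s)) + ennreal (?c * t / B') * ennreal (g x powr (1/t)) \<partial>M)"
    proof (rule nn_integral_mono)
      fix x
      have "(f x powr (1/s) / A') powr s * (g x powr (1/t) / B') powr t
          \<le> s * (f x powr (1/s) / A') + t * (g x powr (1/t) / B')"
        using st nonneg A' B' by (intro weighted_am_gm) auto
      then have "f x * g x / ?c \<le> s * (f x powr (1/s) / A') + t * (g x powr (1/t) / B')"
        using st nonneg A' B' by (simp add: powr_divide powr_powr)
      then have "f x * g x \<le> ?c * s / A' * f x powr (1/s) + ?c * t / B' * g x powr (1/t)"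
        using A' B' by (simp add: pos_divide_le_eq algebra_simps)
      then have "ennreal (f x * g x) \<le> ennreal (?c * s / A' * f x powr (1/s) + ?c * t / B' * g x powr (1/t))"
        by (rule ennreal_leI)
      then show "ennreal (f x * g x) \<le> ennreal (?c * s / A') * ennreal (f x powr (1/s)) + ennreal (?c * t / B') * ennreal (g x powr (1/t))"
        using A' B' st by (simp add: ennreal_mult[symmetric])
    qed
    also have "\<dots> = ennreal (?c * s / A') * (\<integral>\<^sup>+x. ennreal (f x powr (1/s)) \<partial>M) + ennreal (?c * t / B') * (\<integral>\<^sup>+x. ennreal (g x powr (1/t)) \<partial>M)"
      by (subst nn_integral_add) (auto simp: nn_integral_cmult)
    also have "\<dots> \<le> ennreal (?c * s / A') * ennreal A' + ennreal (?c * t / B') * ennreal B'"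
      using A' B' by (intro add_mono mult_left_mono order_trans[OF f] order_trans[OF g] ennreal_leI) auto
    also have "\<dots> = ennreal (?c * s + ?c * t)"
      using A' B' st by (simp add: ennreal_mult[symmetric] ennreal_plus[symmetric] del: ennreal_plus)
    also have "?c * s + ?c * t = ?c" using st by (simp add: distrib_left[symmetric])
    finally show ?thesis .
  qed
  have "((\<lambda>e. (A + e) powr s * (B + e) powr t) \<longlongrightarrow> (A + 0) powr s * (B + 0) powr t) (at_right 0)"
    using nonneg st
    by (intro tendsto_mult tendsto_powr' tendsto_add tendsto_const tendsto_ident_at)
       (auto simp: eventually_at_right_less intro!: eventually_mono[OF eventually_at_right_less])
  then have lim: "((\<lambda>e. ennreal ((A + e) powr s * (B + e) powr t)) \<longlongrightarrow> ennreal (A powr s * B powr t)) (at_right 0)"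
    by (intro tendsto_ennrealI) simp
  show ?thesis
  proof (rule tendsto_lowerbound[OF lim])
    show "\<forall>\<^sub>F e in at_right 0. (\<integral>\<^sup>+x. ennreal (f x * g x) \<partial>M) \<le> ennreal ((A + e) powr s * (B + e) powr t)"
      using nonneg by (intro eventually_mono[OF eventually_at_right_less[of 0]] pos) auto
  qed simp
qed

text \<open>
  \<open>r1\<close> is the last time at which \<open>v\<close> is at least \<open>b\<close>, and \<open>r2\<close> the first time after it at which \<open>v\<close> is at
  most \<open>a\<close>.
\<close>

lemma crossing_interval:
  fixes v :: "real \<Rightarrow> real"
  assumes cont: "continuous_on {0..T} v" and "0 \<le> T" "b \<le> v 0" "v T \<le> a" "a < b"
  obtains r1 r2 where "0 \<le> r1" "r1 < r2" "b \<le> v r1" "v r2 \<le> a" "\<And>r. r1 < r \<Longrightarrow> r < r2 \<Longrightarrow> a < v r \<and> v r < b"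
proof -
  define S1 where "S1 = {r \<in> {0..T}. b \<le> v r}"
  have "closed S1" unfolding S1_def
    by (intro continuous_on_closed_Collect_le cont continuous_on_const closed_atLeastAtMost)
  then have cS1: "compact S1"
    by (rule compact_Int_closed[OF compact_Icc[of 0 T], of S1, THEN back_subst[of compact]]) (auto simp: S1_def)
  have "0 \<in> S1" using assms by (auto simp: S1_def)
  then obtain r1 where r1: "r1 \<in> S1" "\<And>r. r \<in> S1 \<Longrightarrow> r \<le> r1"
    using compact_attains_sup[OF cS1] by auto
  define S2 where "S2 = {r \<in> {r1..T}. v r \<le> a}"
  have r1T: "0 \<le> r1" "r1 \<le> T" "b \<le> v r1" using r1 by (auto simp: S1_def)
  have "closed S2" unfolding S2_def
    using r1T by (intro continuous_on_closed_Collect_le continuous_on_subset[OF cont] continuous_on_const closed_atLeastAtMost) auto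
  then have cS2: "compact S2"
    by (rule compact_Int_closed[OF compact_Icc[of r1 T], of S2, THEN back_subst[of compact]]) (auto simp: S2_def)
  have "T \<in> S2" using assms r1T by (auto simp: S2_def)
  then obtain r2 where r2: "r2 \<in> S2" "\<And>r. r \<in> S2 \<Longrightarrow> r2 \<le> r"
    using compact_attains_inf[OF cS2] by auto
  have r2': "r1 \<le> r2" "r2 \<le> T" "v r2 \<le> a" using r2 by (auto simp: S2_def)
  have "r1 \<noteq> r2" using r1T r2' \<open>a < b\<close> by auto
  show thesis
  proof
    fix r assume r: "r1 < r" "r < r2"
    then have "r \<notin> S1" "r \<notin> S2" using r1 r2 by (meson not_le)+
    then show "a < v r \<and> v r < b" using r r1T r2' by (auto simp: S1_def S2_def)
  qed (use r1T r2' \<open>r1 \<noteq> r2\<close> in auto)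
qed

definition c1_compact :: "('a::euclidean_space \<Rightarrow> real) \<Rightarrow> ('a \<Rightarrow> 'a) \<Rightarrow> bool" where
  "c1_compact u Du \<longleftrightarrow> (\<forall>x. (u has_derivative (\<lambda>h. Du x \<bullet> h)) (at x)) \<and> continuous_on UNIV Du \<and>
     (\<exists>R. \<forall>x. R < norm x \<longrightarrow> u x = 0)"

lemma c1_compact_continuous: "c1_compact u Du \<Longrightarrow> continuous_on UNIV u"
  by (auto simp: c1_compact_def continuous_on_eq_continuous_at intro: has_derivative_continuous)

lemma c1_compact_measurable:
  assumes "c1_compact u Du"
  shows "u \<in> borel_measurable borel" "Du \<in> borel_measurable borel"
  using c1_compact_continuous[OF assms] assms
  by (auto simp: c1_compact_def intro: borel_measurable_continuous_onI)

lemma continuous_bounded_support_bounded: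
  fixes f :: "'a::euclidean_space \<Rightarrow> 'b::real_normed_vector"
  assumes "continuous_on UNIV f" "\<And>x. R < norm x \<Longrightarrow> f x = 0"
  obtains B where "0 \<le> B" "\<And>x. norm (f x) \<le> B"
proof -
  have "compact (f ` cball 0 R)"
    by (intro compact_continuous_image continuous_on_subset[OF assms(1)]) auto
  then obtain B where "\<forall>x\<in>cball 0 R. norm (f x) \<le> B"
    using compact_imp_bounded[of "f ` cball 0 R"] by (auto simp: bounded_iff)
  then have "norm (f x) \<le> \<bar>B\<bar>" for x
    using assms(2)[of x] by (cases "R < norm x") (auto dest!: bspec[of _ _ x])
  then show thesis by (intro that[of "\<bar>B\<bar>"]) auto
qed

lemma nn_integral_abs_derivative_ge:
  fixes w w' :: "real \<Rightarrow> real"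
  assumes "r1 \<le> r2" and w: "\<And>r. (w has_real_derivative w' r) (at r)" and w': "continuous_on UNIV w'"
  shows "ennreal \<bar>w r2 - w r1\<bar> \<le> (\<integral>\<^sup>+r. indicator {r1<..<r2} r * ennreal \<bar>w' r\<bar> \<partial>lborel)"
proof -
  have bi: "has_bochner_integral lborel (\<lambda>x. w' x * indicator {r1 .. r2} x) (w r2 - w r1)"
    using assms by (intro has_bochner_integral_FTC_Icc_real) (auto simp: continuous_on_eq_continuous_at)
  have "ennreal \<bar>w r2 - w r1\<bar> = ennreal (norm (\<integral>x. w' x * indicator {r1 .. r2} x \<partial>lborel))"
    using has_bochner_integral_integral_eq[OF bi] by simp
  also have "\<dots> \<le> (\<integral>\<^sup>+x. ennreal (norm (w' x * indicator {r1 .. r2} x)) \<partial>lborel)"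
    using bi by (intro integral_norm_bound_ennreal) (auto simp: has_bochner_integral_iff)
  also have "\<dots> = (\<integral>\<^sup>+r. indicator {r1<..<r2} r * ennreal \<bar>w' r\<bar> \<partial>lborel)"
  proof (rule nn_integral_cong_AE)
    have "AE x in lborel. x \<noteq> r1" "AE x in lborel. x \<noteq> r2" by (rule AE_lborel_neq)+
    then show "AE x in lborel. ennreal (norm (w' x * indicator {r1 .. r2} x)) = indicator {r1<..<r2} x * ennreal \<bar>w' x\<bar>"
      by eventually_elim (auto simp: indicator_def)
  qed
  finally show ?thesis .
qed

text \<open>
  Between the two crossing times the ray stays in the layer, and there \<open>u\<close> changes by at least \<open>b - a\<close>. The
  argument uses \<open>|u r1| - |u r2| \<le> |u r1 - u r2|\<close>, so that it concerns the differentiable \<open>u\<close> and not \<open>|u|\<close>,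
  and no truncation of \<open>u\<close> has to be differentiated.
\<close>

lemma level_gap_le_ray_integral:
  fixes u :: "'a::euclidean_space \<Rightarrow> real"
  assumes u: "c1_compact u Du" and ab: "0 \<le> a" "a < b" and x: "b \<le> \<bar>u x\<bar>" and "y \<noteq> 0"
  shows "ennreal (b - a) \<le> ennreal (norm y) *
    (\<integral>\<^sup>+r. indicator {0<..} r * (indicator {z. a < \<bar>u z\<bar> \<and> \<bar>u z\<bar> < b} (x + r *\<^sub>R y) * ennreal (norm (Du (x + r *\<^sub>R y)))) \<partial>lborel)"
proof -
  note [measurable] = c1_compact_measurable[OF u]
  let ?G = "{z. a < \<bar>u z\<bar> \<and> \<bar>u z\<bar> < b}"
  define w w' where "w = (\<lambda>r. u (x + r *\<^sub>R y))" and "w' = (\<lambda>r. Du (x + r *\<^sub>R y) \<bullet> y)"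
  have du: "\<And>z. (u has_derivative (\<lambda>h. Du z \<bullet> h)) (at z)" and cD: "continuous_on UNIV Du"
    using u by (auto simp: c1_compact_def)
  have w: "(w has_real_derivative w' r) (at r)" for r
  proof -
    have "((\<lambda>r. x + r *\<^sub>R y) has_derivative (\<lambda>h. h *\<^sub>R y)) (at r)"
      by (auto intro!: derivative_eq_intros)
    from has_derivative_compose[OF this du] show ?thesis
      by (simp add: w_def w'_def has_field_derivative_def mult_commute_abs)
  qed
  have w': "continuous_on UNIV w'"
    unfolding w'_def by (intro continuous_intros continuous_on_compose2[OF cD]) auto
  have wc: "continuous_on S w" for S
    using w by (meson DERIV_continuous_on has_field_derivative_at_within)
  obtain R where R: "\<And>z. R < norm z \<Longrightarrow> u z = 0" using u by (auto simp: c1_compact_def)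
  define T where "T = (\<bar>R\<bar> + norm x + 1) / norm y"
  have "norm (T *\<^sub>R y) = \<bar>R\<bar> + norm x + 1"
    using \<open>y \<noteq> 0\<close> by (simp add: T_def abs_of_nonneg)
  then have "R < norm (x + T *\<^sub>R y)" using norm_triangle_ineq4[of "x + T *\<^sub>R y" x] by simp
  then have wT: "w T = 0" by (simp add: w_def R)
  have "continuous_on {0..T} (\<lambda>r. \<bar>w r\<bar>)" by (intro continuous_intros wc)
  then obtain r1 r2 where r: "0 \<le> r1" "r1 < r2" "b \<le> \<bar>w r1\<bar>" "\<bar>w r2\<bar> \<le> a"
    and between: "\<And>r. r1 < r \<Longrightarrow> r < r2 \<Longrightarrow> a < \<bar>w r\<bar> \<and> \<bar>w r\<bar> < b"
    by (rule crossing_interval[of T "\<lambda>r. \<bar>w r\<bar>" b a]) (use x ab wT in \<open>auto simp: w_def T_def\<close>)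
  have "ennreal (b - a) \<le> ennreal \<bar>w r2 - w r1\<bar>" using r by (intro ennreal_leI) linarith
  also have "\<dots> \<le> (\<integral>\<^sup>+r. indicator {r1<..<r2} r * ennreal \<bar>w' r\<bar> \<partial>lborel)"
    using r by (intro nn_integral_abs_derivative_ge w w') auto
  also have "\<dots> \<le> (\<integral>\<^sup>+r. ennreal (norm y) * (indicator {0<..} r * (indicator ?G (x + r *\<^sub>R y) * ennreal (norm (Du (x + r *\<^sub>R y))))) \<partial>lborel)"
  proof (rule nn_integral_mono)
    fix r
    have "ennreal \<bar>w' r\<bar> \<le> ennreal (norm y) * ennreal (norm (Du (x + r *\<^sub>R y)))"
      using Cauchy_Schwarz_ineq2[of "Du (x + r *\<^sub>R y)" y]
      by (simp add: ennreal_mult[symmetric] w'_def mult.commute)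
    then show "indicator {r1<..<r2} r * ennreal \<bar>w' r\<bar> \<le> ennreal (norm y) * (indicator {0<..} r * (indicator ?G (x + r *\<^sub>R y) * ennreal (norm (Du (x + r *\<^sub>R y)))))"
      using between[of r] r by (auto simp: indicator_def w_def)
  qed
  also have "\<dots> = ennreal (norm y) * (\<integral>\<^sup>+r. indicator {0<..} r * (indicator ?G (x + r *\<^sub>R y) * ennreal (norm (Du (x + r *\<^sub>R y)))) \<partial>lborel)"
    by (rule nn_integral_cmult) measurable
  finally show ?thesis .
qed

text \<open>
  The integral of \<open>level_gap_le_ray_integral\<close> over the unit ball of directions, evaluated by
  \<open>nn_integral_along_rays\<close>.
\<close>

proposition level_gap_le_riesz_potential:
  fixes u :: "'a::euclidean_space \<Rightarrow> real"
  assumes u: "c1_compact u Du" and ab: "0 \<le> a" "a < b" and x: "b \<le> \<bar>u x\<bar>"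
  shows "ennreal (sphere_area DIM('a) * (b - a)) \<le>
    (\<integral>\<^sup>+z. indicator {z. a < \<bar>u z\<bar> \<and> \<bar>u z\<bar> < b} z * ennreal (norm (Du z)) * ennreal (1 / norm (z - x) ^ (DIM('a) - 1)) \<partial>lborel)"
proof -
  note [measurable] = c1_compact_measurable[OF u]
  let ?n = "DIM('a)"
  let ?h = "\<lambda>z. indicator {z. a < \<bar>u z\<bar> \<and> \<bar>u z\<bar> < b} z * ennreal (norm (Du z))"
  have "ennreal (b - a) * ennreal (unit_ball_vol ?n) = (\<integral>\<^sup>+y. ennreal (b - a) * indicator (cball (0::'a) 1) y \<partial>lborel)"
    by (subst nn_integral_cmult_indicator) (auto simp: emeasure_cball)
  also have "\<dots> \<le> (\<integral>\<^sup>+y. indicator (cball (0::'a) 1) y * ennreal (norm y) * (\<integral>\<^sup>+r. indicator {0<..} r * ?h (x + r *\<^sub>R y) \<partial>lborel) \<partial>lborel)"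
  proof (intro nn_integral_mono_AE eventually_mono[OF AE_lborel_neq[of 0]])
    fix y :: 'a assume "y \<noteq> 0"
    from level_gap_le_ray_integral[OF u ab x this]
    show "ennreal (b - a) * indicator (cball (0::'a) 1) y \<le> indicator (cball (0::'a) 1) y * ennreal (norm y) * (\<integral>\<^sup>+r. indicator {0<..} r * ?h (x + r *\<^sub>R y) \<partial>lborel)"
      by (simp add: indicator_def)
  qed
  also have "\<dots> = ennreal (1 / ?n) * (\<integral>\<^sup>+z. ?h z * ennreal (1 / norm (z - x) ^ (?n - 1)) \<partial>lborel)"
    by (rule nn_integral_along_rays) measurable
  finally have "ennreal ?n * (ennreal (b - a) * ennreal (unit_ball_vol ?n)) \<le> ennreal ?n * (ennreal (1 / ?n) * (\<integral>\<^sup>+z. ?h z * ennreal (1 / norm (z - x) ^ (?n - 1)) \<partial>lborel))"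
    by (rule mult_left_mono) auto
  also have "\<dots> = (\<integral>\<^sup>+z. ?h z * ennreal (1 / norm (z - x) ^ (?n - 1)) \<partial>lborel)"
    by (subst mult.assoc[symmetric], subst ennreal_mult[symmetric]) auto
  finally show ?thesis using ab
    by (simp add: sphere_area_def ennreal_mult mult_ac)
qed

section \<open>The averaged Riesz kernel\<close>

text \<open>
  Convexity of the power, in the form that charges the error to \<open>k2\<close> linearly.
\<close>

lemma powr_sum_le:
  fixes k1 k2 q :: real
  assumes "0 \<le> k1" "0 \<le> k2" "1 < q"
  shows "(k1 + k2) powr q \<le> k1 powr q + q * k2 * (k1 + k2) powr (q - 1)"
proof (cases "k1 + k2 = 0")
  case False
  define k where "k = k1 + k2"
  have k: "0 < k" using False assms by (auto simp: k_def)
  have kq: "k powr q = k * k powr (q - 1)" using k by (simp add: powr_mult_base)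
  have "(k1 powr q) powr (1/q) * (k powr q) powr (1 - 1/q) \<le> (1/q) * k1 powr q + (1 - 1/q) * k powr q"
    using assms k by (intro weighted_am_gm) auto
  also have "(k1 powr q) powr (1/q) * (k powr q) powr (1 - 1/q) = k1 * k powr (q - 1)"
    using assms by (simp add: powr_powr algebra_simps)
  finally have "q * (k1 * k powr (q - 1)) \<le> k1 powr q + (q - 1) * k powr q"
    using assms by (simp add: field_simps)
  moreover have "q * (k1 * k powr (q - 1)) + q * (k2 * k powr (q - 1)) = q * k powr q"
    unfolding kq by (simp add: k_def algebra_simps)
  ultimately have "k powr q \<le> k1 powr q + q * k2 * k powr (q - 1)"
    by (simp add: algebra_simps)
  then show ?thesis by (simp add: k_def)
qed (use assms in auto)

lemma powr_average_le:
  fixes E :: "'a::euclidean_space set" and k :: "'a \<Rightarrow> real" and q m a :: real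
  assumes [measurable]: "E \<in> sets borel" "k \<in> borel_measurable borel"
    and E: "emeasure lborel E = ennreal m" "0 < m" and "1 < q"
    and k: "\<And>x. 0 \<le> k x" "\<And>x. k x \<le> b"
    and a: "0 \<le> a" "ennreal a = ennreal (1/m) * (\<integral>\<^sup>+x. indicator E x * ennreal (k x) \<partial>lborel)"
  shows "ennreal (a powr q) \<le> ennreal (1/m) * (\<integral>\<^sup>+x. indicator E x * ennreal (k x powr q) \<partial>lborel)"
proof -
  define A where "A = enn2real (\<integral>\<^sup>+x. indicator E x * ennreal (k x powr q) \<partial>lborel)"
  have "(\<integral>\<^sup>+x. indicator E x * ennreal (k x powr q) \<partial>lborel) \<le> (\<integral>\<^sup>+x. ennreal (b powr q) * indicator E x \<partial>lborel)"
    using k \<open>1 < q\<close> by (intro nn_integral_mono) (auto simp: indicator_def intro!: ennreal_leI powr_mono2)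
  also have "\<dots> < \<infinity>" using E by (subst nn_integral_cmult_indicator) (auto simp: ennreal_mult_less_top)
  finally have A: "(\<integral>\<^sup>+x. indicator E x * ennreal (k x powr q) \<partial>lborel) = ennreal A"
    by (simp add: A_def)
  have A0: "0 \<le> A" by (simp add: A_def)
  have "(\<integral>\<^sup>+x. ennreal ((indicator E x * k x) * indicator E x) \<partial>lborel) \<le> ennreal (A powr (1/q) * m powr (1 - 1/q))"
  proof (rule nn_integral_holder)
    have "(\<integral>\<^sup>+x. ennreal ((indicator E x * k x) powr (1 / (1 / q))) \<partial>lborel) = ennreal A"
      unfolding A[symmetric] by (intro nn_integral_cong) (auto simp: indicator_def)
    then show "(\<integral>\<^sup>+x. ennreal ((indicator E x * k x) powr (1 / (1 / q))) \<partial>lborel) \<le> ennreal A" by simp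
    have "(\<integral>\<^sup>+x. ennreal (indicator E x powr (1 / (1 - 1 / q))) \<partial>lborel) = (\<integral>\<^sup>+x. indicator E x \<partial>lborel)"
      by (intro nn_integral_cong) (auto simp: indicator_def)
    then show "(\<integral>\<^sup>+x. ennreal (indicator E x powr (1 / (1 - 1 / q))) \<partial>lborel) \<le> ennreal m"
      using E by simp
  qed (use k A0 E \<open>1 < q\<close> in auto)
  also have "(\<integral>\<^sup>+x. ennreal ((indicator E x * k x) * indicator E x) \<partial>lborel) = (\<integral>\<^sup>+x. indicator E x * ennreal (k x) \<partial>lborel)"
    by (intro nn_integral_cong) (auto simp: indicator_def)
  finally have "ennreal a \<le> ennreal (1/m) * ennreal (A powr (1/q) * m powr (1 - 1/q))"
    unfolding a(2) by (intro mult_left_mono) auto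
  then have "ennreal a \<le> ennreal ((1/m) * (A powr (1/q) * m powr (1 - 1/q)))"
    using E by (simp add: ennreal_mult[symmetric])
  then have "a \<le> (1/m) * (A powr (1/q) * m powr (1 - 1/q))" using E by (subst (asm) ennreal_le_iff) auto
  also have "\<dots> = (A / m) powr (1/q)"
    using E A0 by (simp add: powr_diff powr_divide)
  finally have "a powr q \<le> ((A / m) powr (1/q)) powr q" using a \<open>1 < q\<close> by (intro powr_mono2) auto
  also have "\<dots> = (1/m) * A" using A0 E \<open>1 < q\<close> by (simp add: powr_powr)
  finally have "ennreal (a powr q) \<le> ennreal ((1/m) * A)" by (rule ennreal_leI)
  then show ?thesis using A A0 E by (simp add: ennreal_mult[symmetric])
qed

text \<open>
  The three terms come from the ball of radius \<open>\<rho>\<close>, from the annulus up to \<open>R\<close>, which gives the logarithm, and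
  from the rest of \<open>G\<close>, where the kernel is at most \<open>1 / R\<^sup>n\<close>. Only the additive constant is not optimal.
\<close>

lemma nn_integral_truncated_kernel:
  fixes G :: "'a::euclidean_space set"
  assumes [measurable]: "G \<in> sets borel" and \<rho>: "0 < \<rho>" "\<rho> \<le> R"
    and G: "emeasure lborel G \<le> ennreal (unit_ball_vol DIM('a) * R ^ DIM('a))"
  shows "(\<integral>\<^sup>+z. indicator G z * ennreal (min (1 / norm (z - x) ^ DIM('a)) (1 / \<rho> ^ DIM('a))) \<partial>lborel)
     \<le> ennreal (2 * unit_ball_vol DIM('a) + sphere_area DIM('a) * ln (R / \<rho>))"
proof -
  let ?n = "DIM('a)"
  let ?v = "unit_ball_vol (real DIM('a))"
  have [measurable]: "cball x \<rho> \<in> sets borel" by simp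
  have "(\<integral>\<^sup>+z. indicator G z * ennreal (min (1 / norm (z - x) ^ ?n) (1 / \<rho> ^ ?n)) \<partial>lborel)
    \<le> (\<integral>\<^sup>+z. ennreal (1 / \<rho> ^ ?n) * indicator (cball x \<rho>) z + indicator {\<rho>..R} (norm (z - x)) * ennreal (1 / norm (z - x) ^ ?n)
          + ennreal (1 / R ^ ?n) * indicator G z \<partial>lborel)"
  proof (rule nn_integral_mono)
    fix z
    consider "norm (z - x) \<le> \<rho>" | "\<rho> < norm (z - x)" "norm (z - x) \<le> R" | "R < norm (z - x)" by linarith
    then show "indicator G z * ennreal (min (1 / norm (z - x) ^ ?n) (1 / \<rho> ^ ?n)) \<le>
      ennreal (1 / \<rho> ^ ?n) * indicator (cball x \<rho>) z + indicator {\<rho>..R} (norm (z - x)) * ennreal (1 / norm (z - x) ^ ?n)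
          + ennreal (1 / R ^ ?n) * indicator G z"
    proof cases
      case 1
      then have "ennreal (min (1 / norm (z - x) ^ ?n) (1 / \<rho> ^ ?n)) \<le> ennreal (1 / \<rho> ^ ?n) * indicator (cball x \<rho>) z"
        by (auto simp: dist_norm norm_minus_commute intro!: ennreal_leI)
      then show ?thesis by (auto simp: indicator_def intro: order_trans add_increasing2)
    next
      case 2
      have "ennreal (min (1 / norm (z - x) ^ ?n) (1 / \<rho> ^ ?n)) \<le> ennreal (1 / norm (z - x) ^ ?n)"
        by (intro ennreal_leI) auto
      with 2 show ?thesis by (auto simp: indicator_def dist_norm norm_minus_commute intro: order_trans add_increasing2 add_increasing)
    next
      case 3
      have "1 / norm (z - x) ^ ?n \<le> 1 / R ^ ?n"
        using 3 \<rho> by (intro divide_left_mono power_mono mult_pos_pos zero_less_power) auto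
      then have "ennreal (min (1 / norm (z - x) ^ ?n) (1 / \<rho> ^ ?n)) \<le> ennreal (1 / R ^ ?n)"
        by (intro ennreal_leI) auto
      with 3 show ?thesis by (auto simp: indicator_def intro: order_trans add_increasing)
    qed
  qed
  also have "\<dots> = ennreal (1 / \<rho> ^ ?n) * emeasure lborel (cball x \<rho>)
      + (\<integral>\<^sup>+z. indicator {\<rho>..R} (norm (z - x)) * ennreal (1 / norm (z - x) ^ ?n) \<partial>lborel)
      + ennreal (1 / R ^ ?n) * emeasure lborel G"
    by (simp add: nn_integral_add nn_integral_cmult_indicator)
  also have "(\<integral>\<^sup>+z. indicator {\<rho>..R} (norm (z - x)) * ennreal (1 / norm (z - x) ^ ?n) \<partial>lborel)
    = (\<integral>\<^sup>+z. indicator {\<rho>..R} (norm z) * ennreal (1 / norm (z::'a) ^ ?n) \<partial>lborel)"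
    by (subst nn_integral_lborel_affine[where c = 1 and t = x]) auto
  also have "\<dots> = ennreal (sphere_area ?n * ln (R / \<rho>))"
    by (rule nn_integral_inverse_norm_annulus[OF \<rho>])
  also have "ennreal (1 / \<rho> ^ ?n) * emeasure lborel (cball x \<rho>) = ennreal ?v"
    using \<rho> by (subst emeasure_cball) (auto simp: ennreal_mult[symmetric])
  also have "ennreal ?v + ennreal (sphere_area ?n * ln (R / \<rho>)) + ennreal (1 / R ^ ?n) * emeasure lborel G
    \<le> ennreal ?v + ennreal (sphere_area ?n * ln (R / \<rho>)) + ennreal (1 / R ^ ?n) * ennreal (?v * R ^ ?n)"
    by (intro add_left_mono mult_left_mono G) auto
  also have "ennreal (1 / R ^ ?n) * ennreal (?v * R ^ ?n) = ennreal ?v"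
    using \<rho> by (subst ennreal_mult[symmetric]) auto
  also have "ennreal ?v + ennreal (sphere_area ?n * ln (R / \<rho>)) + ennreal ?v = ennreal (2 * ?v + sphere_area ?n * ln (R / \<rho>))"
  proof -
    have "0 \<le> sphere_area ?n * ln (R / \<rho>)" using \<rho> sphere_area_pos[of ?n] by simp
    then show ?thesis by (simp add: ennreal_plus[symmetric] del: ennreal_plus)
  qed
  finally show ?thesis .
qed

definition kernel_const :: "nat \<Rightarrow> real" where
  "kernel_const n = 2 + 2 * real n * (real n + 1)"

lemma kernel_const_pos: "0 < kernel_const n"
  by (simp add: kernel_const_def add_pos_nonneg)

text \<open>
  The \<open>q\<close>-th power of the Riesz kernel is \<open>|z|\<^bsup>-n\<^esup>\<close>, whose integral diverges logarithmically at the origin. The mean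
  over \<open>E\<close> removes the divergence at the scale \<open>\<rho>\<close> of a ball with the volume of \<open>E\<close>, and \<open>G\<close> cuts off the integral at
  the scale \<open>R\<close> of a ball of volume \<open>M\<close>; hence \<open>ln (M / m)\<close>. To lose only an additive constant, the kernel is
  split into its truncation \<open>k1\<close> at the value taken for \<open>|z| = \<rho>\<close> and a rest \<open>k2\<close> supported in the ball of
  radius \<open>\<rho>\<close>. The mean of \<open>k1\<close> is treated by Jensen's inequality. The mean of \<open>k2\<close> enters only linearly, by
  \<open>powr_sum_le\<close>: the other factor is bounded by a multiple of \<open>1 / \<rho>\<close>, and the integral of the mean of \<open>k2\<close> is at
  most \<open>\<omega> \<rho>\<close>.
\<close>

proposition averaged_riesz_kernel_bound:
  fixes E G :: "'a::euclidean_space set" and m M :: real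
  assumes n: "2 \<le> DIM('a)"
    and [measurable]: "E \<in> sets borel" "G \<in> sets borel"
    and E: "emeasure lborel E = ennreal m" "0 < m" "m \<le> M"
    and G: "emeasure lborel G \<le> ennreal M"
  obtains K :: "'a \<Rightarrow> real" where "K \<in> borel_measurable borel" "\<And>z. 0 \<le> K z"
    "\<And>z. ennreal (K z) = ennreal (1/m) * (\<integral>\<^sup>+x. indicator E x * ennreal (1 / norm (z - x) ^ (DIM('a) - 1)) \<partial>lborel)"
    "(\<integral>\<^sup>+z. indicator G z * ennreal (K z powr (1 / (1 - 1 / DIM('a)))) \<partial>lborel)
      \<le> ennreal (sphere_area DIM('a) / DIM('a) * (ln (M / m) + kernel_const DIM('a)))"
proof -
  let ?n = "DIM('a)"
  define v where "v = unit_ball_vol (real ?n)"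
  define q where "q = 1 / (1 - 1 / real ?n)"
  define \<rho> R where "\<rho> = (m / v) powr (1 / ?n)" and "R = (M / v) powr (1 / ?n)"
  have v: "0 < v" by (simp add: v_def)
  have \<rho>: "0 < \<rho>" "\<rho> ^ ?n = m / v" and R: "0 < R" "R ^ ?n = M / v"
    using v E by (auto simp: \<rho>_def R_def powr_realpow[symmetric] powr_powr)
  have \<rho>R: "\<rho> \<le> R" using v E by (auto simp: \<rho>_def R_def intro!: powr_mono2 divide_right_mono)
  have q: "1 < q" "q \<le> 2" "q - 1 = 1 / (real ?n - 1)" "(real ?n - 1) * q = real ?n"
    using n by (auto simp: q_def field_simps)
  have \<omega>: "sphere_area ?n = real ?n * v" by (simp add: sphere_area_def v_def)
  have \<rho>n: "\<rho> ^ ?n = \<rho> * \<rho> ^ (?n - 1)" using n by (cases ?n) auto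
  define k1 k2 where "k1 = (\<lambda>z::'a. min (1 / norm z ^ (?n - 1)) (1 / \<rho> ^ (?n - 1)))"
    and "k2 = (\<lambda>z::'a. 1 / norm z ^ (?n - 1) - k1 z)"
  have [measurable]: "k1 \<in> borel_measurable borel" "k2 \<in> borel_measurable borel"
    unfolding k1_def k2_def by measurable
  have k1: "0 \<le> k1 z" "k1 z \<le> 1 / \<rho> ^ (?n - 1)" for z using \<rho> by (auto simp: k1_def)
  have k2: "0 \<le> k2 z" for z by (auto simp: k2_def k1_def)
  have k2_int: "(\<integral>\<^sup>+z. ennreal (k2 z) \<partial>lborel) \<le> ennreal (sphere_area ?n * \<rho>)"
  proof -
    have "ennreal (k2 z) \<le> indicator (cball 0 \<rho>) z * ennreal (1 / norm (z::'a) ^ (?n - 1))" for z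
    proof (cases "norm z \<le> \<rho>")
      case True
      then show ?thesis using k1[of z] by (auto simp: k2_def intro!: ennreal_leI)
    next
      case False
      then have "1 / norm z ^ (?n - 1) \<le> 1 / \<rho> ^ (?n - 1)"
        using \<rho> by (intro divide_left_mono power_mono mult_pos_pos zero_less_power) auto
      then show ?thesis by (simp add: k2_def k1_def min_def)
    qed
    then have "(\<integral>\<^sup>+z. ennreal (k2 z) \<partial>lborel) \<le> (\<integral>\<^sup>+z. indicator (cball 0 \<rho>) z * ennreal (1 / norm (z::'a) ^ (?n - 1)) \<partial>lborel)"
      by (rule nn_integral_mono)
    then show ?thesis using nn_integral_riesz_kernel_cball[of \<rho>, where 'a='a] \<rho> by simp
  qed
  have k1q: "k1 z powr q = min (1 / norm z ^ ?n) (1 / \<rho> ^ ?n)" if "z \<noteq> 0" for z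
  proof -
    have p: "(1 / a ^ (?n - 1)) powr q = 1 / a ^ ?n" if "0 < a" for a :: real
      using that n q(4) by (simp add: powr_divide powr_realpow[symmetric] powr_powr of_nat_diff)
    have "mono_on {0..} (\<lambda>x::real. x powr q)" using q by (auto simp: mono_on_def intro: powr_mono2)
    then have "(min x y) powr q = min (x powr q) (y powr q)" if "0 \<le> x" "0 \<le> y" for x y :: real
      using that by (auto simp: min_def mono_on_def intro: order_antisym)
    then show ?thesis using that \<rho>(1) p[of "norm z"] p[of \<rho>] by (simp add: k1_def)
  qed
  define L1 L2 where "L1 = (\<lambda>z. ennreal (1/m) * (\<integral>\<^sup>+x. indicator E x * ennreal (k1 (z - x)) \<partial>lborel))"
    and "L2 = (\<lambda>z. ennreal (1/m) * (\<integral>\<^sup>+x. indicator E x * ennreal (k2 (z - x)) \<partial>lborel))"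
  have [measurable]: "L1 \<in> borel_measurable borel" "L2 \<in> borel_measurable borel"
    unfolding L1_def L2_def by (measurable; simp)+
  have translate: "(\<integral>\<^sup>+z. ennreal (k2 (z - x)) \<partial>lborel) = (\<integral>\<^sup>+z. ennreal (k2 z) \<partial>lborel)" for x
    by (subst nn_integral_lborel_affine[where c = 1 and t = x]) auto
  have reflect: "(\<integral>\<^sup>+x. ennreal (k2 (z - x)) \<partial>lborel) = (\<integral>\<^sup>+z. ennreal (k2 z) \<partial>lborel)" for z
    by (subst nn_integral_lborel_affine[where c = "-1" and t = z]) (auto simp: k2_def k1_def)
  have L1_le: "L1 z \<le> ennreal (1 / \<rho> ^ (?n - 1))" for z
  proof -
    have "(\<integral>\<^sup>+x. indicator E x * ennreal (k1 (z - x)) \<partial>lborel) \<le> (\<integral>\<^sup>+x. ennreal (1 / \<rho> ^ (?n - 1)) * indicator E x \<partial>lborel)"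
      using k1 by (intro nn_integral_mono) (auto simp: indicator_def intro!: ennreal_leI)
    also have "\<dots> = ennreal (1 / \<rho> ^ (?n - 1) * m)" using E \<rho> by (subst nn_integral_cmult_indicator) (auto simp: ennreal_mult[symmetric])
    finally have "L1 z \<le> ennreal (1/m) * ennreal (1 / \<rho> ^ (?n - 1) * m)" unfolding L1_def by (intro mult_left_mono) auto
    also have "\<dots> = ennreal (1 / \<rho> ^ (?n - 1))" using E \<rho> by (subst ennreal_mult[symmetric]) auto
    finally show ?thesis .
  qed
  have L2_le: "L2 z \<le> ennreal (?n / \<rho> ^ (?n - 1))" for z
  proof -
    have "(\<integral>\<^sup>+x. indicator E x * ennreal (k2 (z - x)) \<partial>lborel) \<le> (\<integral>\<^sup>+x. ennreal (k2 (z - x)) \<partial>lborel)"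
      by (intro nn_integral_mono) (auto simp: indicator_def)
    also have "\<dots> \<le> ennreal (sphere_area ?n * \<rho>)" using k2_int by (simp add: reflect)
    finally have "L2 z \<le> ennreal (1/m) * ennreal (sphere_area ?n * \<rho>)" unfolding L2_def by (intro mult_left_mono) auto
    also have "\<dots> = ennreal (1/m * (sphere_area ?n * \<rho>))" using E \<rho> v by (subst ennreal_mult[symmetric]) (auto simp: \<omega>)
    also have "1/m * (sphere_area ?n * \<rho>) = ?n / \<rho> ^ (?n - 1)"
    proof -
      have "m = v * (\<rho> * \<rho> ^ (?n - 1))" using \<rho> v \<rho>n by simp
      then show ?thesis using \<rho> v by (simp add: \<omega>)
    qed
    finally show ?thesis .
  qed
  define K1 K2 where "K1 = (\<lambda>z. enn2real (L1 z))" and "K2 = (\<lambda>z. enn2real (L2 z))"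
  have [measurable]: "K1 \<in> borel_measurable borel" "K2 \<in> borel_measurable borel"
    unfolding K1_def K2_def by measurable
  have K1: "ennreal (K1 z) = L1 z" "0 \<le> K1 z" "K1 z \<le> 1 / \<rho> ^ (?n - 1)" for z
    using L1_le[of z] \<rho> by (auto simp: K1_def ennreal_enn2real_if top_unique intro!: enn2real_leI)
  have K2: "ennreal (K2 z) = L2 z" "0 \<le> K2 z" "K2 z \<le> ?n / \<rho> ^ (?n - 1)" for z
    using L2_le[of z] \<rho> by (auto simp: K2_def ennreal_enn2real_if top_unique intro!: enn2real_leI)
  have K2_int: "(\<integral>\<^sup>+z. ennreal (K2 z) \<partial>lborel) \<le> ennreal (sphere_area ?n * \<rho>)"
  proof -
    have "(\<integral>\<^sup>+z. ennreal (K2 z) \<partial>lborel) = ennreal (1/m) * (\<integral>\<^sup>+z. (\<integral>\<^sup>+x. indicator E x * ennreal (k2 (z - x)) \<partial>lborel) \<partial>lborel)"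
      unfolding K2(1) L2_def by (rule nn_integral_cmult) (measurable; simp)
    also have "(\<integral>\<^sup>+z. (\<integral>\<^sup>+x. indicator E x * ennreal (k2 (z - x)) \<partial>lborel) \<partial>lborel)
      = (\<integral>\<^sup>+x. (\<integral>\<^sup>+z. indicator E x * ennreal (k2 (z - x)) \<partial>lborel) \<partial>lborel)"
      by (intro lborel_pair.Fubini' borel_measurable_lborel_pair) measurable
    also have "\<dots> = (\<integral>\<^sup>+x. (\<integral>\<^sup>+z. ennreal (k2 z) \<partial>lborel) * indicator E x \<partial>lborel)"
      by (intro nn_integral_cong) (simp add: nn_integral_cmult translate mult.commute)
    also have "\<dots> = (\<integral>\<^sup>+z. ennreal (k2 z) \<partial>lborel) * ennreal m"
      using E by (subst nn_integral_cmult_indicator) auto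
    also have "ennreal (1/m) * \<dots> = (\<integral>\<^sup>+z. ennreal (k2 z) \<partial>lborel)"
      using E by (subst mult.left_commute) (simp add: ennreal_mult[symmetric])
    finally show ?thesis using k2_int by simp
  qed
  have K1_int: "(\<integral>\<^sup>+z. indicator G z * ennreal (K1 z powr q) \<partial>lborel) \<le> ennreal (2 * v + sphere_area ?n * ln (R / \<rho>))"
  proof -
    have "(\<integral>\<^sup>+z. indicator G z * ennreal (K1 z powr q) \<partial>lborel)
      \<le> (\<integral>\<^sup>+z. ennreal (1/m) * (\<integral>\<^sup>+x. indicator G z * (indicator E x * ennreal (k1 (z - x) powr q)) \<partial>lborel) \<partial>lborel)"
    proof (rule nn_integral_mono)
      fix z
      have "ennreal (K1 z powr q) \<le> ennreal (1/m) * (\<integral>\<^sup>+x. indicator E x * ennreal (k1 (z - x) powr q) \<partial>lborel)"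
        using E q k1 K1(1,2)[of z] by (intro powr_average_le[where b = "1 / \<rho> ^ (?n - 1)"]) (auto simp: L1_def)
      then show "indicator G z * ennreal (K1 z powr q) \<le> ennreal (1/m) * (\<integral>\<^sup>+x. indicator G z * (indicator E x * ennreal (k1 (z - x) powr q)) \<partial>lborel)"
        by (auto simp: indicator_def)
    qed
    also have "\<dots> = ennreal (1/m) * (\<integral>\<^sup>+z. (\<integral>\<^sup>+x. indicator G z * (indicator E x * ennreal (k1 (z - x) powr q)) \<partial>lborel) \<partial>lborel)"
      by (rule nn_integral_cmult) (measurable; simp)
    also have "(\<integral>\<^sup>+z. (\<integral>\<^sup>+x. indicator G z * (indicator E x * ennreal (k1 (z - x) powr q)) \<partial>lborel) \<partial>lborel)
      = (\<integral>\<^sup>+x. (\<integral>\<^sup>+z. indicator G z * (indicator E x * ennreal (k1 (z - x) powr q)) \<partial>lborel) \<partial>lborel)"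
      by (intro lborel_pair.Fubini' borel_measurable_lborel_pair) measurable
    also have "ennreal (1/m) * \<dots> \<le> ennreal (1/m) * (\<integral>\<^sup>+x. ennreal (2 * v + sphere_area ?n * ln (R / \<rho>)) * indicator E x \<partial>lborel)"
    proof (intro mult_left_mono nn_integral_mono)
      fix x
      have "(\<integral>\<^sup>+z. indicator G z * ennreal (k1 (z - x) powr q) \<partial>lborel)
        = (\<integral>\<^sup>+z. indicator G z * ennreal (min (1 / norm (z - x) ^ ?n) (1 / \<rho> ^ ?n)) \<partial>lborel)"
        by (intro nn_integral_cong_AE eventually_mono[OF AE_lborel_neq[of x]]) (simp add: k1q)
      also have "\<dots> \<le> ennreal (2 * v + sphere_area ?n * ln (R / \<rho>))"
        using \<rho> \<rho>R G R v unfolding v_def by (intro nn_integral_truncated_kernel) auto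
      finally show "(\<integral>\<^sup>+z. indicator G z * (indicator E x * ennreal (k1 (z - x) powr q)) \<partial>lborel) \<le> ennreal (2 * v + sphere_area ?n * ln (R / \<rho>)) * indicator E x"
        by (auto simp: indicator_def)
    qed simp
    also have "(\<integral>\<^sup>+x. ennreal (2 * v + sphere_area ?n * ln (R / \<rho>)) * indicator E x \<partial>lborel) = ennreal (2 * v + sphere_area ?n * ln (R / \<rho>)) * ennreal m"
      using E by (subst nn_integral_cmult_indicator) auto
    also have "ennreal (1/m) * \<dots> = ennreal (2 * v + sphere_area ?n * ln (R / \<rho>))"
      using E by (subst mult.left_commute) (simp add: ennreal_mult[symmetric])
    finally show ?thesis .
  qed
  define K where "K = (\<lambda>z. K1 z + K2 z)"
  have [measurable]: "K \<in> borel_measurable borel" unfolding K_def by measurable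
  show thesis
  proof
    fix z show "0 \<le> K z" using K1 K2 by (simp add: K_def)
    have "ennreal (K z) = L1 z + L2 z" unfolding K_def K1(1)[symmetric] K2(1)[symmetric]
      using K1 K2 by (simp add: ennreal_plus)
    also have "\<dots> = ennreal (1/m) * (\<integral>\<^sup>+x. indicator E x * ennreal (k1 (z - x)) + indicator E x * ennreal (k2 (z - x)) \<partial>lborel)"
      unfolding L1_def L2_def by (subst nn_integral_add) (auto simp: distrib_left)
    also have "(\<integral>\<^sup>+x. indicator E x * ennreal (k1 (z - x)) + indicator E x * ennreal (k2 (z - x)) \<partial>lborel)
      = (\<integral>\<^sup>+x. indicator E x * ennreal (1 / norm (z - x) ^ (?n - 1)) \<partial>lborel)"
    proof (rule nn_integral_cong)
      fix x
      have "ennreal (k1 (z - x)) + ennreal (k2 (z - x)) = ennreal (1 / norm (z - x) ^ (?n - 1))"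
        using k1 k2 by (subst ennreal_plus[symmetric]) (auto simp: k2_def)
      then show "indicator E x * ennreal (k1 (z - x)) + indicator E x * ennreal (k2 (z - x)) = indicator E x * ennreal (1 / norm (z - x) ^ (?n - 1))"
        by (simp add: distrib_left[symmetric])
    qed
    finally show "ennreal (K z) = ennreal (1/m) * (\<integral>\<^sup>+x. indicator E x * ennreal (1 / norm (z - x) ^ (?n - 1)) \<partial>lborel)" .
  next
    \<comment> \<open>The exponent \<open>q - 1 = 1 / (n - 1)\<close> turns the bound of order \<open>1 / \<rho>^(n - 1)\<close> for \<open>K\<close> into one of order \<open>1 / \<rho>\<close>.\<close>
    have Kq: "K z powr q \<le> K1 z powr q + 2 * (?n + 1) / \<rho> * K2 z" for z
    proof -
      have "K z \<le> (?n + 1) / \<rho> ^ (?n - 1)" using K1(3)[of z] K2(3)[of z] by (simp add: K_def add_divide_distrib)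
      then have "K z powr (q - 1) \<le> ((?n + 1) / \<rho> ^ (?n - 1)) powr (q - 1)"
        using K1 K2 q by (intro powr_mono2) (auto simp: K_def)
      also have "\<dots> = (?n + 1) powr (q - 1) / \<rho>"
        using n \<rho> q(3) by (simp add: powr_divide powr_realpow[symmetric] powr_powr of_nat_diff)
      also have "\<dots> \<le> (?n + 1) powr 1 / \<rho>" using q \<rho> by (intro divide_right_mono powr_mono) auto
      finally have "K z powr (q - 1) \<le> (?n + 1) / \<rho>" by simp
      then have "q * K2 z * K z powr (q - 1) \<le> 2 * K2 z * ((?n + 1) / \<rho>)"
        using q K2[of z] by (intro mult_mono) auto
      then show ?thesis using powr_sum_le[of "K1 z" "K2 z" q] K1[of z] K2[of z] q by (simp add: K_def algebra_simps)
    qed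
    have "(\<integral>\<^sup>+z. indicator G z * ennreal (K z powr q) \<partial>lborel)
      \<le> (\<integral>\<^sup>+z. indicator G z * ennreal (K1 z powr q) + ennreal (2 * (?n + 1) / \<rho>) * ennreal (K2 z) \<partial>lborel)"
    proof (rule nn_integral_mono)
      fix z
      have "ennreal (K z powr q) \<le> ennreal (K1 z powr q + 2 * (?n + 1) / \<rho> * K2 z)"
        by (intro ennreal_leI Kq)
      also have "\<dots> = ennreal (K1 z powr q) + ennreal (2 * (?n + 1) / \<rho>) * ennreal (K2 z)"
        using K2(2)[of z] \<rho>(1) by (simp add: ennreal_plus ennreal_mult[symmetric])
      finally have "ennreal (K z powr q) \<le> ennreal (K1 z powr q) + ennreal (2 * (?n + 1) / \<rho>) * ennreal (K2 z)" .
      then show "indicator G z * ennreal (K z powr q) \<le> indicator G z * ennreal (K1 z powr q) + ennreal (2 * (?n + 1) / \<rho>) * ennreal (K2 z)"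
        by (auto simp: indicator_def)
    qed
    also have "\<dots> = (\<integral>\<^sup>+z. indicator G z * ennreal (K1 z powr q) \<partial>lborel) + ennreal (2 * (?n + 1) / \<rho>) * (\<integral>\<^sup>+z. ennreal (K2 z) \<partial>lborel)"
      by (subst nn_integral_add) (auto simp: nn_integral_cmult)
    also have "\<dots> \<le> ennreal (2 * v + sphere_area ?n * ln (R / \<rho>)) + ennreal (2 * (?n + 1) / \<rho>) * ennreal (sphere_area ?n * \<rho>)"
      by (intro add_mono mult_left_mono K1_int K2_int) auto
    also have "\<dots> = ennreal (2 * v + sphere_area ?n * ln (R / \<rho>) + 2 * (?n + 1) * sphere_area ?n)"
    proof -
      have "0 \<le> sphere_area ?n * ln (R / \<rho>)" using \<rho> \<rho>R v by (auto simp: \<omega>)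
      moreover have "ennreal (2 * (?n + 1) / \<rho>) * ennreal (sphere_area ?n * \<rho>) = ennreal (2 * (?n + 1) * sphere_area ?n)"
        using \<rho> v by (subst ennreal_mult[symmetric]) (auto simp: \<omega>)
      ultimately show ?thesis using v by (simp add: ennreal_plus \<omega> del: ennreal_plus) (subst ennreal_plus[symmetric]; simp)
    qed
    also have "2 * v + sphere_area ?n * ln (R / \<rho>) + 2 * (?n + 1) * sphere_area ?n = sphere_area ?n / ?n * (ln (M / m) + kernel_const ?n)"
    proof -
      have "(R / \<rho>) ^ ?n = M / m" using \<rho> R v by (simp add: power_divide)
      then have "?n * ln (R / \<rho>) = ln (M / m)" using \<rho> R by (metis ln_realpow divide_pos_pos)
      then show ?thesis by (simp add: \<omega> kernel_const_def algebra_simps)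
    qed
    finally show "(\<integral>\<^sup>+z. indicator G z * ennreal (K z powr (1 / (1 - 1 / ?n))) \<partial>lborel)
      \<le> ennreal (sphere_area ?n / ?n * (ln (M / m) + kernel_const ?n))" by (simp add: q_def)
  qed measurable
qed

section \<open>The capacity estimate and level quantiles\<close>

definition moser_alpha :: "nat \<Rightarrow> real" where
  "moser_alpha n = real n * sphere_area n powr (1 / (real n - 1))"

lemma moser_alpha_pos: "0 < n \<Longrightarrow> 0 < moser_alpha n"
  using sphere_area_pos[of n] by (simp add: moser_alpha_def)

text \<open>
  The mean of \<open>level_gap_le_riesz_potential\<close> over the points \<open>x\<close> with \<open>b \<le> |u x|\<close>, followed by Hoelder's
  inequality with the bound for the averaged kernel.
\<close>

proposition capacity_estimate:
  fixes u :: "'a::euclidean_space \<Rightarrow> real"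
  assumes n: "2 \<le> DIM('a)" and u: "c1_compact u Du" and ab: "0 \<le> a" "a < b"
    and E: "emeasure lborel {x. b \<le> \<bar>u x\<bar>} = ennreal m" "0 < m" "m \<le> M"
    and G: "emeasure lborel {x. a < \<bar>u x\<bar> \<and> \<bar>u x\<bar> < b} \<le> ennreal M"
    and e: "0 \<le> e" "(\<integral>\<^sup>+z. indicator {x. a < \<bar>u x\<bar> \<and> \<bar>u x\<bar> < b} z * ennreal (norm (Du z) ^ DIM('a)) \<partial>lborel) \<le> ennreal e"
  shows "moser_alpha DIM('a) powr (1 - 1 / DIM('a)) * (b - a)
    \<le> e powr (1 / DIM('a)) * (ln (M / m) + kernel_const DIM('a)) powr (1 - 1 / DIM('a))"
proof -
  note [measurable] = c1_compact_measurable[OF u]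
  let ?n = "DIM('a)"
  define s t \<omega> L where "s = 1 / real ?n" and "t = 1 - s" and "\<omega> = sphere_area ?n"
    and "L = ln (M / m) + kernel_const ?n"
  let ?E = "{x. b \<le> \<bar>u x\<bar>}" and ?G = "{x. a < \<bar>u x\<bar> \<and> \<bar>u x\<bar> < b}"
  have st: "0 < s" "0 < t" "s + t = 1" using n by (auto simp: s_def t_def)
  have \<omega>: "0 < \<omega>" using n by (simp add: \<omega>_def sphere_area_pos)
  have L: "0 \<le> L" using E kernel_const_pos[of ?n] by (simp add: L_def)
  obtain K :: "'a \<Rightarrow> real" where K[measurable]: "K \<in> borel_measurable borel" and K0: "\<And>z. 0 \<le> K z"
    and K_eq: "\<And>z. ennreal (K z) = ennreal (1/m) * (\<integral>\<^sup>+x. indicator ?E x * ennreal (1 / norm (z - x) ^ (?n - 1)) \<partial>lborel)"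
    and K_int: "(\<integral>\<^sup>+z. indicator ?G z * ennreal (K z powr (1 / (1 - 1 / ?n))) \<partial>lborel)
      \<le> ennreal (sphere_area ?n / ?n * (ln (M / m) + kernel_const ?n))"
    using averaged_riesz_kernel_bound[OF n _ _ E G] by auto
  let ?h = "\<lambda>z. indicator ?G z * ennreal (norm (Du z))"
  have "ennreal m * ennreal (\<omega> * (b - a)) = (\<integral>\<^sup>+x. ennreal (\<omega> * (b - a)) * indicator ?E x \<partial>lborel)"
    using E by (subst nn_integral_cmult_indicator) (auto simp: mult.commute)
  also have "\<dots> \<le> (\<integral>\<^sup>+x. (\<integral>\<^sup>+z. indicator ?E x * (?h z * ennreal (1 / norm (z - x) ^ (?n - 1))) \<partial>lborel) \<partial>lborel)"
  proof (rule nn_integral_mono)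
    fix x show "ennreal (\<omega> * (b - a)) * indicator ?E x \<le> (\<integral>\<^sup>+z. indicator ?E x * (?h z * ennreal (1 / norm (z - x) ^ (?n - 1))) \<partial>lborel)"
      using level_gap_le_riesz_potential[OF u ab, of x] by (auto simp: indicator_def \<omega>_def)
  qed
  also have "\<dots> = (\<integral>\<^sup>+z. (\<integral>\<^sup>+x. indicator ?E x * (?h z * ennreal (1 / norm (z - x) ^ (?n - 1))) \<partial>lborel) \<partial>lborel)"
    by (intro lborel_pair.Fubini' borel_measurable_lborel_pair) measurable
  also have "\<dots> = (\<integral>\<^sup>+z. ennreal m * (?h z * ennreal (K z)) \<partial>lborel)"
  proof (rule nn_integral_cong)
    fix z
    have "(\<integral>\<^sup>+x. indicator ?E x * (?h z * ennreal (1 / norm (z - x) ^ (?n - 1))) \<partial>lborel)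
      = (\<integral>\<^sup>+x. ?h z * (indicator ?E x * ennreal (1 / norm (z - x) ^ (?n - 1))) \<partial>lborel)"
      by (simp add: mult_ac)
    also have "\<dots> = ?h z * (\<integral>\<^sup>+x. indicator ?E x * ennreal (1 / norm (z - x) ^ (?n - 1)) \<partial>lborel)"
      by (rule nn_integral_cmult) measurable
    also have "(\<integral>\<^sup>+x. indicator ?E x * ennreal (1 / norm (z - x) ^ (?n - 1)) \<partial>lborel) = ennreal m * ennreal (K z)"
      unfolding K_eq using E by (subst mult.assoc[symmetric], subst ennreal_mult[symmetric]) auto
    finally show "(\<integral>\<^sup>+x. indicator ?E x * (?h z * ennreal (1 / norm (z - x) ^ (?n - 1))) \<partial>lborel) = ennreal m * (?h z * ennreal (K z))"
      by (simp add: mult_ac)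
  qed
  also have "\<dots> = ennreal m * (\<integral>\<^sup>+z. ?h z * ennreal (K z) \<partial>lborel)"
    by (rule nn_integral_cmult) measurable
  finally have "ennreal (1/m) * (ennreal m * ennreal (\<omega> * (b - a))) \<le> ennreal (1/m) * (ennreal m * (\<integral>\<^sup>+z. ?h z * ennreal (K z) \<partial>lborel))"
    by (rule mult_left_mono) simp
  then have "ennreal (\<omega> * (b - a)) \<le> (\<integral>\<^sup>+z. ?h z * ennreal (K z) \<partial>lborel)"
    using E by (simp add: mult.assoc[symmetric] ennreal_mult[symmetric])
  also have "\<dots> = (\<integral>\<^sup>+z. ennreal ((indicator ?G z * norm (Du z)) * (indicator ?G z * K z)) \<partial>lborel)"
    by (intro nn_integral_cong) (auto simp: indicator_def ennreal_mult K0)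
  also have "\<dots> \<le> ennreal (e powr s * (\<omega> / ?n * L) powr t)"
  proof (rule nn_integral_holder)
    have "(\<integral>\<^sup>+z. ennreal ((indicator ?G z * norm (Du z)) powr (1/s)) \<partial>lborel) = (\<integral>\<^sup>+z. indicator ?G z * ennreal (norm (Du z) ^ ?n) \<partial>lborel)"
      using n by (intro nn_integral_cong) (auto simp: indicator_def s_def powr_realpow')
    then show "(\<integral>\<^sup>+z. ennreal ((indicator ?G z * norm (Du z)) powr (1/s)) \<partial>lborel) \<le> ennreal e" using e by simp
    have "(\<integral>\<^sup>+z. ennreal ((indicator ?G z * K z) powr (1/t)) \<partial>lborel) = (\<integral>\<^sup>+z. indicator ?G z * ennreal (K z powr (1 / (1 - 1 / ?n))) \<partial>lborel)"
      by (intro nn_integral_cong) (auto simp: indicator_def s_def t_def)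
    then show "(\<integral>\<^sup>+z. ennreal ((indicator ?G z * K z) powr (1/t)) \<partial>lborel) \<le> ennreal (\<omega> / ?n * L)"
      using K_int by (simp add: \<omega>_def L_def)
  qed (use st e L \<omega> K0 in auto)
  finally have "\<omega> * (b - a) \<le> e powr s * (\<omega> / ?n * L) powr t"
    by (subst (asm) ennreal_le_iff) auto
  then have "?n powr t * \<omega> powr (s - 1) * (\<omega> * (b - a)) \<le> ?n powr t * \<omega> powr (s - 1) * (e powr s * (\<omega> / ?n * L) powr t)"
    by (intro mult_left_mono) auto
  also have "\<dots> = e powr s * L powr t"
  proof -
    have "s - 1 = - t" using st by simp
    then have "\<omega> powr (s - 1) * \<omega> powr t = 1" using \<omega> by (simp add: powr_minus)
    then have "?n powr t * \<omega> powr (s - 1) * (e powr s * (\<omega> powr t / ?n powr t * L powr t)) = e powr s * L powr t"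
      by (simp add: field_simps)
    then show ?thesis using \<omega> L by (simp add: powr_mult powr_divide)
  qed
  also have "?n powr t * \<omega> powr (s - 1) * (\<omega> * (b - a)) = moser_alpha ?n powr t * (b - a)"
  proof -
    have "1 / (real ?n - 1) * t = s" using n by (simp add: s_def t_def field_simps)
    then have "moser_alpha ?n powr t = ?n powr t * \<omega> powr s"
      by (simp add: moser_alpha_def \<omega>_def[symmetric] powr_mult powr_powr)
    moreover have "\<omega> powr s = \<omega> powr (s - 1) * \<omega>" using \<omega> by (simp add: powr_diff)
    ultimately show ?thesis by simp
  qed
  finally show ?thesis by (simp add: s_def t_def L_def)
qed

text \<open>
  By Taylor's formula with the remainder of Lagrange, the truncated exponential is the remainder of order \<open>n - 1\<close>.
\<close>

lemma trunc_exp_bounds: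
  assumes "2 \<le> n" "0 \<le> t"
  shows "0 \<le> trunc_exp n t" "trunc_exp n t \<le> exp t" "trunc_exp n t \<le> t ^ (n - 1) * exp t"
proof -
  have set: "{0..n - 2} = {..<n - 1}" using assms by auto
  obtain s where s: "\<bar>s\<bar> \<le> \<bar>t\<bar>" "exp t = (\<Sum>m<n - 1. t ^ m / fact m) + exp s / fact (n - 1) * t ^ (n - 1)"
    using Maclaurin_exp_le by blast
  then have eq: "trunc_exp n t = exp s / fact (n - 1) * t ^ (n - 1)"
    by (simp add: trunc_exp_def set)
  show "0 \<le> trunc_exp n t" using assms by (simp add: eq)
  have "exp s / fact (n - 1) \<le> exp s / 1" by (intro divide_left_mono) (auto simp: fact_ge_1)
  also have "\<dots> \<le> exp t" using s(1) assms by simp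
  finally have "exp s / fact (n - 1) * t ^ (n - 1) \<le> exp t * t ^ (n - 1)"
    using assms by (intro mult_right_mono) auto
  then show "trunc_exp n t \<le> t ^ (n - 1) * exp t" by (simp add: eq mult.commute)
  show "trunc_exp n t \<le> exp t" using assms by (auto simp: trunc_exp_def intro!: sum_nonneg)
qed

definition level_quantile :: "('a::euclidean_space \<Rightarrow> real) \<Rightarrow> real \<Rightarrow> real \<Rightarrow> real" where
  "level_quantile v A \<epsilon> = Inf {s. A \<le> s \<and> emeasure lborel {x. s < v x} \<le> ennreal \<epsilon>}"

text \<open>
  The measure of \<open>{s < v}\<close> is continuous from the right in \<open>s\<close>, and its left limits are the measures of
  \<open>{s \<le> v}\<close>. Hence the set strictly above the quantile has measure at most \<open>\<epsilon>\<close>, while the set above or at it has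
  measure at least \<open>\<epsilon>\<close> unless the quantile is the lower end \<open>A\<close>.
\<close>

lemma level_quantile:
  fixes v :: "'a::euclidean_space \<Rightarrow> real"
  assumes [measurable]: "v \<in> borel_measurable borel" and bdd: "\<And>x. v x \<le> B"
    and fin: "emeasure lborel {x. A < v x} < \<infinity>"
  shows level_quantile_ge: "A \<le> level_quantile v A \<epsilon>"
    and level_quantile_antimono: "\<epsilon>' \<le> \<epsilon> \<Longrightarrow> level_quantile v A \<epsilon> \<le> level_quantile v A \<epsilon>'"
    and emeasure_above_level_quantile: "emeasure lborel {x. level_quantile v A \<epsilon> < v x} \<le> ennreal \<epsilon>"
    and emeasure_above_eq_level_quantile:
      "A < level_quantile v A \<epsilon> \<Longrightarrow> ennreal \<epsilon> \<le> emeasure lborel {x. level_quantile v A \<epsilon> \<le> v x}"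
    and level_quantile_eq: "emeasure lborel {x. A < v x} \<le> ennreal \<epsilon> \<Longrightarrow> level_quantile v A \<epsilon> = A"
proof -
  define S where "S = (\<lambda>\<epsilon>. {s. A \<le> s \<and> emeasure lborel {x. s < v x} \<le> ennreal \<epsilon>})"
  have q: "level_quantile v A \<epsilon> = Inf (S \<epsilon>)" for \<epsilon> by (simp add: level_quantile_def S_def)
  have "{x. max A B < v x} = {}" using bdd by (auto simp: not_less intro: max.coboundedI2)
  then have "max A B \<in> S \<epsilon>" for \<epsilon> unfolding S_def by (simp del: max_less_iff_conj)
  then have ne: "S \<epsilon> \<noteq> {}" for \<epsilon> by blast
  have bb: "bdd_below (S \<epsilon>)" for \<epsilon> by (rule bdd_belowI[of _ A]) (simp add: S_def)
  show ge: "A \<le> level_quantile v A \<epsilon>" for \<epsilon>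
    unfolding q by (rule cInf_greatest[OF ne]) (simp add: S_def)
  show "level_quantile v A \<epsilon> \<le> level_quantile v A \<epsilon>'" if "\<epsilon>' \<le> \<epsilon>" for \<epsilon> \<epsilon>'
    unfolding q using that
    by (intro cInf_superset_mono ne bb) (auto simp: S_def intro: order_trans ennreal_leI)
  show "level_quantile v A \<epsilon> = A" if "emeasure lborel {x. A < v x} \<le> ennreal \<epsilon>"
    using ge[of \<epsilon>] that bb[of \<epsilon>] unfolding q by (intro antisym cInf_lower) (auto simp: S_def)
  let ?s = "level_quantile v A \<epsilon>"
  have above: "emeasure lborel {x. s < v x} \<le> ennreal \<epsilon>" if s: "?s < s" for s
  proof -
    obtain s' where "s' \<in> S \<epsilon>" "s' < s" using s ne bb unfolding q by (meson cInf_lessD)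
    then have "emeasure lborel {x. s < v x} \<le> emeasure lborel {x. s' < v x}"
      by (intro emeasure_mono) auto
    with \<open>s' \<in> S \<epsilon>\<close> show ?thesis by (auto simp: S_def intro: order_trans)
  qed
  show "emeasure lborel {x. ?s < v x} \<le> ennreal \<epsilon>"
  proof -
    let ?F = "\<lambda>i::nat. {x. ?s + 1 / real (Suc i) < v x}"
    have "{x. ?s < v x} = (\<Union>i. ?F i)"
    proof (intro equalityI subsetI)
      fix x assume "x \<in> {x. ?s < v x}"
      then have "0 < v x - ?s" by simp
      from reals_Archimedean[OF this] obtain i where "1 / real (Suc i) < v x - ?s"
        by (auto simp: inverse_eq_divide)
      then show "x \<in> (\<Union>i. ?F i)" by (auto intro!: exI[of _ i])
    next
      fix x assume "x \<in> (\<Union>i. ?F i)"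
      then obtain i where "?s + 1 / real (Suc i) < v x" by auto
      moreover have "0 < 1 / real (Suc i)" by simp
      ultimately have "?s < v x" by linarith
      then show "x \<in> {x. ?s < v x}" by simp
    qed
    moreover have "incseq ?F"
    proof (rule incseq_SucI, safe)
      fix i x assume "?s + 1 / real (Suc i) < v x"
      moreover have "1 / real (Suc (Suc i)) \<le> 1 / real (Suc i)" by (simp add: frac_le)
      ultimately show "?s + 1 / real (Suc (Suc i)) < v x" by linarith
    qed
    ultimately have "emeasure lborel {x. ?s < v x} = (SUP i. emeasure lborel (?F i))"
      using SUP_emeasure_incseq[of ?F lborel] by (simp add: image_subset_iff del: of_nat_Suc)
    also have "\<dots> \<le> ennreal \<epsilon>" by (intro SUP_least above) simp
    finally show ?thesis .
  qed
  show "ennreal \<epsilon> \<le> emeasure lborel {x. ?s \<le> v x}" if "A < ?s"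
  proof -
    let ?d = "\<lambda>i::nat. (?s - A) / real (Suc i)"
    let ?F = "\<lambda>i::nat. {x. ?s - ?d i < v x}"
    have d: "0 < ?d i" "?d i \<le> ?s - A" for i
      using that by (auto simp: divide_le_eq mult_le_cancel_left1 simp del: of_nat_Suc)
    have below: "ennreal \<epsilon> \<le> emeasure lborel (?F i)" for i
    proof -
      have "?s - ?d i \<notin> S \<epsilon>"
      proof
        assume "?s - ?d i \<in> S \<epsilon>"
        then have "?s \<le> ?s - ?d i" unfolding q[of \<epsilon>] by (intro cInf_lower bb)
        with d[of i] show False by linarith
      qed
      then show ?thesis using d[of i] by (auto simp: S_def)
    qed
    have "{x. ?s \<le> v x} = (\<Inter>i. ?F i)"
    proof (intro equalityI subsetI)
      fix x assume "x \<in> {x. ?s \<le> v x}"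
      then have "?s - ?d i < v x" for i using d[of i] by auto
      then show "x \<in> (\<Inter>i. ?F i)" by auto
    next
      fix x assume x: "x \<in> (\<Inter>i. ?F i)"
      show "x \<in> {x. ?s \<le> v x}"
      proof (rule ccontr)
        assume "x \<notin> {x. ?s \<le> v x}"
        then have pos: "0 < (?s - v x) / (?s - A)" using that by auto
        from reals_Archimedean[OF this] obtain i where "1 / real (Suc i) < (?s - v x) / (?s - A)"
          by (auto simp: inverse_eq_divide)
        then have "?d i < ?s - v x" using that by (simp add: pos_less_divide_eq mult.commute del: of_nat_Suc)
        moreover have "?s - ?d i < v x" using x by blast
        ultimately show False by linarith
      qed
    qed
    moreover have "decseq ?F"
    proof (rule decseq_SucI, safe)
      fix i x assume "?s - ?d (Suc i) < v x"
      moreover have "?d (Suc i) \<le> ?d i" using that by (intro divide_left_mono) auto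
      ultimately show "?s - ?d i < v x" by linarith
    qed
    moreover have "emeasure lborel (?F i) \<noteq> \<infinity>" for i
    proof -
      have "emeasure lborel (?F i) \<le> emeasure lborel {x. A < v x}"
        using d[of i] by (intro emeasure_mono) auto
      with fin show ?thesis by (auto simp: top_unique)
    qed
    ultimately have "emeasure lborel {x. ?s \<le> v x} = (INF i. emeasure lborel (?F i))"
      using INF_emeasure_decseq[of ?F lborel] by (simp add: image_subset_iff del: of_nat_Suc)
    then show ?thesis using below by (simp add: INF_greatest)
  qed
qed

section \<open>The inequality for smooth functions\<close>

text \<open>
  On the part of the space where \<open>s k < |u| \<le> s (k + 1)\<close>, which has measure at most \<open>exp (- k)\<close>, the integrand is at
  most \<open>exp (\<alpha> s (k + 1)\<^bsup>q\<^esup>)\<close>; the shift of the index costs the factor \<open>exp 1\<close>. These parts exhaust \<open>{A < |u|}\<close> up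
  to a null set.
\<close>

proposition moser_bound_level_sum:
  fixes u :: "'a::euclidean_space \<Rightarrow> real" and s :: "nat \<Rightarrow> real"
  assumes n: "2 \<le> DIM('a)" and [measurable]: "u \<in> borel_measurable borel"
    and A: "A \<le> 1" and \<alpha>: "0 \<le> \<alpha>" and q: "(real DIM('a) - 1) * q = DIM('a)" "0 < q"
    and s0: "s 0 = A" and s: "\<And>k. 0 \<le> s k"
    and meas: "\<And>k. emeasure lborel {x. s k < \<bar>u x\<bar>} \<le> ennreal (exp (- real k))"
    and u: "(\<integral>\<^sup>+x. ennreal (\<bar>u x\<bar> ^ DIM('a)) \<partial>lborel) \<le> 1"
    and sum: "(\<Sum>k. ennreal (exp (\<alpha> * s k powr q - real k))) \<le> ennreal D" "0 \<le> D"
  shows "(\<integral>\<^sup>+x. ennreal (trunc_exp DIM('a) (\<alpha> * \<bar>u x\<bar> powr q)) \<partial>lborel)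
    \<le> ennreal (\<alpha> ^ (DIM('a) - 1) * exp \<alpha> + exp 1 * D)"
proof -
  let ?n = "DIM('a)"
  let ?b = "\<alpha> ^ (?n - 1) * exp \<alpha>"
  let ?F = "\<lambda>k x. ennreal (exp (\<alpha> * s (Suc k) powr q)) * indicator {x. s k < \<bar>u x\<bar>} x"
  let ?N = "{x. \<forall>k. s k < \<bar>u x\<bar>}"
  have low: "ennreal (trunc_exp ?n (\<alpha> * \<bar>u x\<bar> powr q)) \<le> ennreal ?b * ennreal (\<bar>u x\<bar> ^ ?n)" if "\<bar>u x\<bar> \<le> 1" for x
  proof -
    have pw: "(\<bar>u x\<bar> powr q) ^ (?n - 1) = \<bar>u x\<bar> ^ ?n"
    proof (cases "u x = 0")
      case False
      then show ?thesis using n q by (simp add: powr_realpow[symmetric] powr_powr of_nat_diff mult.commute)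
    qed (use n in \<open>auto simp: power_0_left\<close>)
    have le: "\<alpha> * \<bar>u x\<bar> powr q \<le> \<alpha>"
      using that \<alpha> q by (intro mult_left_le powr_le1) auto
    have "trunc_exp ?n (\<alpha> * \<bar>u x\<bar> powr q) \<le> (\<alpha> * \<bar>u x\<bar> powr q) ^ (?n - 1) * exp (\<alpha> * \<bar>u x\<bar> powr q)"
      using n \<alpha> by (intro trunc_exp_bounds) auto
    also have "\<dots> \<le> (\<alpha> * \<bar>u x\<bar> powr q) ^ (?n - 1) * exp \<alpha>"
      using le \<alpha> by (intro mult_left_mono) auto
    also have "\<dots> = ?b * \<bar>u x\<bar> ^ ?n" by (simp only: power_mult_distrib pw mult_ac)
    finally show ?thesis using \<alpha> by (simp add: ennreal_mult[symmetric] ennreal_leI)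
  qed
  have "?N \<in> sets lborel" by measurable
  moreover have "emeasure lborel ?N = 0"
  proof -
    have "emeasure lborel ?N \<le> ennreal (exp (- real k))" for k
      by (rule order_trans[OF _ meas[of k]]) (auto intro!: emeasure_mono)
    moreover have "(\<lambda>k. ennreal (exp (- real k))) \<longlonglongrightarrow> ennreal 0"
      by (intro tendsto_ennrealI filterlim_compose[OF exp_at_bot] filterlim_compose[OF filterlim_uminus_at_bot_at_top] filterlim_real_sequentially)
    ultimately have "emeasure lborel ?N \<le> ennreal 0" by (intro LIMSEQ_le_const) auto
    then show ?thesis by simp
  qed
  ultimately have "AE x in lborel. x \<notin> ?N" by (intro AE_not_in) auto
  then have "(\<integral>\<^sup>+x. ennreal (trunc_exp ?n (\<alpha> * \<bar>u x\<bar> powr q)) \<partial>lborel)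
    \<le> (\<integral>\<^sup>+x. ennreal ?b * ennreal (\<bar>u x\<bar> ^ ?n) + (\<Sum>k. ?F k x) \<partial>lborel)"
  proof (intro nn_integral_mono_AE, eventually_elim)
    case (elim x)
    show ?case
    proof (cases "\<bar>u x\<bar> \<le> A")
      case True
      then show ?thesis using low[of x] A by (intro add_increasing2) auto
    next
      case False
      define k where "k = (LEAST k. \<bar>u x\<bar> \<le> s k)"
      have ex: "\<exists>k. \<bar>u x\<bar> \<le> s k" using elim by (auto simp: not_less)
      then have k: "\<bar>u x\<bar> \<le> s k" unfolding k_def by (rule LeastI_ex)
      then have "k \<noteq> 0" using False s0 by (metis)
      then obtain j where j: "k = Suc j" by (cases k) auto
      have "\<not> \<bar>u x\<bar> \<le> s j" using j unfolding k_def by (intro not_less_Least) simp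
      then have "ennreal (trunc_exp ?n (\<alpha> * \<bar>u x\<bar> powr q)) \<le> ?F j x"
        using k j n \<alpha> q
        by (auto intro!: ennreal_leI order_trans[OF trunc_exp_bounds(2)] mult_left_mono powr_mono2)
      also have "?F j x = sum (\<lambda>k. ?F k x) {j}" by (simp only: sum.insert sum.empty finite.emptyI empty_iff not_False_eq_True add_0_right)
      also have "\<dots> \<le> (\<Sum>k. ?F k x)" by (rule sum_le_suminf) auto
      finally show ?thesis by (intro add_increasing) auto
    qed
  qed
  also have "\<dots> = ennreal ?b * (\<integral>\<^sup>+x. ennreal (\<bar>u x\<bar> ^ ?n) \<partial>lborel) + (\<Sum>k. \<integral>\<^sup>+x. ?F k x \<partial>lborel)"
    by (simp add: nn_integral_add nn_integral_cmult nn_integral_suminf)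
  also have "\<dots> \<le> ennreal ?b * 1 + (\<Sum>k. ennreal (exp 1) * ennreal (exp (\<alpha> * s (k + 1) powr q - real (k + 1))))"
  proof (intro add_mono mult_left_mono u suminf_le)
    fix k
    have "(\<integral>\<^sup>+x. ?F k x \<partial>lborel) \<le> ennreal (exp (\<alpha> * s (Suc k) powr q)) * ennreal (exp (- real k))"
      using meas[of k] by (subst nn_integral_cmult_indicator) (auto intro: mult_left_mono)
    also have "\<dots> = ennreal (exp 1) * ennreal (exp (\<alpha> * s (k + 1) powr q - real (k + 1)))"
      by (simp add: ennreal_mult[symmetric] exp_add[symmetric])
    finally show "(\<integral>\<^sup>+x. ?F k x \<partial>lborel) \<le> ennreal (exp 1) * ennreal (exp (\<alpha> * s (k + 1) powr q - real (k + 1)))" .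
  qed auto
  also have "\<dots> = ennreal ?b + ennreal (exp 1) * (\<Sum>k. ennreal (exp (\<alpha> * s (k + 1) powr q - real (k + 1))))"
    by (subst ennreal_suminf_cmult) simp
  also have "\<dots> \<le> ennreal ?b + ennreal (exp 1) * ennreal D"
  proof (intro add_left_mono mult_left_mono)
    have "(\<Sum>k. ennreal (exp (\<alpha> * s (k + 1) powr q - real (k + 1)))) \<le> (\<Sum>k. ennreal (exp (\<alpha> * s k powr q - real k)))"
      by (subst suminf_offset[of "\<lambda>k. ennreal (exp (\<alpha> * s k powr q - real k))" 1]) auto
    with sum show "(\<Sum>k. ennreal (exp (\<alpha> * s (k + 1) powr q - real (k + 1)))) \<le> ennreal D" by simp
  qed simp
  also have "\<dots> = ennreal (?b + exp 1 * D)"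
    using sum(2) \<alpha> by (simp add: ennreal_mult[symmetric])
  finally show ?thesis .
qed

text \<open>
  The levels \<open>s\<close> are quantiles, and \<open>E k\<close> is the \<open>L\<^sup>n\<close> part of the norm plus the energy between the levels \<open>A\<close> and
  \<open>s k\<close>. The level gaps obey \<open>capacity_estimate\<close> with \<open>M = exp (- j)\<close> and a set \<open>{s k \<le> |u|}\<close> of measure at
  least \<open>exp (- k)\<close>, so that the logarithm is at most \<open>k - j\<close>. The constant \<open>D\<close> depends on the dimension only.
\<close>

theorem moser_bound_c1_compact:
  assumes n: "2 \<le> DIM('a::euclidean_space)"
  obtains D where "0 < D" "\<And>(u :: 'a \<Rightarrow> real) Du. c1_compact u Du \<Longrightarrow>
    (\<integral>\<^sup>+x. ennreal (norm (Du x) ^ DIM('a) + \<bar>u x\<bar> ^ DIM('a)) \<partial>lborel) \<le> 1 \<Longrightarrow>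
    (\<integral>\<^sup>+x. ennreal (trunc_exp DIM('a) (moser_alpha DIM('a) * \<bar>u x\<bar> powr (real DIM('a) / (real DIM('a) - 1)))) \<partial>lborel) \<le> ennreal D"
proof -
  let ?n = "DIM('a)"
  define \<sigma> t q \<alpha> C where "\<sigma> = 1 / real ?n" and "t = 1 - 1 / real ?n" and "q = real ?n / (real ?n - 1)"
    and "\<alpha> = moser_alpha ?n" and "C = kernel_const ?n"
  have \<sigma>: "0 < \<sigma>" "\<sigma> \<le> 1/2" "\<sigma> + t = 1" and t: "0 < t"
    using n by (auto simp: \<sigma>_def t_def field_simps)
  have q: "q = 1 / t" "0 < q" "(real ?n - 1) * q = real ?n" using n by (auto simp: q_def t_def field_simps)
  have \<alpha>: "0 < \<alpha>" by (simp add: \<alpha>_def moser_alpha_pos)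
  have C: "0 < C" by (simp add: C_def kernel_const_pos)
  have "0 < C + \<alpha>" using C \<alpha> by simp
  then obtain D0 where D0: "\<And>\<tau> E. moser_admissible \<sigma> t (C + \<alpha>) \<tau> E \<Longrightarrow>
    (\<Sum>k. ennreal (exp (\<tau> k powr (1/t) - real k))) \<le> ennreal D0"
    using moser_sequence_bound[OF \<sigma>] by blast
  define D where "D = \<alpha> ^ (?n - 1) * exp \<alpha> + exp 1 * \<bar>D0\<bar>"
  show thesis
  proof
    show "0 < D" using \<alpha> by (simp add: D_def add_pos_nonneg)
    fix u :: "'a \<Rightarrow> real" and Du
    assume u: "c1_compact u Du" and norm: "(\<integral>\<^sup>+x. ennreal (norm (Du x) ^ ?n + \<bar>u x\<bar> ^ ?n) \<partial>lborel) \<le> 1"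
    note [measurable] = c1_compact_measurable[OF u]
    have split: "(\<integral>\<^sup>+x. ennreal (norm (Du x) ^ ?n) \<partial>lborel) + (\<integral>\<^sup>+x. ennreal (\<bar>u x\<bar> ^ ?n) \<partial>lborel) \<le> 1"
      using norm by (subst nn_integral_add[symmetric]) (auto simp: ennreal_plus)
    define \<kappa> where "\<kappa> = enn2real (\<integral>\<^sup>+x. ennreal (\<bar>u x\<bar> ^ ?n) \<partial>lborel)"
    have u_le1: "(\<integral>\<^sup>+x. ennreal (\<bar>u x\<bar> ^ ?n) \<partial>lborel) \<le> 1"
      using split by (rule order_trans[rotated]) (simp add: add_increasing)
    then have \<kappa>: "(\<integral>\<^sup>+x. ennreal (\<bar>u x\<bar> ^ ?n) \<partial>lborel) = ennreal \<kappa>" "0 \<le> \<kappa>" "\<kappa> \<le> 1"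
      by (auto simp: \<kappa>_def ennreal_enn2real_if top_unique intro!: enn2real_leI)
    define A where "A = \<kappa> powr \<sigma>"
    have A: "0 \<le> A" "A \<le> 1" using \<kappa> \<sigma> by (auto simp: A_def intro!: powr_le1)
    have An: "A ^ ?n = \<kappa>" using \<kappa> n by (simp add: A_def \<sigma>_def powr_powr powr_realpow'[symmetric] del: DIM_positive)
    \<comment> \<open>Chebyshev's inequality; the measure bound \<open>1\<close> does not involve the support of \<open>u\<close>.\<close>
    have above_A: "emeasure lborel {x. A < \<bar>u x\<bar>} \<le> 1"
    proof (cases "\<kappa> = 0")
      case True
      then have "AE x in lborel. ennreal (\<bar>u x\<bar> ^ ?n) = 0"
        using \<kappa>(1) nn_integral_0_iff_AE[of "\<lambda>x. ennreal (\<bar>u x\<bar> ^ ?n)" lborel] by simp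
      then have "AE x in lborel. \<not> A < \<bar>u x\<bar>" by eventually_elim (use True n in \<open>auto simp: A_def\<close>)
      then have "emeasure lborel {x. A < \<bar>u x\<bar>} = 0" by (subst (asm) AE_iff_measurable[OF _ refl]) auto
      then show ?thesis by simp
    next
      case False
      have "ennreal \<kappa> * emeasure lborel {x. A < \<bar>u x\<bar>} = (\<integral>\<^sup>+x. ennreal \<kappa> * indicator {x. A < \<bar>u x\<bar>} x \<partial>lborel)"
        by (subst nn_integral_cmult_indicator) auto
      also have "\<dots> \<le> (\<integral>\<^sup>+x. ennreal (\<bar>u x\<bar> ^ ?n) \<partial>lborel)"
        using A by (intro nn_integral_mono) (auto simp: indicator_def An[symmetric] intro!: ennreal_leI power_mono)
      finally have "ennreal (1/\<kappa>) * (ennreal \<kappa> * emeasure lborel {x. A < \<bar>u x\<bar>}) \<le> ennreal (1/\<kappa>) * ennreal \<kappa>"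
        unfolding \<kappa>(1) by (rule mult_left_mono) simp
      then show ?thesis using False \<kappa> by (simp add: mult.assoc[symmetric] ennreal_mult[symmetric])
    qed
    obtain B where B: "\<And>x. \<bar>u x\<bar> \<le> B"
    proof -
      obtain R where "\<And>x. R < norm x \<Longrightarrow> u x = 0" using u by (auto simp: c1_compact_def)
      from continuous_bounded_support_bounded[OF c1_compact_continuous[OF u] this] that show thesis
        by (metis real_norm_def)
    qed
    define s where "s = (\<lambda>k::nat. level_quantile (\<lambda>x. \<bar>u x\<bar>) A (exp (- real k)))"
    have fin: "emeasure lborel {x. A < \<bar>u x\<bar>} < \<infinity>" using above_A by (auto simp: less_top[symmetric] top_unique)
    note quantile = level_quantile[of "\<lambda>x. \<bar>u x\<bar>" B A, OF _ B fin, simplified]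
    have s_ge: "A \<le> s k" for k unfolding s_def by (rule quantile(1))
    have s_mono: "s j \<le> s k" if "j \<le> k" for j k unfolding s_def using that by (intro quantile(2)) auto
    have s_meas: "emeasure lborel {x. s k < \<bar>u x\<bar>} \<le> ennreal (exp (- real k))" for k unfolding s_def by (rule quantile(3))
    have s_meas': "ennreal (exp (- real k)) \<le> emeasure lborel {x. s k \<le> \<bar>u x\<bar>}" if "A < s k" for k
      using that unfolding s_def by (rule quantile(4))
    have s0: "s 0 = A" unfolding s_def using above_A by (intro quantile(5)) auto
    have s_nonneg: "0 \<le> s k" for k using s_ge[of k] A by simp
    let ?layer = "\<lambda>a b. {x. a < \<bar>u x\<bar> \<and> \<bar>u x\<bar> < b}"
    define J where "J = (\<lambda>a b. enn2real (\<integral>\<^sup>+z. indicator (?layer a b) z * ennreal (norm (Du z) ^ ?n) \<partial>lborel))"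
    have Du_le: "(\<integral>\<^sup>+x. ennreal (norm (Du x) ^ ?n) \<partial>lborel) + ennreal \<kappa> \<le> 1"
      using split \<kappa> by simp
    have J_le: "(\<integral>\<^sup>+z. indicator S z * ennreal (norm (Du z) ^ ?n) \<partial>lborel) \<le> (\<integral>\<^sup>+x. ennreal (norm (Du x) ^ ?n) \<partial>lborel)" for S
      by (intro nn_integral_mono) (auto simp: indicator_def)
    have J: "(\<integral>\<^sup>+z. indicator (?layer a b) z * ennreal (norm (Du z) ^ ?n) \<partial>lborel) = ennreal (J a b)" "0 \<le> J a b" for a b
    proof -
      have "(\<integral>\<^sup>+x. ennreal (norm (Du x) ^ ?n) \<partial>lborel) \<le> 1" using Du_le by (rule order_trans[rotated]) (simp add: add_increasing2)
      then have "(\<integral>\<^sup>+z. indicator (?layer a b) z * ennreal (norm (Du z) ^ ?n) \<partial>lborel) \<le> 1" using J_le order_trans by blast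
      then show "(\<integral>\<^sup>+z. indicator (?layer a b) z * ennreal (norm (Du z) ^ ?n) \<partial>lborel) = ennreal (J a b)"
        by (auto simp: J_def ennreal_enn2real_if top_unique)
    qed (simp add: J_def)
    have J_add: "J a b + J b c \<le> J a c" if "a \<le> b" "b \<le> c" for a b c
    proof -
      have "ennreal (J a b + J b c) = (\<integral>\<^sup>+z. indicator (?layer a b) z * ennreal (norm (Du z) ^ ?n) + indicator (?layer b c) z * ennreal (norm (Du z) ^ ?n) \<partial>lborel)"
        by (subst nn_integral_add) (auto simp: J ennreal_plus)
      also have "\<dots> \<le> (\<integral>\<^sup>+z. indicator (?layer a c) z * ennreal (norm (Du z) ^ ?n) \<partial>lborel)"
        using that by (intro nn_integral_mono) (auto simp: indicator_def)
      finally have "ennreal (J a b + J b c) \<le> ennreal (J a c)" unfolding J(1) .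
      then show ?thesis by (rule ennreal_le_iff[THEN iffD1, rotated]) (rule J)
    qed
    define E where "E = (\<lambda>k. \<kappa> + J A (s k))"
    have E_diff: "J (s j) (s k) \<le> E k - E j" if "j \<le> k" for j k
      using J_add[OF s_ge s_mono[OF that]] by (simp add: E_def)
    have E_le1: "E k \<le> 1" for k
    proof -
      have "ennreal (E k) = ennreal (J A (s k)) + ennreal \<kappa>" using J \<kappa> by (simp add: E_def add.commute)
      also have "\<dots> \<le> (\<integral>\<^sup>+x. ennreal (norm (Du x) ^ ?n) \<partial>lborel) + ennreal \<kappa>"
        unfolding J(1)[symmetric] by (intro add_right_mono J_le)
      also have "\<dots> \<le> 1" by (rule Du_le)
      finally show ?thesis by (simp add: ennreal_le_1)
    qed
    define \<tau> where "\<tau> = (\<lambda>k. \<alpha> powr t * s k)"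
    have gap: "\<tau> k - \<tau> j \<le> J (s j) (s k) powr \<sigma> * (real k - real j + C) powr t" if "j < k" for j k
    proof (cases "s j = s k")
      case False
      then have less: "s j < s k" using s_mono[of j k] that by simp
      define m where "m = measure lborel {x. s k \<le> \<bar>u x\<bar>}"
      have sub: "emeasure lborel {x. s k \<le> \<bar>u x\<bar>} \<le> ennreal (exp (- real j))"
        using less by (intro order_trans[OF emeasure_mono s_meas[of j]]) auto
      then have m: "emeasure lborel {x. s k \<le> \<bar>u x\<bar>} = ennreal m" unfolding m_def
        by (intro emeasure_eq_ennreal_measure) (auto simp: top_unique)
      have "ennreal (exp (- real k)) \<le> ennreal m"
        using s_meas'[of k] s_ge[of j] less m by simp
      then have m_ge: "exp (- real k) \<le> m" by (simp add: m_def)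
      have m_le: "m \<le> exp (- real j)" using sub m by simp
      have m0: "0 < m" using m_ge by (rule less_le_trans[rotated]) simp
      have "\<alpha> powr (1 - 1 / ?n) * (s k - s j) \<le> J (s j) (s k) powr (1 / ?n) * (ln (exp (- real j) / m) + kernel_const ?n) powr (1 - 1 / ?n)"
        unfolding \<alpha>_def
      proof (rule capacity_estimate[OF n u s_nonneg less m m0 m_le])
        show "emeasure lborel (?layer (s j) (s k)) \<le> ennreal (exp (- real j))"
          by (intro order_trans[OF emeasure_mono s_meas[of j]]) auto
      qed (use J in auto)
      also have "\<dots> \<le> J (s j) (s k) powr \<sigma> * (real k - real j + C) powr t"
      proof -
        have "ln (exp (- real k)) \<le> ln m" using m_ge m0 by (subst ln_le_cancel_iff) auto
        then have "ln (exp (- real j) / m) \<le> real k - real j" using m0 by (simp add: ln_div)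
        moreover have "0 \<le> ln (exp (- real j) / m)" using m_le m0 by simp
        ultimately show ?thesis unfolding t_def[symmetric] unfolding \<sigma>_def[symmetric] C_def[symmetric]
          using C t by (intro mult_left_mono powr_mono2) auto
      qed
      finally show ?thesis by (simp add: \<tau>_def t_def algebra_simps)
    qed (simp add: \<tau>_def)
    have "(\<Sum>k. ennreal (exp (\<tau> k powr (1/t) - real k))) \<le> ennreal D0"
    proof (rule D0, unfold moser_admissible_def, intro conjI allI impI)
      fix k show "0 \<le> \<tau> k" using s_nonneg by (simp add: \<tau>_def)
      show "0 \<le> E k" using J \<kappa> by (simp add: E_def)
      show "E k \<le> 1" by (rule E_le1)
      have "\<tau> k - \<tau> 0 \<le> J A (s k) powr \<sigma> * (real k + C) powr t"
        using gap[of 0 k] s0 by (cases "k = 0") auto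
      then have "\<tau> k \<le> \<kappa> powr \<sigma> * \<alpha> powr t + J A (s k) powr \<sigma> * (real k + C) powr t"
        using s0 by (simp add: \<tau>_def A_def mult.commute)
      \<comment> \<open>The first level counts as one more layer: it has energy \<open>\<kappa>\<close> and takes the additional distance \<open>\<alpha>\<close>.\<close>
      also have "\<dots> \<le> (\<kappa> + J A (s k)) powr \<sigma> * (\<alpha> + (real k + C)) powr t"
        using \<kappa> J \<alpha> C \<sigma> t by (intro holder_two_terms) auto
      finally show "\<tau> k \<le> E k powr \<sigma> * (real k + (C + \<alpha>)) powr t" by (simp add: E_def add_ac)
    next
      fix j k :: nat assume jk: "j < k"
      note gap[OF jk]
      also have "J (s j) (s k) powr \<sigma> * (real k - real j + C) powr t \<le> (E k - E j) powr \<sigma> * (real k - real j + (C + \<alpha>)) powr t"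
        using E_diff[of j k] J jk C \<alpha> \<sigma> t by (intro mult_mono powr_mono2) auto
      finally show "\<tau> k - \<tau> j \<le> (E k - E j) powr \<sigma> * (real k - real j + (C + \<alpha>)) powr t" .
      show "E j \<le> E k" using E_diff[of j k] J(2)[of "s j" "s k"] jk by simp
    qed
    moreover have "\<tau> k powr (1/t) = \<alpha> * s k powr q" for k
      using \<alpha> t s_nonneg by (simp add: \<tau>_def powr_mult powr_powr q(1))
    ultimately have "(\<Sum>k. ennreal (exp (\<alpha> * s k powr q - real k))) \<le> ennreal \<bar>D0\<bar>"
      by (auto intro: order_trans ennreal_leI)
    then show "(\<integral>\<^sup>+x. ennreal (trunc_exp ?n (moser_alpha ?n * \<bar>u x\<bar> powr (real ?n / (real ?n - 1)))) \<partial>lborel) \<le> ennreal D"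
      unfolding D_def \<alpha>_def[symmetric] q_def[symmetric]
      using n A \<alpha> q s0 s_nonneg s_meas u_le1 by (intro moser_bound_level_sum) auto
  qed
qed

section \<open>Smooth functions and gradients\<close>

lemma has_derivative_imp_frechet:
  "(f has_derivative f') (at x) \<Longrightarrow> frechet_derivative f (at x) = f'"
  by (rule frechet_derivative_at[symmetric])

lemma k_times_cont_diff_Suc: "k_times_cont_diff (Suc k) f \<Longrightarrow> k_times_cont_diff k f"
proof (induction k arbitrary: f)
  case 0
  then show ?case
    by (auto intro!: continuous_at_imp_continuous_on differentiable_imp_continuous_within)
next
  case (Suc k)
  then show ?case by (metis k_times_cont_diff.simps(2))
qed

lemma k_times_cont_diff_SucI:
  assumes "\<And>x. (f has_derivative f' x) (at x)"
    and "\<And>b. b \<in> Basis \<Longrightarrow> k_times_cont_diff k (\<lambda>x. f' x b)"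
  shows "k_times_cont_diff (Suc k) f"
  using assms by (auto simp: has_derivative_imp_frechet[OF assms(1)] intro: differentiableI)

lemma k_times_cont_diff_SucD:
  assumes "k_times_cont_diff (Suc k) f"
  shows "(f has_derivative frechet_derivative f (at x)) (at x)"
  using assms by (simp add: frechet_derivative_works[symmetric])

lemma k_times_cont_diff_const: "k_times_cont_diff k (\<lambda>x. c)"
proof (induction k arbitrary: c)
  case (Suc k)
  show ?case by (rule k_times_cont_diff_SucI[where f' = "\<lambda>_ _. 0"]) (use Suc in auto)
qed simp

lemma k_times_cont_diff_inner: "k_times_cont_diff k (\<lambda>x. x \<bullet> a)"
proof (cases k)
  case (Suc j)
  show ?thesis unfolding Suc
    by (rule k_times_cont_diff_SucI[where f' = "\<lambda>_ h. h \<bullet> a"])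
       (auto intro!: derivative_eq_intros k_times_cont_diff_const)
qed (auto intro: continuous_intros)

lemma k_times_cont_diff_add:
  "k_times_cont_diff k f \<Longrightarrow> k_times_cont_diff k g \<Longrightarrow> k_times_cont_diff k (\<lambda>x. f x + g x)"
proof (induction k arbitrary: f g)
  case (Suc k)
  show ?case
  proof (rule k_times_cont_diff_SucI)
    show "((\<lambda>x. f x + g x) has_derivative (\<lambda>h. frechet_derivative f (at x) h + frechet_derivative g (at x) h)) (at x)" for x
      by (intro has_derivative_add k_times_cont_diff_SucD[OF Suc.prems(1)] k_times_cont_diff_SucD[OF Suc.prems(2)])
  qed (use Suc in auto)
qed (auto intro: continuous_intros)

lemma k_times_cont_diff_mult:
  "k_times_cont_diff k f \<Longrightarrow> k_times_cont_diff k g \<Longrightarrow> k_times_cont_diff k (\<lambda>x. f x * g x)"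
proof (induction k arbitrary: f g)
  case (Suc k)
  note k = Suc.prems[THEN k_times_cont_diff_Suc]
  show ?case
  proof (rule k_times_cont_diff_SucI)
    show "((\<lambda>x. f x * g x) has_derivative (\<lambda>h. f x * frechet_derivative g (at x) h + frechet_derivative f (at x) h * g x)) (at x)" for x
      by (intro has_derivative_mult k_times_cont_diff_SucD[OF Suc.prems(1)] k_times_cont_diff_SucD[OF Suc.prems(2)])
    show "k_times_cont_diff k (\<lambda>x. f x * frechet_derivative g (at x) b + frechet_derivative f (at x) b * g x)" if "b \<in> Basis" for b
      using Suc that k by (intro k_times_cont_diff_add Suc.IH) auto
  qed
qed (auto intro: continuous_intros)

text \<open>
  The induction needs the statement for all iterated derivatives of the outer function at once, so these are given
  as a sequence \<open>G\<close> in which each member differentiates to the next.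
\<close>

lemma k_times_cont_diff_compose:
  fixes f :: "'a::euclidean_space \<Rightarrow> real" and G :: "nat \<Rightarrow> real \<Rightarrow> real"
  assumes G: "\<And>i t. t \<in> S \<Longrightarrow> (G i has_real_derivative G (Suc i) t) (at t)"
    and f: "k_times_cont_diff k f" "\<And>x. f x \<in> S"
  shows "k_times_cont_diff k (\<lambda>x. G i (f x))"
  using f(1)
proof (induction k arbitrary: i)
  case 0
  then have f_cont: "continuous_on UNIV f" by simp
  have "continuous_on S (G i)"
    using G by (meson DERIV_continuous_on has_field_derivative_at_within)
  then show ?case
    using f(2) by (simp, intro continuous_on_compose2[OF _ f_cont]) auto
next
  case (Suc k)
  show ?case
  proof (rule k_times_cont_diff_SucI)
    fix x
    have "(G i has_derivative (*) (G (Suc i) (f x))) (at (f x))"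
      using G[OF f(2)] by (simp add: has_field_derivative_def)
    from has_derivative_compose[OF k_times_cont_diff_SucD[OF Suc.prems] this]
    show "((\<lambda>x. G i (f x)) has_derivative (\<lambda>h. G (Suc i) (f x) * frechet_derivative f (at x) h)) (at x)" .
  next
    fix b :: 'a assume "b \<in> Basis"
    then show "k_times_cont_diff k (\<lambda>x. G (Suc i) (f x) * frechet_derivative f (at x) b)"
      using Suc by (intro k_times_cont_diff_mult Suc.IH k_times_cont_diff_Suc[OF Suc.prems]) auto
  qed
qed

definition smooth :: "('a::euclidean_space \<Rightarrow> real) \<Rightarrow> bool" where
  "smooth f \<longleftrightarrow> (\<forall>k. k_times_cont_diff k f)"

lemma smooth_const: "smooth (\<lambda>x. c)"
  and smooth_inner: "smooth (\<lambda>x. x \<bullet> a)"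
  and smooth_add: "smooth f \<Longrightarrow> smooth g \<Longrightarrow> smooth (\<lambda>x. f x + g x)"
  and smooth_mult: "smooth f \<Longrightarrow> smooth g \<Longrightarrow> smooth (\<lambda>x. f x * g x)"
  by (auto simp: smooth_def k_times_cont_diff_const k_times_cont_diff_inner k_times_cont_diff_add k_times_cont_diff_mult)

lemma smooth_diff: "smooth f \<Longrightarrow> smooth g \<Longrightarrow> smooth (\<lambda>x. f x - g x)"
  using smooth_add[of f "\<lambda>x. (-1) * g x"] smooth_mult[OF smooth_const, of g "-1"] by simp

lemma smooth_sum: "finite I \<Longrightarrow> (\<And>i. i \<in> I \<Longrightarrow> smooth (f i)) \<Longrightarrow> smooth (\<lambda>x. \<Sum>i\<in>I. f i x)"
  by (induction I rule: finite_induct) (auto intro: smooth_const smooth_add)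

lemma smooth_prod: "finite I \<Longrightarrow> (\<And>i. i \<in> I \<Longrightarrow> smooth (f i)) \<Longrightarrow> smooth (\<lambda>x. \<Prod>i\<in>I. f i x)"
  by (induction I rule: finite_induct) (auto intro: smooth_const smooth_mult)

lemma smooth_compose:
  assumes "\<And>i t. t \<in> S \<Longrightarrow> (G i has_real_derivative G (Suc i) t) (at t)" "smooth f" "\<And>x. f x \<in> S"
  shows "smooth (\<lambda>x. G 0 (f x))"
  using assms k_times_cont_diff_compose[of S G _ f 0] by (auto simp: smooth_def)

lemma smooth_dist_squared: "smooth (\<lambda>x::'a::euclidean_space. (norm (x - a))\<^sup>2)"
proof -
  have "smooth (\<lambda>x::'a. \<Sum>b\<in>Basis. (x \<bullet> b - a \<bullet> b) * (x \<bullet> b - a \<bullet> b))"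
    by (intro smooth_sum smooth_mult smooth_diff smooth_inner smooth_const finite_Basis)
  moreover have "(norm (x - a))\<^sup>2 = (\<Sum>b\<in>Basis. (x \<bullet> b - a \<bullet> b) * (x \<bullet> b - a \<bullet> b))" for x
    unfolding power2_norm_eq_inner by (subst euclidean_inner) (simp add: inner_diff_left)
  ultimately show ?thesis by simp
qed

lemma smooth_ln:
  assumes "smooth f" "\<And>x. 0 < f x"
  shows "smooth (\<lambda>x. ln (f x))"
proof -
  define G where "G = (\<lambda>i t::real. case i of 0 \<Rightarrow> ln t | Suc j \<Rightarrow> (-1) ^ j * fact j * inverse t ^ Suc j)"
  have "(G i has_real_derivative G (Suc i) t) (at t)" if "t \<in> {0<..}" for i t
  proof (cases i)
    case 0
    then show ?thesis using that by (auto simp: G_def intro!: derivative_eq_intros simp: inverse_eq_divide)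
  next
    case (Suc j)
    have "((\<lambda>t. (-1) ^ j * fact j * inverse t ^ Suc j) has_real_derivative
      (-1) ^ j * fact j * ((1 + real j) * (- (inverse t ^ Suc (Suc 0)) * inverse t ^ j))) (at t)"
      using that by (intro DERIV_cmult DERIV_power_Suc DERIV_inverse) auto
    then show ?thesis by (simp add: Suc G_def algebra_simps)
  qed
  from smooth_compose[of "{0<..}" G, OF this assms(1)] show ?thesis
    using assms(2) by (simp add: G_def)
qed

text \<open>
  The functions \<open>p (1/t) exp (- 1/t)\<close> with a polynomial \<open>p\<close>, extended by zero, are closed under differentiation; this
  makes the standard flat function smooth.
\<close>

definition flat :: "real poly \<Rightarrow> real \<Rightarrow> real" where
  "flat p t = (if 0 < t then poly p (1 / t) * exp (- (1 / t)) else 0)"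

lemma tendsto_poly_mult_exp_at_top:
  fixes p :: "real poly"
  shows "((\<lambda>y. poly p y * y ^ k * exp (- y)) \<longlongrightarrow> 0) at_top"
proof (induction p arbitrary: k)
  case (pCons a p)
  have "((\<lambda>y. a * (y ^ k / exp y) + poly p y * y ^ Suc k * exp (- y)) \<longlongrightarrow> a * 0 + 0) at_top"
    by (intro tendsto_add tendsto_mult tendsto_const tendsto_power_div_exp_0 pCons.IH)
  then show ?case by (simp add: algebra_simps exp_minus divide_inverse)
qed simp

lemma flat_has_derivative:
  "(flat p has_real_derivative flat ([:0, 0, 1:] * (p - pderiv p)) t) (at t)"
proof -
  consider "0 < t" | "t < 0" | "t = 0" by linarith
  then show ?thesis
  proof cases
    case 1
    have "((\<lambda>t. poly p (1 / t) * exp (- (1 / t))) has_real_derivative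
      poly ([:0, 0, 1:] * (p - pderiv p)) (1 / t) * exp (- (1 / t))) (at t)"
    proof -
      have inv: "((\<lambda>t. 1 / t) has_real_derivative - (1 / t\<^sup>2)) (at t)"
        using 1 by (auto intro!: derivative_eq_intros simp: power2_eq_square)
      have "((\<lambda>t. poly p (1 / t) * exp (- (1 / t))) has_real_derivative
        (poly (pderiv p) (1 / t) * - (1 / t\<^sup>2)) * exp (- (1 / t)) + (exp (- (1 / t)) * - (- (1 / t\<^sup>2))) * poly p (1 / t)) (at t)"
        by (rule DERIV_mult[OF DERIV_chain2[OF poly_DERIV inv] DERIV_chain2[OF DERIV_exp DERIV_minus[OF inv]]])
      moreover have "(poly (pderiv p) (1 / t) * - (1 / t\<^sup>2)) * exp (- (1 / t)) + (exp (- (1 / t)) * - (- (1 / t\<^sup>2))) * poly p (1 / t)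
        = poly ([:0, 0, 1:] * (p - pderiv p)) (1 / t) * exp (- (1 / t))"
        by (simp add: power2_eq_square algebra_simps)
      ultimately show ?thesis by simp
    qed
    then have "((\<lambda>t. poly p (1 / t) * exp (- (1 / t))) has_real_derivative flat ([:0, 0, 1:] * (p - pderiv p)) t) (at t)"
      using 1 by (simp add: flat_def)
    then show ?thesis
      by (rule has_field_derivative_transform_within_open[of _ _ _ "{0<..}"]) (use 1 in \<open>auto simp: flat_def\<close>)
  next
    case 2
    have "((\<lambda>t. 0) has_real_derivative flat ([:0, 0, 1:] * (p - pderiv p)) t) (at t)"
      using 2 by (simp add: flat_def)
    then show ?thesis
      by (rule has_field_derivative_transform_within_open[of _ _ _ "{..<0}"]) (use 2 in \<open>auto simp: flat_def\<close>)
  next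
    case 3
    have "((\<lambda>h. flat p h / h) \<longlongrightarrow> 0) (at 0)"
    proof (rule filterlim_split_at_real)
      show "((\<lambda>h. flat p h / h) \<longlongrightarrow> 0) (at_left 0)"
        by (rule tendsto_eventually) (auto simp: eventually_at_filter flat_def)
      have "((\<lambda>h. poly p (inverse h) * inverse h ^ 1 * exp (- inverse h)) \<longlongrightarrow> 0) (at_right 0)"
        by (rule filterlim_compose[OF tendsto_poly_mult_exp_at_top filterlim_inverse_at_top_right])
      then show "((\<lambda>h. flat p h / h) \<longlongrightarrow> 0) (at_right 0)"
        by (rule Lim_transform_eventually)
           (auto simp: eventually_at_filter flat_def divide_inverse mult_ac)
    qed
    then show ?thesis using 3 by (simp add: DERIV_def flat_def)
  qed
qed

definition flat_exp :: "real \<Rightarrow> real" where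
  "flat_exp t = (if 0 < t then exp (- (1 / t)) else 0)"

lemma smooth_flat_exp: 
  assumes "smooth f"
  shows "smooth (\<lambda>x. flat_exp (f x))"
proof -
  define G where "G = (\<lambda>i. flat (((\<lambda>p. [:0, 0, 1:] * (p - pderiv p)) ^^ i) 1))"
  have "(G i has_real_derivative G (Suc i) t) (at t)" for i t
    using flat_has_derivative by (simp add: G_def)
  then have "smooth (\<lambda>x. G 0 (f x))" by (rule smooth_compose[of UNIV, OF _ assms]) auto
  then show ?thesis by (simp add: G_def flat_def flat_exp_def cong: if_cong)
qed

lemma flat_exp_bounds: "0 \<le> flat_exp t" "flat_exp t \<le> 1" "0 < flat_exp t \<longleftrightarrow> 0 < t" "flat_exp t = 0 \<longleftrightarrow> t \<le> 0"
  by (auto simp: flat_exp_def)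

definition gradient :: "('a::euclidean_space \<Rightarrow> real) \<Rightarrow> 'a \<Rightarrow> 'a" where
  "gradient f x = (\<Sum>b\<in>Basis. frechet_derivative f (at x) b *\<^sub>R b)"

lemma gradient_inner_Basis: "b \<in> Basis \<Longrightarrow> gradient f x \<bullet> b = frechet_derivative f (at x) b"
  by (simp add: gradient_def)

lemma gradient_eqI:
  assumes "(f has_derivative (\<lambda>h. g \<bullet> h)) (at x)"
  shows "gradient f x = g"
  unfolding gradient_def[of f] has_derivative_imp_frechet[OF assms] by (rule euclidean_representation)

lemma frechet_eq_gradient:
  assumes "f differentiable (at x)"
  shows "frechet_derivative f (at x) = (\<lambda>h. gradient f x \<bullet> h)"
proof
  fix h
  interpret bounded_linear "frechet_derivative f (at x)"
    using assms by (simp add: frechet_derivative_works has_derivative_bounded_linear)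
  have "frechet_derivative f (at x) h = frechet_derivative f (at x) (\<Sum>b\<in>Basis. (h \<bullet> b) *\<^sub>R b)"
    by (simp add: euclidean_representation)
  also have "\<dots> = (\<Sum>b\<in>Basis. (h \<bullet> b) * frechet_derivative f (at x) b)" by (simp add: sum scale)
  also have "\<dots> = gradient f x \<bullet> h" unfolding gradient_def inner_sum_left inner_scaleR_left by (simp add: inner_commute mult.commute)
  finally show "frechet_derivative f (at x) h = gradient f x \<bullet> h" .
qed

lemma smooth_has_derivative_gradient:
  assumes "smooth f"
  shows "(f has_derivative (\<lambda>h. gradient f x \<bullet> h)) (at x)"
proof -
  have "k_times_cont_diff (Suc 0) f" using assms by (simp add: smooth_def del: k_times_cont_diff.simps)
  from k_times_cont_diff_SucD[OF this] show ?thesis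
    by (metis differentiableI frechet_eq_gradient)
qed

lemma smooth_continuous_gradient: 
  assumes "smooth f"
  shows "continuous_on UNIV (gradient f)"
proof -
  have "k_times_cont_diff (Suc 0) f" using assms by (simp add: smooth_def del: k_times_cont_diff.simps)
  then have "continuous_on UNIV (\<lambda>x. frechet_derivative f (at x) b)" if "b \<in> Basis" for b using that by simp
  then show ?thesis unfolding gradient_def by (intro continuous_intros)
qed

lemma test_function_smooth: "\<phi> \<in> test_functions \<Omega> \<Longrightarrow> smooth \<phi>"
  by (simp add: test_functions_def smooth_def)

lemma test_functionI:
  assumes "smooth \<phi>" "{x. \<phi> x \<noteq> 0} \<subseteq> K" "compact K" "K \<subseteq> \<Omega>"
  shows "\<phi> \<in> test_functions \<Omega>"
proof -
  have "closure {x. \<phi> x \<noteq> 0} \<subseteq> K" using assms by (simp add: closure_minimal compact_imp_closed)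
  then have "compact (closure {x. \<phi> x \<noteq> 0})"
    using assms(3) compact_Int_closed[of K "closure {x. \<phi> x \<noteq> 0}"] by (simp add: Int_absorb1)
  with \<open>closure {x. \<phi> x \<noteq> 0} \<subseteq> K\<close> assms show ?thesis by (auto simp: test_functions_def smooth_def)
qed

lemma test_function_c1_compact:
  assumes "\<phi> \<in> test_functions \<Omega>"
  shows "c1_compact \<phi> (gradient \<phi>)"
proof -
  have "bounded (closure {x. \<phi> x \<noteq> 0})" using assms by (auto simp: test_functions_def compact_imp_bounded)
  then obtain R where "\<forall>x\<in>closure {x. \<phi> x \<noteq> 0}. norm x \<le> R" by (auto simp: bounded_iff)
  then have "\<forall>x. R < norm x \<longrightarrow> \<phi> x = 0" using closure_subset[of "{x. \<phi> x \<noteq> 0}"] by force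
  then show ?thesis
    using smooth_has_derivative_gradient smooth_continuous_gradient test_function_smooth[OF assms]
    by (auto simp: c1_compact_def)
qed

lemma test_function_zero_outside:
  assumes "\<phi> \<in> test_functions \<Omega>" "x \<notin> \<Omega>"
  shows "\<phi> x = 0" "gradient \<phi> x = 0"
proof -
  let ?S = "closure {x. \<phi> x \<noteq> 0}"
  have x: "x \<notin> ?S" using assms by (auto simp: test_functions_def)
  then show "\<phi> x = 0" using closure_subset[of "{x. \<phi> x \<noteq> 0}"] by auto
  have "((\<lambda>_. 0) has_derivative (\<lambda>_. 0)) (at x)" by simp
  then have "(\<phi> has_derivative (\<lambda>_. 0)) (at x)"
    by (rule has_derivative_transform_within_open[of _ _ _ _ "- ?S"])
       (use x closure_subset[of "{x. \<phi> x \<noteq> 0}"] in auto)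
  then show "gradient \<phi> x = 0" by (simp add: gradient_def has_derivative_imp_frechet)
qed

section \<open>Uniqueness of weak gradients\<close>

lemma c1_compact_vanishing:
  assumes "c1_compact u Du"
  obtains R where "0 < R" "\<And>x. R < norm x \<Longrightarrow> u x = 0" "\<And>x. R < norm x \<Longrightarrow> Du x = 0"
proof -
  from assms obtain R where R: "\<And>x. R < norm x \<Longrightarrow> u x = 0" and du: "\<And>x. (u has_derivative (\<lambda>h. Du x \<bullet> h)) (at x)"
    by (auto simp: c1_compact_def)
  have "Du x = 0" if "\<bar>R\<bar> + 1 < norm x" for x
  proof -
    have "open {x. R < norm x}" by (intro open_Collect_less continuous_intros)
    have "((\<lambda>_. 0) has_derivative (\<lambda>_. 0)) (at x)" by simp
    then have "(u has_derivative (\<lambda>_. 0)) (at x)"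
      by (rule has_derivative_transform_within_open[OF _ \<open>open {x. R < norm x}\<close>]) (use that R in auto)
    then have "(\<lambda>h. Du x \<bullet> h) = (\<lambda>_. 0)" using du has_derivative_unique by blast
    then show ?thesis by (metis inner_eq_zero_iff)
  qed
  then show thesis using R by (intro that[of "\<bar>R\<bar> + 1"]) auto
qed

lemma integrable_continuous_bounded_support:
  fixes f :: "'a::euclidean_space \<Rightarrow> real"
  assumes f: "continuous_on UNIV f" and R: "\<And>x. R < norm x \<Longrightarrow> f x = 0"
  shows "integrable lborel f"
proof -
  from f R obtain B where B: "0 \<le> B" "\<And>x. norm (f x) \<le> B" by (rule continuous_bounded_support_bounded) blast+
  have [measurable]: "f \<in> borel_measurable borel" using f by (rule borel_measurable_continuous_onI)
  show ?thesis
  proof (rule integrableI_bounded_set[where A = "cball 0 R" and B = B])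
    show "emeasure lborel (cball 0 R :: 'a set) < \<infinity>" by (rule emeasure_compact_finite) simp
  qed (use B R in \<open>auto simp: not_le\<close>)
qed

text \<open>
  Difference quotients have integral zero by translation invariance, and they converge to the derivative with a common
  bound and a common bounded support.
\<close>

lemma integral_partial_derivative_eq_0:
  fixes u :: "'a::euclidean_space \<Rightarrow> real"
  assumes u: "c1_compact u Du" and b: "b \<in> Basis"
  shows "(\<integral>x. Du x \<bullet> b \<partial>lborel) = 0"
proof -
  note [measurable] = c1_compact_measurable[OF u]
  from u have du: "\<And>x. (u has_derivative (\<lambda>h. Du x \<bullet> h)) (at x)" and cD: "continuous_on UNIV Du"
    by (auto simp: c1_compact_def)
  obtain R where R: "0 < R" "\<And>x. R < norm x \<Longrightarrow> u x = 0" "\<And>x. R < norm x \<Longrightarrow> Du x = 0"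
    using c1_compact_vanishing[OF u] by blast
  from cD R(3) obtain L where L: "0 \<le> L" "\<And>x. norm (Du x) \<le> L" by (rule continuous_bounded_support_bounded) blast+
  have u_int: "integrable lborel u"
    by (rule integrable_continuous_bounded_support[OF c1_compact_continuous[OF u] R(2)])
  define h where "h = (\<lambda>k::nat. inverse (real (Suc k)))"
  have h: "0 < h k" "h k \<le> 1" for k by (auto simp: h_def inverse_le_1_iff)
  let ?D = "\<lambda>k x. (u (x + h k *\<^sub>R b) - u x) / h k"
  have shift_int: "integrable lborel (\<lambda>x. u (x + h k *\<^sub>R b))" "(\<integral>x. u (x + h k *\<^sub>R b) \<partial>lborel) = (\<integral>x. u x \<partial>lborel)" for k
    using u_int lborel_distr_plus[of "h k *\<^sub>R b"]
      integrable_distr_eq[of "(+) (h k *\<^sub>R b)" lborel borel u] integral_distr[of "(+) (h k *\<^sub>R b)" lborel borel u]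
    by (auto simp: add.commute)
  have D0: "(\<integral>x. ?D k x \<partial>lborel) = 0" for k
    using shift_int u_int by (simp add: Bochner_Integration.integral_diff)
  have lip: "\<bar>u (x + y) - u x\<bar> \<le> L * norm y" for x y
  proof -
    have "norm (u (x + y) - u x) \<le> L * norm (x + y - x)"
    proof (rule differentiable_bound[of UNIV])
      fix z show "(u has_derivative (\<lambda>h. Du z \<bullet> h)) (at z within UNIV)" using du by simp
      show "onorm (\<lambda>h. Du z \<bullet> h) \<le> L"
        using L(1) order_trans[OF Cauchy_Schwarz_ineq2[of "Du z"] mult_right_mono[OF L(2)[of z]]]
        by (intro onorm_bound) auto
    qed auto
    then show ?thesis by simp
  qed
  have "(\<lambda>k. \<integral>x. ?D k x \<partial>lborel) \<longlonglongrightarrow> (\<integral>x. Du x \<bullet> b \<partial>lborel)"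
  proof (rule integral_dominated_convergence[where w = "\<lambda>x. L * indicator (cball 0 (R + 1)) x"])
    show "integrable lborel (\<lambda>x::'a. L * indicator (cball 0 (R + 1)) x)"
      by (intro integrable_mult_right integrable_real_indicator emeasure_compact_finite) auto
    show "AE x in lborel. (\<lambda>k. ?D k x) \<longlonglongrightarrow> Du x \<bullet> b"
    proof (rule AE_I2)
      fix x
      have "((\<lambda>t. x + t *\<^sub>R b) has_derivative (\<lambda>h. h *\<^sub>R b)) (at 0)"
        by (auto intro!: derivative_eq_intros)
      from has_derivative_compose[OF this du[of "x + 0 *\<^sub>R b"]]
      have "((\<lambda>t. u (x + t *\<^sub>R b)) has_real_derivative Du x \<bullet> b) (at 0)"
        by (simp add: has_field_derivative_def mult_commute_abs)
      then have "((\<lambda>t. (u (x + t *\<^sub>R b) - u x) / t) \<longlongrightarrow> Du x \<bullet> b) (at 0)"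
        by (simp add: DERIV_def)
      moreover have "filterlim h (at 0) sequentially"
        using LIMSEQ_inverse_real_of_nat h(1) by (auto simp: filterlim_at h_def)
      ultimately show "(\<lambda>k. ?D k x) \<longlonglongrightarrow> Du x \<bullet> b" by (rule filterlim_compose)
    qed
    show "AE x in lborel. norm (?D k x) \<le> L * indicator (cball 0 (R + 1)) x" for k
    proof (rule AE_I2)
      fix x
      have nb: "norm (h k *\<^sub>R b) = h k" using b h[of k] by simp
      have "\<bar>u (x + h k *\<^sub>R b) - u x\<bar> \<le> L * h k" using lip[of x "h k *\<^sub>R b"] nb by simp
      then have 1: "norm (?D k x) \<le> L" using h[of k] by (simp add: divide_le_eq)
      have "?D k x = 0" if "R + 1 < norm x"
      proof -
        have "norm x \<le> norm (x + h k *\<^sub>R b) + h k" using norm_triangle_ineq4[of "x + h k *\<^sub>R b" "h k *\<^sub>R b"] nb by simp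
        then show ?thesis using that h[of k] R(2)[of x] R(2)[of "x + h k *\<^sub>R b"] by simp
      qed
      then show "norm (?D k x) \<le> L * indicator (cball 0 (R + 1)) x" using 1 by (auto simp: indicator_def not_le)
    qed
  qed measurable
  then show ?thesis unfolding D0 using LIMSEQ_unique tendsto_const by blast
qed

lemma c1_compact_mult:
  assumes u: "c1_compact u Du" and v: "c1_compact v Dv"
  shows "c1_compact (\<lambda>x. u x * v x) (\<lambda>x. u x *\<^sub>R Dv x + v x *\<^sub>R Du x)"
  unfolding c1_compact_def
proof (intro conjI allI)
  fix x
  have "(u has_derivative (\<lambda>h. Du x \<bullet> h)) (at x)" "(v has_derivative (\<lambda>h. Dv x \<bullet> h)) (at x)"
    using u v by (auto simp: c1_compact_def)
  from has_derivative_mult[OF this]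
  show "((\<lambda>x. u x * v x) has_derivative (\<lambda>h. (u x *\<^sub>R Dv x + v x *\<^sub>R Du x) \<bullet> h)) (at x)"
    by (simp add: inner_add_left mult.commute)
next
  show "continuous_on UNIV (\<lambda>x. u x *\<^sub>R Dv x + v x *\<^sub>R Du x)"
    using u v c1_compact_continuous[OF u] c1_compact_continuous[OF v] by (intro continuous_intros) (auto simp: c1_compact_def)
  obtain R where "\<And>x. R < norm x \<Longrightarrow> u x = 0" using u by (auto simp: c1_compact_def)
  then show "\<exists>R. \<forall>x. R < norm x \<longrightarrow> u x * v x = 0" by auto
qed

lemma integral_lebesgue_on_eq_lborel:
  fixes f :: "'a::euclidean_space \<Rightarrow> real"
  assumes "open \<Omega>" "f \<in> borel_measurable borel" "\<And>x. x \<notin> \<Omega> \<Longrightarrow> f x = 0"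
  shows "(\<integral>x. f x \<partial>lebesgue_on \<Omega>) = (\<integral>x. f x \<partial>lborel)"
proof -
  have "(\<integral>x. f x \<partial>lebesgue_on \<Omega>) = (\<integral>x. indicator \<Omega> x *\<^sub>R f x \<partial>lebesgue)"
    using assms by (intro integral_restrict_space) auto
  also have "(\<lambda>x. indicator \<Omega> x *\<^sub>R f x) = f" using assms(3) by (auto simp: indicator_def fun_eq_iff)
  finally show ?thesis using assms(2) by (simp add: integral_completion)
qed

lemma integrable_lebesgue_on_iff:
  fixes f :: "'a::euclidean_space \<Rightarrow> real"
  assumes "open \<Omega>" "\<And>x. x \<notin> \<Omega> \<Longrightarrow> f x = 0"
  shows "integrable (lebesgue_on \<Omega>) f \<longleftrightarrow> integrable lebesgue f"
proof -
  have "integrable (lebesgue_on \<Omega>) f \<longleftrightarrow> integrable lebesgue (\<lambda>x. indicator \<Omega> x *\<^sub>R f x)"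
    using assms by (intro integrable_restrict_space) auto
  also have "(\<lambda>x. indicator \<Omega> x *\<^sub>R f x) = f" using assms(2) by (auto simp: indicator_def fun_eq_iff)
  finally show ?thesis .
qed

lemma locally_integrable_continuous:
  fixes f :: "'a::euclidean_space \<Rightarrow> 'b::euclidean_space"
  assumes "continuous_on UNIV f"
  shows "locally_integrable_on f \<Omega>"
  unfolding locally_integrable_on_def
proof (intro allI impI)
  fix K :: "'a set" assume K: "compact K \<and> K \<subseteq> \<Omega>"
  then obtain a where a: "K \<subseteq> cbox (- a) a" using bounded_subset_cbox_symmetric compact_imp_bounded by blast
  have "f absolutely_integrable_on (cbox (- a) a)"
    using assms by (intro absolutely_integrable_continuous continuous_on_subset[OF assms]) auto
  then show "f absolutely_integrable_on K"
    by (rule set_integrable_subset) (use K a in \<open>auto simp: compact_imp_closed lmeasurable_compact fmeasurableD\<close>)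
qed

lemma integrable_mult_test:
  fixes f :: "'a::euclidean_space \<Rightarrow> real"
  assumes "open \<Omega>" and f: "locally_integrable_on f \<Omega>"
    and \<psi>: "continuous_on UNIV \<psi>" and K: "compact K" "K \<subseteq> \<Omega>" "\<And>x. x \<notin> K \<Longrightarrow> \<psi> x = 0"
  shows "integrable (lebesgue_on \<Omega>) (\<lambda>x. f x * \<psi> x)"
proof -
  have fK: "integrable lebesgue (\<lambda>x. indicator K x *\<^sub>R f x)"
    using f K by (auto simp: locally_integrable_on_def set_integrable_def)
  obtain R where "\<forall>x\<in>K. norm x \<le> R" using compact_imp_bounded[OF K(1)] by (auto simp: bounded_iff)
  then have "\<And>x. R < norm x \<Longrightarrow> \<psi> x = 0" using K(3) by force
  with \<psi> obtain B where B: "0 \<le> B" "\<And>x. norm (\<psi> x) \<le> B" by (rule continuous_bounded_support_bounded) blast+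
  have [measurable]: "\<psi> \<in> borel_measurable lebesgue"
    using borel_measurable_continuous_onI[OF \<psi>] by (intro measurable_completion) simp
  have "integrable lebesgue (\<lambda>x. (indicator K x *\<^sub>R f x) * \<psi> x)"
  proof (rule Bochner_Integration.integrable_bound)
    show "integrable lebesgue (\<lambda>x. B * (indicator K x *\<^sub>R f x))" using fK by (rule integrable_mult_right)
    show "AE x in lebesgue. norm (indicator K x *\<^sub>R f x * \<psi> x) \<le> norm (B * (indicator K x *\<^sub>R f x))"
      using B by (intro AE_I2) (auto simp: abs_mult indicator_def mult.commute[of B] intro!: mult_left_mono)
    show "(\<lambda>x. indicator K x *\<^sub>R f x * \<psi> x) \<in> borel_measurable lebesgue"
      using borel_measurable_integrable[OF fK] by measurable
  qed
  also have "(\<lambda>x. (indicator K x *\<^sub>R f x) * \<psi> x) = (\<lambda>x. f x * \<psi> x)" using K(3) by (auto simp: indicator_def fun_eq_iff)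
  finally show ?thesis using K by (subst integrable_lebesgue_on_iff[OF \<open>open \<Omega>\<close>]) auto
qed

lemma test_function_support:
  assumes "\<phi> \<in> test_functions \<Omega>"
  obtains K where "compact K" "K \<subseteq> \<Omega>" "\<And>x. x \<notin> K \<Longrightarrow> \<phi> x = 0" "\<And>x. x \<notin> K \<Longrightarrow> gradient \<phi> x = 0"
proof
  let ?K = "closure {x. \<phi> x \<noteq> 0}"
  show "compact ?K" "?K \<subseteq> \<Omega>" using assms by (auto simp: test_functions_def)
  have "\<phi> \<in> test_functions ?K" using assms by (auto simp: test_functions_def)
  then show "\<phi> x = 0" "gradient \<phi> x = 0" if "x \<notin> ?K" for x using that by (auto dest: test_function_zero_outside)
qed

text \<open>
  Integration by parts: the product of two test functions has a derivative with integral zero.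
\<close>

lemma test_function_has_weak_gradient:
  assumes "open \<Omega>" and \<phi>: "\<phi> \<in> test_functions \<Omega>"
  shows "has_weak_gradient \<phi> (gradient \<phi>) \<Omega>"
  unfolding has_weak_gradient_def
proof (intro conjI ballI)
  note c1 = test_function_c1_compact[OF \<phi>]
  show "locally_integrable_on \<phi> \<Omega>" "locally_integrable_on (gradient \<phi>) \<Omega>"
    using c1 c1_compact_continuous[OF c1] by (auto simp: c1_compact_def intro: locally_integrable_continuous)
  fix \<psi> b assume \<psi>: "\<psi> \<in> test_functions \<Omega>" and b: "b \<in> (Basis :: 'a set)"
  note c1' = test_function_c1_compact[OF \<psi>]
  note [measurable] = c1_compact_measurable[OF c1] c1_compact_measurable[OF c1']
  obtain R where R: "\<And>x. R < norm x \<Longrightarrow> \<phi> x = 0" using c1 by (auto simp: c1_compact_def)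
  obtain R' where R': "\<And>x. R' < norm x \<Longrightarrow> \<psi> x = 0" using c1' by (auto simp: c1_compact_def)
  have cont: "continuous_on UNIV (gradient \<phi>)" "continuous_on UNIV (gradient \<psi>)" "continuous_on UNIV \<phi>" "continuous_on UNIV \<psi>"
    using c1 c1' by (auto simp: c1_compact_def intro: c1_compact_continuous[OF c1] c1_compact_continuous[OF c1'])
  have "integrable lborel (\<lambda>x. \<phi> x * (gradient \<psi> x \<bullet> b))"
    by (rule integrable_continuous_bounded_support[where R = R]) (auto intro!: continuous_intros cont simp: R)
  moreover have "integrable lborel (\<lambda>x. (gradient \<phi> x \<bullet> b) * \<psi> x)"
    by (rule integrable_continuous_bounded_support[where R = R']) (auto intro!: continuous_intros cont simp: R')
  ultimately have int: "integrable lborel (\<lambda>x. \<phi> x * (gradient \<psi> x \<bullet> b))" "integrable lborel (\<lambda>x. (gradient \<phi> x \<bullet> b) * \<psi> x)" .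
  have "0 = (\<integral>x. (\<phi> x *\<^sub>R gradient \<psi> x + \<psi> x *\<^sub>R gradient \<phi> x) \<bullet> b \<partial>lborel)"
    by (rule integral_partial_derivative_eq_0[OF c1_compact_mult[OF c1 c1'] b, symmetric])
  also have "\<dots> = (\<integral>x. \<phi> x * (gradient \<psi> x \<bullet> b) + (gradient \<phi> x \<bullet> b) * \<psi> x \<partial>lborel)"
    by (simp add: inner_add_left mult.commute)
  also have "\<dots> = (\<integral>x. \<phi> x * (gradient \<psi> x \<bullet> b) \<partial>lborel) + (\<integral>x. (gradient \<phi> x \<bullet> b) * \<psi> x \<partial>lborel)"
    by (rule Bochner_Integration.integral_add[OF int])
  finally have "(\<integral>x. \<phi> x * (gradient \<psi> x \<bullet> b) \<partial>lborel) = - (\<integral>x. (gradient \<phi> x \<bullet> b) * \<psi> x \<partial>lborel)" by simp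
  then show "(\<integral>x. \<phi> x * frechet_derivative \<psi> (at x) b \<partial>lebesgue_on \<Omega>) = - (\<integral>x. (gradient \<phi> x \<bullet> b) * \<psi> x \<partial>lebesgue_on \<Omega>)"
    using \<open>open \<Omega>\<close> \<phi> \<psi> b
    by (subst (1 2) integral_lebesgue_on_eq_lborel)
       (auto simp: gradient_inner_Basis[symmetric] test_function_zero_outside)
qed

text \<open>
  The boxes form a generator of the Borel sets that is stable under intersections, so the integrals vanish over all
  Borel sets.
\<close>

lemma AE_zero_of_box_integrals:
  fixes f :: "'a::euclidean_space \<Rightarrow> real"
  assumes f: "integrable lborel f" and supp: "\<And>x. x \<notin> box a b \<Longrightarrow> f x = 0"
    and zero: "\<And>c d. (\<integral>x. indicator (box c d) x * f x \<partial>lborel) = 0"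
  shows "AE x in lborel. f x = 0"
proof (rule density_unique_real[OF f])
  have [measurable]: "f \<in> borel_measurable borel" using f by simp
  have total: "(\<integral>x. f x \<partial>lborel) = 0"
  proof -
    have "(\<lambda>x. indicator (box a b) x * f x) = f" using supp by (auto simp: indicator_def fun_eq_iff)
    with zero[of a b] show ?thesis by simp
  qed
  have int: "integrable lborel (\<lambda>x. indicator A x * f x)" if "A \<in> sets borel" for A
    using integrable_mult_indicator[OF _ f, of A] that by simp
  have all: "(\<integral>x. indicator A x * f x \<partial>lborel) = 0" if "A \<in> sigma_sets UNIV (range (\<lambda>(a, b). box a b :: 'a set))" for A
  proof (rule sigma_sets_induct_disjoint[OF _ _ that])
    show "Int_stable (range (\<lambda>(a, b). box a b :: 'a set))"
      by (auto simp: Int_stable_def box_Int_box)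
    show "range (\<lambda>(a, b). box a b :: 'a set) \<subseteq> Pow UNIV" by simp
  next
    fix A :: "'a set" assume "A \<in> range (\<lambda>(a, b). box a b)"
    then show "(\<integral>x. indicator A x * f x \<partial>lborel) = 0" using zero by auto
  next
    show "(\<integral>x. indicator {} x * f x \<partial>lborel) = 0" by simp
  next
    fix A :: "'a set" assume A: "A \<in> sigma_sets UNIV (range (\<lambda>(a, b). box a b))" and 0: "(\<integral>x. indicator A x * f x \<partial>lborel) = 0"
    from A have "A \<in> sets borel" by (simp add: borel_eq_box)
    have "(\<lambda>x. indicator (UNIV - A) x * f x) = (\<lambda>x. f x - indicator A x * f x)" by (auto simp: indicator_def fun_eq_iff)
    then show "(\<integral>x. indicator (UNIV - A) x * f x \<partial>lborel) = 0"
      using f int[OF \<open>A \<in> sets borel\<close>] total 0 by simp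
  next
    fix A :: "nat \<Rightarrow> 'a set"
    assume dis: "disjoint_family A" and A: "range A \<subseteq> sigma_sets UNIV (range (\<lambda>(a, b). box a b))"
      and 0: "\<And>i. (\<integral>x. indicator (A i) x * f x \<partial>lborel) = 0"
    from A have A': "A i \<in> sets borel" for i by (auto simp: borel_eq_box)
    then have U: "(\<Union>i. A i) \<in> sets borel" by auto
    have "(LINT x:(\<Union>i. A i)|lborel. f x) = (\<Sum>i. LINT x:(A i)|lborel. f x)"
      using dis A' U int by (intro lebesgue_integral_countable_add) (auto simp: disjoint_family_on_def set_integrable_def)
    then show "(\<integral>x. indicator (\<Union>i. A i) x * f x \<partial>lborel) = 0"
      using 0 by (simp add: set_lebesgue_integral_def)
  qed
  show "(LINT x:A|lborel. f x) = (LINT x:A|lborel. 0)" if "A \<in> sets lborel" for A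
    using all[of A] that by (simp add: set_lebesgue_integral_def borel_eq_box)
qed simp

text \<open>
  A smooth function that is positive exactly on the open box; its multiples composed with \<open>flat_exp\<close> increase to the
  indicator function of the box.
\<close>

definition box_bump :: "'a::euclidean_space \<Rightarrow> 'a \<Rightarrow> 'a \<Rightarrow> real" where
  "box_bump c d x = (\<Prod>b\<in>Basis. flat_exp (x \<bullet> b - c \<bullet> b) * flat_exp (d \<bullet> b - x \<bullet> b))"

lemma box_bump: "smooth (box_bump c d)" "0 \<le> box_bump c d x" "0 < box_bump c d x \<longleftrightarrow> x \<in> box c d"
proof -
  show "smooth (box_bump c d)"
    unfolding box_bump_def by (intro smooth_prod smooth_mult smooth_flat_exp smooth_diff smooth_inner smooth_const finite_Basis)
  show nonneg: "0 \<le> box_bump c d x"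
    unfolding box_bump_def by (intro prod_nonneg ballI mult_nonneg_nonneg flat_exp_bounds)
  have "box_bump c d x \<noteq> 0 \<longleftrightarrow> x \<in> box c d"
    by (auto simp: box_bump_def box_def flat_exp_bounds not_le)
  with nonneg show "0 < box_bump c d x \<longleftrightarrow> x \<in> box c d" by (simp add: order_less_le)
qed

lemma flat_exp_tendsto_indicator:
  assumes "0 \<le> c"
  shows "(\<lambda>m. flat_exp (real (Suc m) * c)) \<longlonglongrightarrow> (if 0 < c then 1 else 0)"
proof (cases "0 < c")
  case True
  have "(\<lambda>m. exp (- (inverse (real (Suc m)) * (1 / c)))) \<longlonglongrightarrow> exp (- (0 * (1 / c)))"
    by (intro tendsto_intros LIMSEQ_inverse_real_of_nat)
  with True show ?thesis by (simp add: flat_exp_def divide_inverse mult.commute del: of_nat_Suc)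
qed (use assms in \<open>simp add: flat_exp_def\<close>)

text \<open>
  Test functions approximate the indicator functions of the boxes inside \<open>box a b\<close>, so the integrals of \<open>h\<close> over
  these boxes vanish. A Borel measurable representative of \<open>h\<close> brings this to the form of
  \<open>AE_zero_of_box_integrals\<close>.
\<close>

lemma AE_zero_on_box_of_test:
  fixes h :: "'a::euclidean_space \<Rightarrow> real"
  assumes "open \<Omega>" and h: "locally_integrable_on h \<Omega>"
    and test: "\<And>\<phi>. \<phi> \<in> test_functions \<Omega> \<Longrightarrow> (\<integral>x. h x * \<phi> x \<partial>lebesgue_on \<Omega>) = 0"
    and ab: "cbox a b \<subseteq> \<Omega>"
  shows "AE x in lebesgue. x \<in> box a b \<longrightarrow> h x = 0"
proof -
  define f where "f = (\<lambda>x. indicator (cbox a b) x * h x)"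
  have f: "integrable lebesgue f"
    using h ab compact_cbox by (auto simp: locally_integrable_on_def set_integrable_def f_def)
  have box_zero: "(\<integral>x. indicator (box c d) x * f x \<partial>lebesgue) = 0" if cd: "box c d \<subseteq> box a b" for c d
  proof -
    define \<phi> where "\<phi> = (\<lambda>m::nat. \<lambda>x. flat_exp (real (Suc m) * box_bump c d x))"
    have \<phi>_smooth: "smooth (\<phi> m)" for m unfolding \<phi>_def
      by (intro smooth_flat_exp smooth_mult smooth_const box_bump)
    have \<phi>_supp: "\<phi> m x = 0" if "x \<notin> box c d" for m x
      using that box_bump(2,3)[of c d x] by (simp add: \<phi>_def flat_exp_def zero_less_mult_iff del: of_nat_Suc)
    have \<phi>_test: "\<phi> m \<in> test_functions \<Omega>" for m
      by (rule test_functionI[OF \<phi>_smooth _ compact_cbox ab]) (use \<phi>_supp cd box_subset_cbox in blast)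
    have \<phi>_meas: "\<phi> m \<in> borel_measurable lebesgue" for m
      using c1_compact_measurable(1)[OF test_function_c1_compact[OF \<phi>_test]] by (intro measurable_completion) simp
    have f_meas: "f \<in> borel_measurable lebesgue" using f by (rule borel_measurable_integrable)
    have 0: "(\<integral>x. \<phi> m x * f x \<partial>lebesgue) = 0" for m
    proof -
      have "(\<integral>x. h x * \<phi> m x \<partial>lebesgue_on \<Omega>) = (\<integral>x. indicator \<Omega> x *\<^sub>R (h x * \<phi> m x) \<partial>lebesgue)"
        using \<open>open \<Omega>\<close> by (intro integral_restrict_space) auto
      also have "(\<lambda>x. indicator \<Omega> x *\<^sub>R (h x * \<phi> m x)) = (\<lambda>x. \<phi> m x * f x)"
      proof
        fix x show "indicator \<Omega> x *\<^sub>R (h x * \<phi> m x) = \<phi> m x * f x"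
          using ab cd box_subset_cbox[of a b] \<phi>_supp[of x m] by (cases "x \<in> box c d") (auto simp: f_def indicator_def)
      qed
      finally show ?thesis using test[OF \<phi>_test[of m]] by simp
    qed
    have "(\<lambda>m. \<integral>x. \<phi> m x * f x \<partial>lebesgue) \<longlonglongrightarrow> (\<integral>x. indicator (box c d) x * f x \<partial>lebesgue)"
    proof (rule integral_dominated_convergence[where w = "\<lambda>x. \<bar>f x\<bar>"])
      show "integrable lebesgue (\<lambda>x. \<bar>f x\<bar>)" using f by simp
      show "AE x in lebesgue. (\<lambda>m. \<phi> m x * f x) \<longlonglongrightarrow> indicator (box c d) x * f x"
      proof (rule AE_I2)
        fix x
        have "(\<lambda>m. \<phi> m x) \<longlonglongrightarrow> indicator (box c d) x"
          using flat_exp_tendsto_indicator[OF box_bump(2)[of c d x]] box_bump(3)[of c d x]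
          by (simp add: \<phi>_def indicator_def of_bool_def)
        then show "(\<lambda>m. \<phi> m x * f x) \<longlonglongrightarrow> indicator (box c d) x * f x" by (intro tendsto_intros)
      qed
      show "AE x in lebesgue. norm (\<phi> m x * f x) \<le> \<bar>f x\<bar>" for m
        using flat_exp_bounds by (intro AE_I2) (auto simp: \<phi>_def abs_mult intro!: mult_left_le_one_le)
      show "(\<lambda>x. \<phi> m x * f x) \<in> borel_measurable lebesgue" for m
        by (intro borel_measurable_times \<phi>_meas f_meas)
      show "(\<lambda>x. indicator (box c d) x * f x) \<in> borel_measurable lebesgue"
        by (intro borel_measurable_times f_meas borel_measurable_indicator) simp
    qed
    then show ?thesis unfolding 0 using LIMSEQ_unique tendsto_const by blast
  qed
  obtain g where g[measurable]: "g \<in> borel_measurable borel" and fg: "AE x in lborel. f x = g x"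
    using completion_ex_borel_measurable_real[of f lborel] f by auto
  have fg': "AE x in lebesgue. f x = g x" using fg by (rule AE_completion)
  define g' where "g' = (\<lambda>x. indicator (box a b) x * g x)"
  have g'[measurable]: "g' \<in> borel_measurable borel" unfolding g'_def by measurable
  have ff: "integrable lebesgue (\<lambda>x. indicator A x * f x)" if "A \<in> sets borel" for A
    using integrable_mult_indicator[OF _ f, of A] that by simp
  have g'_eq: "AE x in lebesgue. indicator (box a b) x * f x = g' x"
    using fg' by eventually_elim (simp add: g'_def)
  have "AE x in lborel. g' x = 0"
  proof (rule AE_zero_of_box_integrals)
    have "g' \<in> borel_measurable lebesgue" by (rule measurable_completion) simp
    then have "integrable lebesgue g'"
      by (rule integrable_cong_AE_imp[OF ff[of "box a b", simplified] _ g'_eq])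
    then show "integrable lborel g'" using integrable_completion[of g' lborel] by simp
    show "g' x = 0" if "x \<notin> box a b" for x using that by (simp add: g'_def)
    fix c d
    obtain c' d' where cd': "box a b \<inter> box c d = box c' d'" by (auto simp: box_Int_box)
    have "(\<integral>x. indicator (box c d) x * g' x \<partial>lborel) = (\<integral>x. indicator (box c d) x * g' x \<partial>lebesgue)"
      by (rule integral_completion[symmetric]) measurable
    also have "\<dots> = (\<integral>x. indicator (box c' d') x * f x \<partial>lebesgue)"
    proof (rule integral_cong_AE)
      show "AE x in lebesgue. indicator (box c d) x * g' x = indicator (box c' d') x * f x"
        using g'_eq
      proof eventually_elim
        case (elim x)
        have "indicator (box c' d') x = (indicator (box c d) x * indicator (box a b) x :: real)"
          by (simp add: cd'[symmetric] indicator_inter_arith mult.commute)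
        then show ?case unfolding elim[symmetric] by simp
      qed
      show "(\<lambda>x. indicator (box c d) x * g' x) \<in> borel_measurable lebesgue"
        by (rule measurable_completion) measurable
      show "(\<lambda>x. indicator (box c' d') x * f x) \<in> borel_measurable lebesgue"
        using ff[of "box c' d'"] by (rule borel_measurable_integrable[OF _]) simp
    qed
    also have "\<dots> = 0" using cd' by (intro box_zero) blast
    finally show "(\<integral>x. indicator (box c d) x * g' x \<partial>lborel) = 0" .
  qed
  then have "AE x in lebesgue. g' x = 0" by (rule AE_completion)
  with g'_eq show ?thesis
  proof eventually_elim
    case (elim x)
    then show ?case using box_subset_cbox[of a b] by (cases "x \<in> box a b") (auto simp: f_def)
  qed
qed

text \<open>
  By the theorem of Lindeloef, countably many boxes with closure in \<open>\<Omega>\<close> cover \<open>\<Omega>\<close>.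
\<close>

proposition fundamental_lemma_calculus_of_variations:
  fixes h :: "'a::euclidean_space \<Rightarrow> real"
  assumes "open \<Omega>" and h: "locally_integrable_on h \<Omega>"
    and test: "\<And>\<phi>. \<phi> \<in> test_functions \<Omega> \<Longrightarrow> (\<integral>x. h x * \<phi> x \<partial>lebesgue_on \<Omega>) = 0"
  shows "AE x in lebesgue_on \<Omega>. h x = 0"
proof -
  define \<F> where "\<F> = {p :: 'a \<times> 'a. cbox (fst p) (snd p) \<subseteq> \<Omega>}"
  have cover: "\<Omega> \<subseteq> (\<Union>p\<in>\<F>. box (fst p) (snd p))"
  proof
    fix x assume "x \<in> \<Omega>"
    then obtain e where e: "0 < e" "ball x e \<subseteq> \<Omega>" using \<open>open \<Omega>\<close> open_contains_ball by blast
    from rational_boxes[OF e(1), of x] obtain a b where "x \<in> box a b" "box a b \<subseteq> ball x e" by blast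
    from open_contains_cbox[of "box a b"] this open_box
    obtain c d where "cbox c d \<subseteq> box a b" "x \<in> box c d" by (meson open_contains_cbox)
    then show "x \<in> (\<Union>p\<in>\<F>. box (fst p) (snd p))"
      using e \<open>box a b \<subseteq> ball x e\<close> unfolding \<F>_def by (intro UN_I[of "(c, d)"]) auto
  qed
  obtain \<F>' where \<F>': "\<F>' \<subseteq> (\<lambda>p. box (fst p) (snd p)) ` \<F>" "countable \<F>'" "\<Union>\<F>' = \<Union>((\<lambda>p. box (fst p) (snd p)) ` \<F>)"
    by (rule Lindelof[of "(\<lambda>p. box (fst p) (snd p)) ` \<F>"]) (auto intro: open_box)
  have "AE x in lebesgue. \<forall>B\<in>\<F>'. x \<in> B \<longrightarrow> h x = 0"
  proof (rule AE_ball_countable[OF \<F>'(2), THEN iffD2], rule ballI)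
    fix B assume "B \<in> \<F>'"
    then obtain a b where "B = box a b" "cbox a b \<subseteq> \<Omega>" using \<F>'(1) by (auto simp: \<F>_def)
    then show "AE x in lebesgue. x \<in> B \<longrightarrow> h x = 0"
      using AE_zero_on_box_of_test[OF assms] by simp
  qed
  then have "AE x in lebesgue. x \<in> \<Omega> \<longrightarrow> h x = 0"
    by eventually_elim (use cover \<F>'(3) in blast)
  then show ?thesis using \<open>open \<Omega>\<close> by (subst AE_restrict_space_iff) auto
qed

lemma locally_integrable_diff:
  fixes g1 g2 :: "'a::euclidean_space \<Rightarrow> 'b::euclidean_space"
  assumes "locally_integrable_on g1 \<Omega>" "locally_integrable_on g2 \<Omega>"
  shows "locally_integrable_on (\<lambda>x. g1 x - g2 x) \<Omega>"
  using assms by (auto simp: locally_integrable_on_def intro!: set_integral_diff)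

lemma locally_integrable_inner:
  fixes g :: "'a::euclidean_space \<Rightarrow> 'b::euclidean_space"
  assumes "locally_integrable_on g \<Omega>"
  shows "locally_integrable_on (\<lambda>x. g x \<bullet> b) \<Omega>"
proof -
  have "integrable lebesgue (\<lambda>x. indicator K x *\<^sub>R (g x \<bullet> b))" if "integrable lebesgue (\<lambda>x. indicator K x *\<^sub>R g x)" for K
    using integrable_inner_left[OF that, of b] by simp
  then show ?thesis using assms by (auto simp: locally_integrable_on_def set_integrable_def)
qed

lemma integrable_mult_test_function:
  fixes f :: "'a::euclidean_space \<Rightarrow> real"
  assumes "open \<Omega>" "locally_integrable_on f \<Omega>" "\<phi> \<in> test_functions \<Omega>" "b \<in> Basis"
  shows "integrable (lebesgue_on \<Omega>) (\<lambda>x. f x * \<phi> x)"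
    and "integrable (lebesgue_on \<Omega>) (\<lambda>x. f x * frechet_derivative \<phi> (at x) b)"
proof -
  obtain K where K: "compact K" "K \<subseteq> \<Omega>" "\<And>x. x \<notin> K \<Longrightarrow> \<phi> x = 0" "\<And>x. x \<notin> K \<Longrightarrow> gradient \<phi> x = 0"
    using test_function_support[OF assms(3)] by blast
  note c1 = test_function_c1_compact[OF assms(3)]
  have cont: "continuous_on UNIV \<phi>" "continuous_on UNIV (gradient \<phi>)"
    using c1 c1_compact_continuous[OF c1] by (auto simp: c1_compact_def)
  show "integrable (lebesgue_on \<Omega>) (\<lambda>x. f x * \<phi> x)"
    by (rule integrable_mult_test[OF assms(1,2) cont(1) K(1,2,3)])
  have "integrable (lebesgue_on \<Omega>) (\<lambda>x. f x * (gradient \<phi> x \<bullet> b))"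
    by (rule integrable_mult_test[OF assms(1,2) _ K(1,2)]) (auto intro!: continuous_intros cont simp: K)
  then show "integrable (lebesgue_on \<Omega>) (\<lambda>x. f x * frechet_derivative \<phi> (at x) b)"
    using assms(4) by (simp add: gradient_inner_Basis)
qed

text \<open>
  The components of the difference of two weak gradients are orthogonal to all test functions.
\<close>

proposition weak_gradient_AE_unique:
  fixes u :: "'a::euclidean_space \<Rightarrow> real"
  assumes "open \<Omega>" and g1: "has_weak_gradient u g1 \<Omega>" and g2: "has_weak_gradient u g2 \<Omega>"
  shows "AE x in lebesgue_on \<Omega>. g1 x = g2 x"
proof -
  have "AE x in lebesgue_on \<Omega>. g1 x \<bullet> b - g2 x \<bullet> b = 0" if b: "b \<in> Basis" for b
  proof (rule fundamental_lemma_calculus_of_variations[OF \<open>open \<Omega>\<close>])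
    have loc: "locally_integrable_on (\<lambda>x. g1 x \<bullet> b) \<Omega>" "locally_integrable_on (\<lambda>x. g2 x \<bullet> b) \<Omega>"
      using g1 g2 by (auto simp: has_weak_gradient_def intro: locally_integrable_inner)
    then show "locally_integrable_on (\<lambda>x. g1 x \<bullet> b - g2 x \<bullet> b) \<Omega>" by (rule locally_integrable_diff)
    fix \<phi> assume \<phi>: "\<phi> \<in> test_functions \<Omega>"
    have "(\<integral>x. u x * frechet_derivative \<phi> (at x) b \<partial>lebesgue_on \<Omega>) = - (\<integral>x. (g x \<bullet> b) * \<phi> x \<partial>lebesgue_on \<Omega>)"
      if "has_weak_gradient u g \<Omega>" for g
      using that \<phi> b by (simp add: has_weak_gradient_def)
    from this[OF g1] this[OF g2]
    have "(\<integral>x. (g1 x \<bullet> b) * \<phi> x \<partial>lebesgue_on \<Omega>) = (\<integral>x. (g2 x \<bullet> b) * \<phi> x \<partial>lebesgue_on \<Omega>)"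
      by simp
    then show "(\<integral>x. (g1 x \<bullet> b - g2 x \<bullet> b) * \<phi> x \<partial>lebesgue_on \<Omega>) = 0"
      using integrable_mult_test_function(1)[OF \<open>open \<Omega>\<close> loc(1) \<phi> b] integrable_mult_test_function(1)[OF \<open>open \<Omega>\<close> loc(2) \<phi> b]
      by (simp add: left_diff_distrib Bochner_Integration.integral_diff)
  qed
  then have "AE x in lebesgue_on \<Omega>. \<forall>b\<in>Basis. g1 x \<bullet> b - g2 x \<bullet> b = 0"
    by (subst AE_ball_countable) (auto simp: countable_finite)
  then show ?thesis
  proof eventually_elim
    case (elim x)
    then show ?case by (intro euclidean_eqI[of "g1 x"]) simp
  qed
qed

lemma has_weak_gradient_diff:
  fixes u v :: "'a::euclidean_space \<Rightarrow> real"
  assumes "open \<Omega>" and u: "has_weak_gradient u g \<Omega>" and v: "has_weak_gradient v h \<Omega>"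
  shows "has_weak_gradient (\<lambda>x. u x - v x) (\<lambda>x. g x - h x) \<Omega>"
proof -
  have loc: "locally_integrable_on u \<Omega>" "locally_integrable_on v \<Omega>" "locally_integrable_on g \<Omega>" "locally_integrable_on h \<Omega>"
    using u v by (auto simp: has_weak_gradient_def)
  have "(\<integral>x. (u x - v x) * frechet_derivative \<phi> (at x) b \<partial>lebesgue_on \<Omega>) = - (\<integral>x. ((g x - h x) \<bullet> b) * \<phi> x \<partial>lebesgue_on \<Omega>)"
    if \<phi>: "\<phi> \<in> test_functions \<Omega>" and b: "b \<in> Basis" for \<phi> b
  proof -
    note i = integrable_mult_test_function[OF \<open>open \<Omega>\<close> _ \<phi> b]
    have "(\<integral>x. (u x - v x) * frechet_derivative \<phi> (at x) b \<partial>lebesgue_on \<Omega>)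
      = (\<integral>x. u x * frechet_derivative \<phi> (at x) b \<partial>lebesgue_on \<Omega>) - (\<integral>x. v x * frechet_derivative \<phi> (at x) b \<partial>lebesgue_on \<Omega>)"
      using i(2)[OF loc(1)] i(2)[OF loc(2)] by (simp add: left_diff_distrib Bochner_Integration.integral_diff)
    also have "\<dots> = - ((\<integral>x. (g x \<bullet> b) * \<phi> x \<partial>lebesgue_on \<Omega>) - (\<integral>x. (h x \<bullet> b) * \<phi> x \<partial>lebesgue_on \<Omega>))"
      using u v \<phi> b by (simp add: has_weak_gradient_def)
    also have "(\<integral>x. (g x \<bullet> b) * \<phi> x \<partial>lebesgue_on \<Omega>) - (\<integral>x. (h x \<bullet> b) * \<phi> x \<partial>lebesgue_on \<Omega>) = (\<integral>x. ((g x - h x) \<bullet> b) * \<phi> x \<partial>lebesgue_on \<Omega>)"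
      using i(1)[OF locally_integrable_inner[OF loc(3)], of b] i(1)[OF locally_integrable_inner[OF loc(4)], of b]
      by (simp add: inner_diff_left left_diff_distrib Bochner_Integration.integral_diff)
    finally show ?thesis .
  qed
  then show ?thesis using loc unfolding has_weak_gradient_def by (auto intro: locally_integrable_diff)
qed

section \<open>Sobolev norms and test functions\<close>

lemma borel_measurable_lebesgue_on_AE:
  fixes f g :: "'a::euclidean_space \<Rightarrow> 'b::euclidean_space"
  assumes "open \<Omega>" and f: "f \<in> borel_measurable (lebesgue_on \<Omega>)" and eq: "AE x in lebesgue_on \<Omega>. f x = g x"
  shows "g \<in> borel_measurable (lebesgue_on \<Omega>)"
proof -
  have \<Omega>: "\<Omega> \<inter> space lebesgue \<in> sets lebesgue" using \<open>open \<Omega>\<close> by simp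
  have "(\<lambda>x. indicator \<Omega> x *\<^sub>R f x) \<in> borel_measurable lebesgue"
    using f by (simp add: borel_measurable_restrict_space_iff[OF \<Omega>])
  moreover have "AE x in lebesgue. indicator \<Omega> x *\<^sub>R f x = indicator \<Omega> x *\<^sub>R g x"
    using eq unfolding AE_restrict_space_iff[OF \<Omega>] by eventually_elim (auto simp: indicator_def)
  ultimately have "(\<lambda>x. indicator \<Omega> x *\<^sub>R g x) \<in> borel_measurable lebesgue"
    by (rule borel_measurable_AE)
  then show ?thesis by (simp add: borel_measurable_restrict_space_iff[OF \<Omega>])
qed

text \<open>
  The definition of the norm uses a chosen weak gradient; by uniqueness any measurable one may be used.
\<close>

lemma sobolev_norm_eq:
  assumes "open \<Omega>" and g: "has_weak_gradient u g \<Omega>" "g \<in> borel_measurable (lebesgue_on \<Omega>)"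
    and u: "u \<in> borel_measurable (lebesgue_on \<Omega>)"
  shows "sobolev_norm p \<Omega> u = root p (\<integral>x. norm (g x) ^ p + \<bar>u x\<bar> ^ p \<partial>lebesgue_on \<Omega>)"
proof -
  have "has_weak_gradient u (weak_gradient \<Omega> u) \<Omega>"
    unfolding weak_gradient_def by (rule someI[of "\<lambda>g. has_weak_gradient u g \<Omega>"]) (rule g(1))
  with g(1) have eq: "AE x in lebesgue_on \<Omega>. g x = weak_gradient \<Omega> u x"
    by (rule weak_gradient_AE_unique[OF \<open>open \<Omega>\<close>])
  have [measurable]: "weak_gradient \<Omega> u \<in> borel_measurable (lebesgue_on \<Omega>)"
    by (rule borel_measurable_lebesgue_on_AE[OF \<open>open \<Omega>\<close> g(2) eq])
  note [measurable] = g(2) u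
  have "(\<integral>x. norm (weak_gradient \<Omega> u x) ^ p + \<bar>u x\<bar> ^ p \<partial>lebesgue_on \<Omega>)
    = (\<integral>x. norm (g x) ^ p + \<bar>u x\<bar> ^ p \<partial>lebesgue_on \<Omega>)"
    by (intro integral_cong_AE) (use eq in \<open>auto elim!: eventually_mono\<close>)
  then show ?thesis by (simp add: sobolev_norm_def)
qed

lemma Lp_space_diff:
  assumes f: "f \<in> Lp_space p \<Omega>" and g: "g \<in> Lp_space p \<Omega>"
  shows "(\<lambda>x. f x - g x) \<in> Lp_space p \<Omega>"
proof -
  have m[measurable]: "f \<in> borel_measurable (lebesgue_on \<Omega>)" "g \<in> borel_measurable (lebesgue_on \<Omega>)"
    using f g by (auto simp: Lp_space_def)
  have "integrable (lebesgue_on \<Omega>) (\<lambda>x. norm (f x - g x) ^ p)"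
  proof (rule Bochner_Integration.integrable_bound)
    show "integrable (lebesgue_on \<Omega>) (\<lambda>x. 2 ^ p * (norm (f x) ^ p + norm (g x) ^ p))"
      using f g by (auto simp: Lp_space_def)
    show "AE x in lebesgue_on \<Omega>. norm (norm (f x - g x) ^ p) \<le> norm (2 ^ p * (norm (f x) ^ p + norm (g x) ^ p))"
    proof (rule AE_I2)
      fix x
      have "norm (f x - g x) \<le> 2 * max (norm (f x)) (norm (g x))"
        using norm_triangle_ineq4[of "f x" "g x"] by linarith
      then have "norm (f x - g x) ^ p \<le> (2 * max (norm (f x)) (norm (g x))) ^ p" by (intro power_mono) auto
      also have "\<dots> \<le> 2 ^ p * (norm (f x) ^ p + norm (g x) ^ p)"
        by (auto simp: power_mult_distrib max_def)
      finally show "norm (norm (f x - g x) ^ p) \<le> norm (2 ^ p * (norm (f x) ^ p + norm (g x) ^ p))" by simp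
    qed
  qed measurable
  then show ?thesis using m by (simp add: Lp_space_def)
qed

lemma continuous_bounded_support_Lp:
  fixes f :: "'a::euclidean_space \<Rightarrow> 'b::euclidean_space"
  assumes "open \<Omega>" "0 < p" and f: "continuous_on UNIV f" "\<And>x. R < norm x \<Longrightarrow> f x = 0"
  shows "f \<in> Lp_space p \<Omega>"
proof -
  have fb[measurable]: "f \<in> borel_measurable borel" using f(1) by (rule borel_measurable_continuous_onI)
  have fm: "f \<in> borel_measurable (lebesgue_on \<Omega>)"
    by (rule measurable_restrict_space1, rule measurable_completion) simp
  have "integrable lborel (\<lambda>x. norm (f x) ^ p)"
    by (rule integrable_continuous_bounded_support[where R = R])
       (use f \<open>0 < p\<close> in \<open>auto intro!: continuous_intros simp: power_0_left\<close>)
  moreover have "(\<lambda>x. norm (f x) ^ p) \<in> borel_measurable lborel" by measurable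
  ultimately have "integrable lebesgue (\<lambda>x. norm (f x) ^ p)"
    by (simp only: integrable_completion)
  then have "integrable lebesgue (\<lambda>x. indicator \<Omega> x *\<^sub>R norm (f x) ^ p)"
    using \<open>open \<Omega>\<close> by (intro integrable_mult_indicator) auto
  then have "integrable (lebesgue_on \<Omega>) (\<lambda>x. norm (f x) ^ p)"
    using \<open>open \<Omega>\<close> by (subst integrable_restrict_space) auto
  with fm show ?thesis by (simp add: Lp_space_def)
qed

lemma test_function_Lp:
  assumes "open \<Omega>" "0 < p" and \<phi>: "\<phi> \<in> test_functions \<Omega>"
  shows "\<phi> \<in> Lp_space p \<Omega>" "gradient \<phi> \<in> Lp_space p \<Omega>"
proof -
  note c1 = test_function_c1_compact[OF \<phi>]
  have cont: "continuous_on UNIV \<phi>" "continuous_on UNIV (gradient \<phi>)"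
    using c1 c1_compact_continuous[OF c1] by (auto simp: c1_compact_def)
  obtain R where "0 < R" and R: "\<And>x. R < norm x \<Longrightarrow> \<phi> x = 0" "\<And>x. R < norm x \<Longrightarrow> gradient \<phi> x = 0"
    using c1_compact_vanishing[OF c1] by blast
  show "\<phi> \<in> Lp_space p \<Omega>" by (rule continuous_bounded_support_Lp[OF assms(1,2) cont(1) R(1)])
  show "gradient \<phi> \<in> Lp_space p \<Omega>" by (rule continuous_bounded_support_Lp[OF assms(1,2) cont(2) R(2)])
qed

lemma test_function_in_sobolev_space_0:
  assumes "open \<Omega>" "0 < p" and \<phi>: "\<phi> \<in> test_functions \<Omega>"
  shows "\<phi> \<in> sobolev_space_0 p \<Omega>"
proof -
  have "(\<lambda>_. 0) \<in> test_functions \<Omega>"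
    by (rule test_functionI[of _ "{}"]) (auto intro: smooth_const)
  from test_function_has_weak_gradient[OF \<open>open \<Omega>\<close> this]
  have "has_weak_gradient (\<lambda>_. 0) (\<lambda>_. 0) \<Omega>" by (simp add: gradient_def[abs_def])
  then have "sobolev_norm p \<Omega> (\<lambda>x. \<phi> x - \<phi> x) = 0"
    using sobolev_norm_eq[OF \<open>open \<Omega>\<close>, of "\<lambda>_. 0" "\<lambda>_. 0" p] \<open>0 < p\<close> by (simp add: power_0_left)
  then have "(\<lambda>k. sobolev_norm p \<Omega> (\<lambda>x. \<phi> x - \<phi> x)) \<longlonglongrightarrow> 0" by simp
  then show ?thesis
    using test_function_Lp[OF assms] test_function_has_weak_gradient[OF \<open>open \<Omega>\<close> \<phi>] \<phi>
    unfolding sobolev_space_0_def sobolev_space_def by (auto intro!: exI[of _ "\<lambda>_. \<phi>"])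
qed

lemma sobolev_norm_test_function:
  fixes \<phi> :: "'a::euclidean_space \<Rightarrow> real"
  assumes "open \<Omega>" "0 < p" and \<phi>: "\<phi> \<in> test_functions \<Omega>"
  shows "sobolev_norm p \<Omega> \<phi> = root p (\<integral>x. norm (gradient \<phi> x) ^ p + \<bar>\<phi> x\<bar> ^ p \<partial>lborel)"
    and "integrable lborel (\<lambda>x. norm (gradient \<phi> x) ^ p + \<bar>\<phi> x\<bar> ^ p)"
proof -
  note c1 = test_function_c1_compact[OF \<phi>]
  note [measurable] = c1_compact_measurable[OF c1]
  have "sobolev_norm p \<Omega> \<phi> = root p (\<integral>x. norm (gradient \<phi> x) ^ p + \<bar>\<phi> x\<bar> ^ p \<partial>lebesgue_on \<Omega>)"
    using test_function_Lp[OF assms]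
    by (intro sobolev_norm_eq test_function_has_weak_gradient \<phi> \<open>open \<Omega>\<close>) (auto simp: Lp_space_def)
  also have "(\<integral>x. norm (gradient \<phi> x) ^ p + \<bar>\<phi> x\<bar> ^ p \<partial>lebesgue_on \<Omega>) = (\<integral>x. norm (gradient \<phi> x) ^ p + \<bar>\<phi> x\<bar> ^ p \<partial>lborel)"
    using \<open>0 < p\<close> test_function_zero_outside[OF \<phi>]
    by (intro integral_lebesgue_on_eq_lborel \<open>open \<Omega>\<close>) (auto simp: power_0_left)
  finally show "sobolev_norm p \<Omega> \<phi> = root p (\<integral>x. norm (gradient \<phi> x) ^ p + \<bar>\<phi> x\<bar> ^ p \<partial>lborel)" .
  have cont: "continuous_on UNIV \<phi>" "continuous_on UNIV (gradient \<phi>)"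
    using c1 c1_compact_continuous[OF c1] by (auto simp: c1_compact_def)
  obtain R where "0 < R" and R: "\<And>x. R < norm x \<Longrightarrow> \<phi> x = 0" "\<And>x. R < norm x \<Longrightarrow> gradient \<phi> x = 0"
    using c1_compact_vanishing[OF c1] by blast
  show "integrable lborel (\<lambda>x. norm (gradient \<phi> x) ^ p + \<bar>\<phi> x\<bar> ^ p)"
    using \<open>0 < p\<close>
    by (intro integrable_continuous_bounded_support[where R = R] continuous_intros cont) (auto simp: R power_0_left)
qed

lemma test_function_scale:
  assumes "\<phi> \<in> test_functions \<Omega>"
  shows "(\<lambda>x. c * \<phi> x) \<in> test_functions \<Omega>" "gradient (\<lambda>x. c * \<phi> x) x = c *\<^sub>R gradient \<phi> x"
proof -
  obtain K where K: "compact K" "K \<subseteq> \<Omega>" and supp: "\<And>x. x \<notin> K \<Longrightarrow> \<phi> x = 0" and "\<And>x. x \<notin> K \<Longrightarrow> gradient \<phi> x = 0"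
    using test_function_support[OF assms] by blast
  have "smooth (\<lambda>x. c * \<phi> x)" by (rule smooth_mult[OF smooth_const test_function_smooth[OF assms]])
  moreover have "{x. c * \<phi> x \<noteq> 0} \<subseteq> K" using supp by force
  ultimately show "(\<lambda>x. c * \<phi> x) \<in> test_functions \<Omega>" using K by (rule test_functionI)
  have d: "((\<lambda>x. c * \<phi> x) has_derivative (\<lambda>h. c * (gradient \<phi> x \<bullet> h))) (at x)"
    by (intro has_derivative_mult_right smooth_has_derivative_gradient test_function_smooth[OF assms])
  have "gradient (\<lambda>x. c * \<phi> x) x = (\<Sum>b\<in>Basis. (c *\<^sub>R gradient \<phi> x \<bullet> b) *\<^sub>R b)"
    unfolding gradient_def[of "\<lambda>x. c * \<phi> x"] has_derivative_imp_frechet[OF d] by simp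
  then show "gradient (\<lambda>x. c * \<phi> x) x = c *\<^sub>R gradient \<phi> x" by (simp only: euclidean_representation)
qed

lemma moser_const_eq: "moser_const TYPE('a::euclidean_space) = moser_alpha DIM('a)"
proof -
  let ?C = "{r *\<^sub>R x | r x. 0 < r \<and> r \<le> 1 \<and> x \<in> sphere (0::'a) 1}"
  have "?C = cball 0 1 - {0}"
  proof (intro equalityI subsetI)
    fix y assume "y \<in> cball (0::'a) 1 - {0}"
    then have "y = norm y *\<^sub>R (y /\<^sub>R norm y)" "0 < norm y \<and> norm y \<le> 1 \<and> y /\<^sub>R norm y \<in> sphere 0 1" by auto
    then show "y \<in> ?C" unfolding mem_Collect_eq
      by (intro exI[of _ "norm y"] exI[of _ "y /\<^sub>R norm y"]) auto
  qed auto
  moreover have "measure lebesgue (cball (0::'a) 1 - {0}) = measure lebesgue (cball (0::'a) 1)"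
    by (rule measure_Diff_null_set) (auto simp: null_sets_completionI)
  ultimately show ?thesis
    by (simp add: moser_const_def moser_alpha_def sphere_area_def sphere_measure_def content_cball)
qed

section \<open>Extension to the Sobolev space\<close>

text \<open>
  A substitute for Minkowski's inequality: a factor below \<open>1\<close> absorbs a small perturbation \<open>b\<close> at the price of a
  constant. Either \<open>b\<close> is so small that the factor compensates for it, or \<open>a\<close> is at most a multiple of \<open>b\<close>.
\<close>

lemma power_add_le_mult:
  fixes \<theta> :: real
  assumes "0 < \<theta>" "\<theta> < 1"
  obtains C where "0 \<le> C" "\<And>a b. 0 \<le> a \<Longrightarrow> 0 \<le> b \<Longrightarrow> (\<theta> * (a + b)) ^ p \<le> a ^ p + C * b ^ p"
proof
  define K where "K = 1 / (1 - \<theta>)"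
  have K: "0 < K" using assms by (simp add: K_def)
  then show "0 \<le> K ^ p" by simp
  fix a b :: real assume ab: "0 \<le> a" "0 \<le> b"
  have "\<theta> * (a + b) \<le> a \<or> \<theta> * (a + b) \<le> K * b"
  proof (cases "\<theta> * b \<le> (1 - \<theta>) * a")
    case False
    then have "a \<le> \<theta> / (1 - \<theta>) * b" using assms by (simp add: field_simps)
    moreover have "\<theta> / (1 - \<theta>) + 1 = K" using assms by (simp add: K_def field_simps)
    ultimately have "a + b \<le> K * b" by (metis add.commute add_left_mono distrib_right mult_1)
    moreover have "\<theta> * (a + b) \<le> a + b" using ab assms by (intro mult_left_le_one_le) auto
    ultimately show ?thesis by simp
  qed (simp add: algebra_simps)
  then show "(\<theta> * (a + b)) ^ p \<le> a ^ p + K ^ p * b ^ p"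
  proof
    assume "\<theta> * (a + b) \<le> a"
    then have "(\<theta> * (a + b)) ^ p \<le> a ^ p" using ab assms by (intro power_mono) auto
    then show ?thesis using ab K by (intro add_increasing2) auto
  next
    assume "\<theta> * (a + b) \<le> K * b"
    then have "(\<theta> * (a + b)) ^ p \<le> K ^ p * b ^ p"
      using ab assms by (subst power_mult_distrib[symmetric], intro power_mono) auto
    then show ?thesis using ab by (intro add_increasing) auto
  qed
qed

lemma tendsto_trunc_exp_powr:
  assumes "0 < q" "(f \<longlongrightarrow> (l::real)) F"
  shows "((\<lambda>x. trunc_exp n (\<alpha> * \<bar>f x\<bar> powr q)) \<longlongrightarrow> trunc_exp n (\<alpha> * \<bar>l\<bar> powr q)) F"
proof -
  have "((\<lambda>x. \<alpha> * \<bar>f x\<bar> powr q) \<longlongrightarrow> \<alpha> * \<bar>l\<bar> powr q) F"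
    using assms by (intro tendsto_mult tendsto_const tendsto_powr' tendsto_rabs) auto
  then show ?thesis unfolding trunc_exp_def
    by (intro tendsto_diff tendsto_exp tendsto_sum tendsto_divide tendsto_power tendsto_const) auto
qed

lemma trunc_exp_powr_measurable [measurable]:
  assumes [measurable]: "u \<in> borel_measurable M"
  shows "(\<lambda>x. ennreal (trunc_exp n (\<alpha> * \<bar>u x\<bar> powr q))) \<in> borel_measurable M"
  unfolding trunc_exp_def by measurable

lemma fatou_trunc_exp:
  fixes u :: "'b \<Rightarrow> real" and v :: "nat \<Rightarrow> 'b \<Rightarrow> real"
  assumes "0 < q" and v: "\<And>k. v k \<in> borel_measurable M"
    and lim: "AE x in M. (\<lambda>k. v k x) \<longlonglongrightarrow> u x"
    and le: "\<forall>\<^sub>F k in sequentially. (\<integral>\<^sup>+x. ennreal (trunc_exp n (\<alpha> * \<bar>v k x\<bar> powr q)) \<partial>M) \<le> D"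
  shows "(\<integral>\<^sup>+x. ennreal (trunc_exp n (\<alpha> * \<bar>u x\<bar> powr q)) \<partial>M) \<le> D"
proof -
  let ?F = "\<lambda>t. ennreal (trunc_exp n (\<alpha> * \<bar>t\<bar> powr q))"
  have "(\<integral>\<^sup>+x. ?F (u x) \<partial>M) \<le> (\<integral>\<^sup>+x. liminf (\<lambda>k. ?F (v k x)) \<partial>M)"
    using lim
  proof (intro nn_integral_mono_AE, eventually_elim)
    case (elim x)
    have "(\<lambda>k. ?F (v k x)) \<longlonglongrightarrow> ?F (u x)"
      by (intro tendsto_ennrealI tendsto_trunc_exp_powr \<open>0 < q\<close> elim)
    then show ?case by (simp add: lim_imp_Liminf)
  qed
  also have "\<dots> \<le> liminf (\<lambda>k. \<integral>\<^sup>+x. ?F (v k x) \<partial>M)"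
    using v by (intro nn_integral_liminf) measurable
  also have "\<dots> \<le> limsup (\<lambda>k. \<integral>\<^sup>+x. ?F (v k x) \<partial>M)" by (rule Liminf_le_Limsup) simp
  also have "\<dots> \<le> D" using le by (rule Limsup_bounded)
  finally show ?thesis .
qed

lemma nn_integral_lebesgue_on_le_lborel:
  fixes f :: "'a::euclidean_space \<Rightarrow> ennreal"
  assumes "open \<Omega>"
  shows "(\<integral>\<^sup>+x. f x \<partial>lebesgue_on \<Omega>) \<le> (\<integral>\<^sup>+x. f x \<partial>lborel)"
proof -
  have "(\<integral>\<^sup>+x. f x \<partial>lebesgue_on \<Omega>) = (\<integral>\<^sup>+x. f x * indicator \<Omega> x \<partial>lebesgue)"
    using assms by (intro nn_integral_restrict_space) auto
  also have "\<dots> \<le> (\<integral>\<^sup>+x. f x \<partial>lebesgue)" by (intro nn_integral_mono) (auto simp: indicator_def)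
  finally show ?thesis by (simp add: nn_integral_completion)
qed

text \<open>
  The approximating test functions may have norm slightly above \<open>1\<close>. Of the factor \<open>\<theta>\<^sup>2\<close>, one \<open>\<theta>\<close> is spent on
  \<open>power_add_le_mult\<close> and the other brings the norm below \<open>1\<close>. A subsequence converges almost everywhere because the
  \<open>p\<close>-th powers of the differences tend to zero in \<open>L\<^sup>1\<close>.
\<close>

lemma sobolev_space_0_approximation:
  fixes u :: "'a::euclidean_space \<Rightarrow> real"
  assumes \<Omega>: "open \<Omega>" and p: "0 < p"
    and u: "u \<in> sobolev_space_0 p \<Omega>" and norm: "sobolev_norm p \<Omega> u \<le> 1"
    and \<theta>: "0 < \<theta>" "\<theta> < 1"
  obtains w :: "nat \<Rightarrow> 'a \<Rightarrow> real" where "\<And>k. w k \<in> test_functions \<Omega>"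
    "AE x in lebesgue_on \<Omega>. (\<lambda>k. w k x) \<longlonglongrightarrow> \<theta>\<^sup>2 * u x"
    "\<forall>\<^sub>F k in sequentially. (\<integral>x. norm (gradient (w k) x) ^ p + \<bar>w k x\<bar> ^ p \<partial>lborel) \<le> 1"
proof -
  let ?M = "lebesgue_on \<Omega>"
  obtain g where uLp: "u \<in> Lp_space p \<Omega>" and gLp: "g \<in> Lp_space p \<Omega>" and g: "has_weak_gradient u g \<Omega>"
    using u by (auto simp: sobolev_space_0_def sobolev_space_def)
  obtain \<phi> where \<phi>: "\<And>k. \<phi> k \<in> test_functions \<Omega>" and conv: "(\<lambda>k. sobolev_norm p \<Omega> (\<lambda>x. u x - \<phi> k x)) \<longlonglongrightarrow> 0"
    using u by (auto simp: sobolev_space_0_def)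
  note \<phi>Lp = test_function_Lp[OF \<Omega> p \<phi>]
  have um[measurable]: "u \<in> borel_measurable ?M" "g \<in> borel_measurable ?M"
    using uLp gLp by (auto simp: Lp_space_def)
  have \<phi>m[measurable]: "\<phi> k \<in> borel_measurable ?M" "gradient (\<phi> k) \<in> borel_measurable ?M" for k
    using \<phi>Lp by (auto simp: Lp_space_def)
  define I where "I = (\<integral>x. norm (g x) ^ p + \<bar>u x\<bar> ^ p \<partial>?M)"
  define \<epsilon> where "\<epsilon> = (\<lambda>k. \<integral>x. norm (g x - gradient (\<phi> k) x) ^ p + \<bar>u x - \<phi> k x\<bar> ^ p \<partial>?M)"
  have I_int: "integrable ?M (\<lambda>x. norm (g x) ^ p + \<bar>u x\<bar> ^ p)"
    and I_int': "integrable ?M (\<lambda>x. norm (g x) ^ p)" "integrable ?M (\<lambda>x. \<bar>u x\<bar> ^ p)"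
    using uLp gLp by (auto simp: Lp_space_def)
  have d_int: "integrable ?M (\<lambda>x. norm (g x - gradient (\<phi> k) x) ^ p)" "integrable ?M (\<lambda>x. \<bar>u x - \<phi> k x\<bar> ^ p)" for k
    using Lp_space_diff[OF gLp \<phi>Lp(2)] Lp_space_diff[OF uLp \<phi>Lp(1)] by (auto simp: Lp_space_def)
  have "sobolev_norm p \<Omega> u = root p I"
    unfolding I_def by (rule sobolev_norm_eq[OF \<Omega> g um(2,1)])
  then have I_le: "I \<le> 1" using norm p by simp
  have \<epsilon>_nonneg: "0 \<le> \<epsilon> k" for k unfolding \<epsilon>_def by (intro integral_nonneg_AE) auto
  have "sobolev_norm p \<Omega> (\<lambda>x. u x - \<phi> k x) = root p (\<epsilon> k)" for k
    unfolding \<epsilon>_def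
    by (rule sobolev_norm_eq[OF \<Omega> has_weak_gradient_diff[OF \<Omega> g test_function_has_weak_gradient[OF \<Omega> \<phi>]]]) measurable
  with conv have "(\<lambda>k. root p (\<epsilon> k)) \<longlonglongrightarrow> 0" by simp
  then have "(\<lambda>k. root p (\<epsilon> k) ^ p) \<longlonglongrightarrow> 0 ^ p" by (rule tendsto_power)
  then have \<epsilon>: "\<epsilon> \<longlonglongrightarrow> 0" using p \<epsilon>_nonneg by (simp add: power_0_left)
  have "(\<lambda>k. \<integral>x. norm (\<bar>u x - \<phi> k x\<bar> ^ p) \<partial>?M) \<longlonglongrightarrow> 0"
  proof (rule tendsto_sandwich[OF _ _ tendsto_const \<epsilon>])
    show "\<forall>\<^sub>F k in sequentially. 0 \<le> (\<integral>x. norm (\<bar>u x - \<phi> k x\<bar> ^ p) \<partial>?M)" by simp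
    have "(\<integral>x. norm (\<bar>u x - \<phi> k x\<bar> ^ p) \<partial>?M) \<le> \<epsilon> k" for k
      unfolding \<epsilon>_def using d_int by (intro integral_mono) auto
    then show "\<forall>\<^sub>F k in sequentially. (\<integral>x. norm (\<bar>u x - \<phi> k x\<bar> ^ p) \<partial>?M) \<le> \<epsilon> k" by simp
  qed
  from tendsto_L1_AE_subseq[OF d_int(2) this] obtain r where r: "strict_mono r"
    and AE: "AE x in ?M. (\<lambda>k. \<bar>u x - \<phi> (r k) x\<bar> ^ p) \<longlonglongrightarrow> 0" by auto
  from \<theta> obtain C where C: "0 \<le> C" "\<And>a b. 0 \<le> a \<Longrightarrow> 0 \<le> b \<Longrightarrow> (\<theta> * (a + b)) ^ p \<le> a ^ p + C * b ^ p"
    using power_add_le_mult[of \<theta> p] by blast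
  define w where "w = (\<lambda>k x. \<theta>\<^sup>2 * \<phi> (r k) x)"
  show thesis
  proof
    show wt: "w k \<in> test_functions \<Omega>" for k unfolding w_def by (rule test_function_scale[OF \<phi>])
    show "AE x in ?M. (\<lambda>k. w k x) \<longlonglongrightarrow> \<theta>\<^sup>2 * u x"
      using AE
    proof eventually_elim
      case (elim x)
      have "(\<lambda>k. root p (\<bar>u x - \<phi> (r k) x\<bar> ^ p)) \<longlonglongrightarrow> root p 0" by (intro tendsto_real_root elim)
      then have "(\<lambda>k. \<bar>u x - \<phi> (r k) x\<bar>) \<longlonglongrightarrow> 0" using p by (simp add: real_root_power_cancel)
      then have "(\<lambda>k. u x - (u x - \<phi> (r k) x)) \<longlonglongrightarrow> u x - 0"
        by (intro tendsto_diff tendsto_const) (simp add: tendsto_rabs_zero_iff)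
      then show ?case unfolding w_def by (intro tendsto_mult tendsto_const) simp
    qed
    have bound: "(\<integral>x. norm (gradient (w k) x) ^ p + \<bar>w k x\<bar> ^ p \<partial>lborel) \<le> \<theta> ^ p * (1 + C * \<epsilon> (r k))" for k
    proof -
      have grad_w: "gradient (w k) x = \<theta>\<^sup>2 *\<^sub>R gradient (\<phi> (r k)) x" for x
        unfolding w_def by (rule test_function_scale[OF \<phi>])
      have *: "(\<theta>\<^sup>2 * c) ^ p \<le> \<theta> ^ p * (a ^ p + C * b ^ p)" if "c \<le> a + b" "0 \<le> a" "0 \<le> b" "0 \<le> c" for a b c
      proof -
        have "(\<theta>\<^sup>2 * c) ^ p = \<theta> ^ p * (\<theta> * c) ^ p" by (simp add: power_mult_distrib power2_eq_square mult_ac)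
        also have "\<dots> \<le> \<theta> ^ p * (\<theta> * (a + b)) ^ p"
          using that \<theta> by (intro mult_left_mono power_mono) auto
        also have "\<dots> \<le> \<theta> ^ p * (a ^ p + C * b ^ p)"
          using that \<theta> by (intro mult_left_mono C) auto
        finally show ?thesis .
      qed
      note c1 = test_function_c1_compact[OF wt[of k]]
      note [measurable] = c1_compact_measurable[OF c1]
      have "(\<integral>x. norm (gradient (w k) x) ^ p + \<bar>w k x\<bar> ^ p \<partial>lborel) = (\<integral>x. norm (gradient (w k) x) ^ p + \<bar>w k x\<bar> ^ p \<partial>?M)"
        using p test_function_zero_outside[OF wt[of k]]
        by (intro integral_lebesgue_on_eq_lborel[symmetric] \<Omega>) (auto simp: power_0_left)
      also have "\<dots> \<le> (\<integral>x. \<theta> ^ p * ((norm (g x) ^ p + \<bar>u x\<bar> ^ p) + C * (norm (g x - gradient (\<phi> (r k)) x) ^ p + \<bar>u x - \<phi> (r k) x\<bar> ^ p)) \<partial>?M)"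
      proof (rule integral_mono)
        show "integrable ?M (\<lambda>x. norm (gradient (w k) x) ^ p + \<bar>w k x\<bar> ^ p)"
          using test_function_Lp[OF \<Omega> p wt[of k]] by (auto simp: Lp_space_def)
        show "integrable ?M (\<lambda>x. \<theta> ^ p * ((norm (g x) ^ p + \<bar>u x\<bar> ^ p) + C * (norm (g x - gradient (\<phi> (r k)) x) ^ p + \<bar>u x - \<phi> (r k) x\<bar> ^ p)))"
          using I_int' d_int by (intro integrable_mult_right Bochner_Integration.integrable_add) auto
        fix x
        have "norm (gradient (\<phi> (r k)) x) \<le> norm (g x) + norm (g x - gradient (\<phi> (r k)) x)"
          using norm_triangle_ineq4[of "g x" "g x - gradient (\<phi> (r k)) x"] by simp
        from *[OF this] have 1: "norm (gradient (w k) x) ^ p \<le> \<theta> ^ p * (norm (g x) ^ p + C * norm (g x - gradient (\<phi> (r k)) x) ^ p)"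
          by (simp add: grad_w)
        have "\<bar>\<phi> (r k) x\<bar> \<le> \<bar>u x\<bar> + \<bar>u x - \<phi> (r k) x\<bar>" by linarith
        from *[OF this] have 2: "\<bar>w k x\<bar> ^ p \<le> \<theta> ^ p * (\<bar>u x\<bar> ^ p + C * \<bar>u x - \<phi> (r k) x\<bar> ^ p)"
          by (simp add: w_def abs_mult)
        show "norm (gradient (w k) x) ^ p + \<bar>w k x\<bar> ^ p \<le> \<theta> ^ p * ((norm (g x) ^ p + \<bar>u x\<bar> ^ p) + C * (norm (g x - gradient (\<phi> (r k)) x) ^ p + \<bar>u x - \<phi> (r k) x\<bar> ^ p))"
          using add_mono[OF 1 2] by (simp add: algebra_simps)
      qed
      also have "\<dots> = \<theta> ^ p * (I + C * \<epsilon> (r k))"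
        unfolding I_def \<epsilon>_def using I_int' d_int
        by (simp add: Bochner_Integration.integral_add Bochner_Integration.integrable_add)
      also have "\<dots> \<le> \<theta> ^ p * (1 + C * \<epsilon> (r k))" using I_le \<theta> by (intro mult_left_mono) auto
      finally show ?thesis .
    qed
    have "(\<lambda>k. \<theta> ^ p * (1 + C * \<epsilon> (r k))) \<longlonglongrightarrow> \<theta> ^ p * (1 + C * 0)"
      using LIMSEQ_subseq_LIMSEQ[OF \<epsilon> r] by (intro tendsto_intros) (simp add: o_def)
    moreover have "\<theta> ^ p * (1 + C * 0) < 1" using \<theta> p by (simp add: power_less_one_iff)
    ultimately have "\<forall>\<^sub>F k in sequentially. \<theta> ^ p * (1 + C * \<epsilon> (r k)) < 1" by (rule order_tendstoD(2))
    then show "\<forall>\<^sub>F k in sequentially. (\<integral>x. norm (gradient (w k) x) ^ p + \<bar>w k x\<bar> ^ p \<partial>lborel) \<le> 1"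
      by eventually_elim (use bound in \<open>auto intro: order_trans less_imp_le\<close>)
  qed
qed

text \<open>
  Fatou's lemma is applied twice: along the approximating test functions for a fixed factor, and then for factors that
  increase to \<open>1\<close>.
\<close>

theorem moser_sup_bounded:
  assumes n: "2 \<le> DIM('a::euclidean_space)"
  obtains D where "0 < D" "\<And>\<Omega> :: 'a set. open \<Omega> \<Longrightarrow> moser_sup (moser_const TYPE('a)) \<Omega> \<le> ennreal D"
proof -
  let ?n = "DIM('a)"
  define q where "q = real ?n / (real ?n - 1)"
  have q: "0 < q" using n by (simp add: q_def)
  let ?F = "\<lambda>t. ennreal (trunc_exp ?n (moser_alpha ?n * \<bar>t\<bar> powr q))"
  obtain D where D: "0 < D" and bound: "\<And>(u :: 'a \<Rightarrow> real) Du. c1_compact u Du \<Longrightarrow>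
    (\<integral>\<^sup>+x. ennreal (norm (Du x) ^ ?n + \<bar>u x\<bar> ^ ?n) \<partial>lborel) \<le> 1 \<Longrightarrow> (\<integral>\<^sup>+x. ?F (u x) \<partial>lborel) \<le> ennreal D"
    using moser_bound_c1_compact[OF n] unfolding q_def by blast
  show thesis
  proof
    fix \<Omega> :: "'a set" assume \<Omega>: "open \<Omega>"
    show "moser_sup (moser_const TYPE('a)) \<Omega> \<le> ennreal D"
      unfolding moser_sup_def moser_const_eq q_def[symmetric]
    proof (rule SUP_least)
      fix u assume "u \<in> {u \<in> sobolev_space_0 ?n \<Omega>. sobolev_norm ?n \<Omega> u \<le> 1}"
      then have u: "u \<in> sobolev_space_0 ?n \<Omega>" "sobolev_norm ?n \<Omega> u \<le> 1" by auto
      then have um: "u \<in> borel_measurable (lebesgue_on \<Omega>)"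
        by (auto simp: sobolev_space_0_def sobolev_space_def Lp_space_def)
      have scaled: "(\<integral>\<^sup>+x. ?F (\<theta>\<^sup>2 * u x) \<partial>lebesgue_on \<Omega>) \<le> ennreal D" if \<theta>: "0 < \<theta>" "\<theta> < 1" for \<theta>
      proof -
        obtain w where w: "\<And>k. w k \<in> test_functions \<Omega>"
          and lim: "AE x in lebesgue_on \<Omega>. (\<lambda>k. w k x) \<longlonglongrightarrow> \<theta>\<^sup>2 * u x"
          and le1: "\<forall>\<^sub>F k in sequentially. (\<integral>x. norm (gradient (w k) x) ^ ?n + \<bar>w k x\<bar> ^ ?n \<partial>lborel) \<le> 1"
          using sobolev_space_0_approximation[OF \<Omega> _ u \<theta>] DIM_positive by blast
        show ?thesis
        proof (rule fatou_trunc_exp[OF q _ lim])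
          show "w k \<in> borel_measurable (lebesgue_on \<Omega>)" for k
            using test_function_Lp(1)[OF \<Omega> zero_less_one w, of k] by (simp add: Lp_space_def)
          show "\<forall>\<^sub>F k in sequentially. (\<integral>\<^sup>+x. ?F (w k x) \<partial>lebesgue_on \<Omega>) \<le> ennreal D"
            using le1
          proof eventually_elim
            case (elim k)
            have "(\<integral>\<^sup>+x. ennreal (norm (gradient (w k) x) ^ ?n + \<bar>w k x\<bar> ^ ?n) \<partial>lborel)
              = ennreal (\<integral>x. norm (gradient (w k) x) ^ ?n + \<bar>w k x\<bar> ^ ?n \<partial>lborel)"
              by (intro nn_integral_eq_integral sobolev_norm_test_function(2)[OF \<Omega> DIM_positive w]) auto
            also have "\<dots> \<le> 1" using elim by simp
            finally have "(\<integral>\<^sup>+x. ?F (w k x) \<partial>lborel) \<le> ennreal D"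
              by (rule bound[OF test_function_c1_compact[OF w]])
            then show ?case by (rule order_trans[OF nn_integral_lebesgue_on_le_lborel[OF \<Omega>]])
          qed
        qed
      qed
      define \<mu> where "\<mu> = (\<lambda>k::nat. 1 - inverse (real (Suc (Suc k))))"
      show "(\<integral>\<^sup>+x. ?F (u x) \<partial>lebesgue_on \<Omega>) \<le> ennreal D"
      proof (rule fatou_trunc_exp[OF q])
        show "(\<lambda>x. (\<mu> k)\<^sup>2 * u x) \<in> borel_measurable (lebesgue_on \<Omega>)" for k using um by measurable
        have "\<mu> \<longlonglongrightarrow> 1 - 0" unfolding \<mu>_def
          by (intro tendsto_diff tendsto_const LIMSEQ_Suc[OF LIMSEQ_inverse_real_of_nat])
        then have "(\<lambda>k. (\<mu> k)\<^sup>2 * c) \<longlonglongrightarrow> (1 - 0)\<^sup>2 * c" for c by (intro tendsto_intros)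
        then show "AE x in lebesgue_on \<Omega>. (\<lambda>k. (\<mu> k)\<^sup>2 * u x) \<longlonglongrightarrow> u x" by simp
        have "0 < \<mu> k" "\<mu> k < 1" for k by (auto simp: \<mu>_def field_simps)
        then show "\<forall>\<^sub>F k in sequentially. (\<integral>\<^sup>+x. ?F ((\<mu> k)\<^sup>2 * u x) \<partial>lebesgue_on \<Omega>) \<le> ennreal D"
          by (intro always_eventually allI scaled)
      qed
    qed
  qed (rule D)
qed

section \<open>Smooth concentrating functions\<close>

lemma power_le_fact_mult_exp:
  fixes s :: real
  assumes "0 \<le> s"
  shows "s ^ k \<le> fact k * exp s"
proof -
  have "(\<Sum>i\<in>{k}. s ^ i /\<^sub>R fact i) \<le> (\<Sum>i. s ^ i /\<^sub>R fact i)"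
    using assms by (intro sum_le_suminf summable_exp_generic) auto
  also have "(\<Sum>i. s ^ i /\<^sub>R fact i) = exp s" by (rule sums_unique[OF exp_converges, symmetric])
  finally have "s ^ k / fact k \<le> exp s" by (simp add: divide_inverse mult.commute)
  then show ?thesis by (simp add: pos_divide_le_eq mult.commute)
qed

text \<open>
  A smooth replacement for the positive part. The slope for \<open>s > 0\<close> is \<open>(1 + 1/s) exp (- 1/s) \<le> 1\<close>, so truncation by
  this function does not increase the energy, and \<open>s - 1 \<le> ramp s\<close>, so it lowers the height by at most \<open>1\<close>.
\<close>

definition ramp :: "real \<Rightarrow> real" where
  "ramp s = s * flat_exp s"

lemma ramp_bounds:
  shows "0 \<le> ramp s" "s \<le> 0 \<Longrightarrow> ramp s = 0" "0 \<le> s \<Longrightarrow> ramp s \<le> s" "s - 1 \<le> ramp s"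
proof -
  show "0 \<le> ramp s" "s \<le> 0 \<Longrightarrow> ramp s = 0" by (auto simp: ramp_def flat_exp_def)
  show "0 \<le> s \<Longrightarrow> ramp s \<le> s" using flat_exp_bounds(2)[of s] by (simp add: ramp_def mult_left_le)
  show "s - 1 \<le> ramp s"
  proof (cases "0 < s")
    case True
    have "1 - 1 / s \<le> exp (- (1 / s))" using exp_ge_add_one_self[of "- (1 / s)"] by simp
    then have "s * (1 - 1 / s) \<le> s * exp (- (1 / s))" using True by (intro mult_left_mono) auto
    then show ?thesis using True by (simp add: ramp_def flat_exp_def algebra_simps)
  qed (simp add: ramp_def flat_exp_def)
qed

lemma ramp_has_derivative:
  obtains d where "(ramp has_real_derivative d) (at s)" "\<bar>d\<bar> \<le> 1" "s \<le> 0 \<Longrightarrow> d = 0"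
proof
  let ?d = "1 * flat_exp s + flat ([:0, 0, 1:] * (1 - pderiv 1)) s * s"
  have eq: "flat 1 = flat_exp" by (auto simp: flat_def flat_exp_def fun_eq_iff)
  show "(ramp has_real_derivative ?d) (at s)"
    unfolding ramp_def[abs_def] eq[symmetric]
    by (rule DERIV_mult[OF DERIV_ident flat_has_derivative])
  show "s \<le> 0 \<Longrightarrow> ?d = 0" by (simp add: flat_exp_def flat_def)
  show "\<bar>?d\<bar> \<le> 1"
  proof (cases "0 < s")
    case True
    then have "?d = (1 + 1 / s) * exp (- (1 / s))"
      by (simp add: flat_exp_def flat_def pderiv_1 power2_eq_square algebra_simps)
    also have "\<dots> \<le> exp (1 / s) * exp (- (1 / s))"
      using exp_ge_add_one_self[of "1 / s"] by (intro mult_right_mono) auto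
    also have "\<dots> = 1" by (simp add: exp_minus)
    finally show ?thesis using True by (simp add: flat_exp_def flat_def)
  qed (simp add: flat_exp_def flat_def)
qed

text \<open>
  The argument of \<open>ramp\<close> is \<open>ln (R / sqrt (|x - a|\<^sup>2 + r\<^sup>2))\<close>: a smooth version of the function
  \<open>min (ln (R / |x - a|)) (ln (R / r))\<close> used by Moser.
\<close>

definition log_profile :: "'a::euclidean_space \<Rightarrow> real \<Rightarrow> real \<Rightarrow> 'a \<Rightarrow> real" where
  "log_profile a R r x = ramp (- ln (((norm (x - a))\<^sup>2 + r\<^sup>2) / R\<^sup>2) / 2)"

context
  fixes a :: "'a::euclidean_space" and R r :: real
  assumes r: "0 < r" "r < R"
begin

lemma log_profile_arg_pos: "0 < ((norm (x - a))\<^sup>2 + r\<^sup>2) / R\<^sup>2"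
  using r by (auto intro!: divide_pos_pos add_nonneg_pos)

lemma log_profile_smooth: "smooth (log_profile a R r)"
proof -
  have "smooth (\<lambda>x. ((norm (x - a))\<^sup>2 + r\<^sup>2) * (1 / R\<^sup>2))"
    by (intro smooth_mult smooth_add smooth_dist_squared smooth_const)
  then have "smooth (\<lambda>x. ((norm (x - a))\<^sup>2 + r\<^sup>2) / R\<^sup>2)" by simp
  from smooth_mult[OF smooth_ln[OF this log_profile_arg_pos] smooth_const, of "- (1/2)"]
  have l: "smooth (\<lambda>x. - ln (((norm (x - a))\<^sup>2 + r\<^sup>2) / R\<^sup>2) / 2)" by simp
  show ?thesis unfolding log_profile_def[abs_def] ramp_def
    by (rule smooth_mult[OF l smooth_flat_exp[OF l]])
qed

lemma log_profile_gradient: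
  obtains d where "\<bar>d\<bar> \<le> 1" "- ln (((norm (y - a))\<^sup>2 + r\<^sup>2) / R\<^sup>2) / 2 \<le> 0 \<Longrightarrow> d = 0"
    "gradient (log_profile a R r) y = (- d / ((norm (y - a))\<^sup>2 + r\<^sup>2)) *\<^sub>R (y - a)"
proof -
  let ?f = "\<lambda>x. ((norm (x - a))\<^sup>2 + r\<^sup>2) / R\<^sup>2"
  let ?l = "\<lambda>x. - ln (?f x) / 2"
    obtain d where d: "(ramp has_real_derivative d) (at (?l y))" "\<bar>d\<bar> \<le> 1" "?l y \<le> 0 \<Longrightarrow> d = 0"
      using ramp_has_derivative[of "?l y"] by blast
    have "((\<lambda>x. (norm (x - a))\<^sup>2) has_derivative (\<lambda>h. 2 * ((y - a) \<bullet> h))) (at y)"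
      unfolding power2_norm_eq_inner by (auto intro!: derivative_eq_intros simp: inner_commute)
    from has_derivative_mult_left[OF has_derivative_add[OF this has_derivative_const[of "r\<^sup>2"]], of "1 / R\<^sup>2"]
    have f: "(?f has_derivative (\<lambda>h. (2 * ((y - a) \<bullet> h)) / R\<^sup>2)) (at y)"
      by simp
    have "((\<lambda>t. ramp (- ln t / 2)) has_real_derivative d * (- (1 / ?f y) / 2)) (at (?f y))"
    proof (rule DERIV_chain2[where f = ramp and g = "\<lambda>t. - ln t / 2"])
      show "((\<lambda>t. - ln t / 2) has_real_derivative - (1 / ?f y) / 2) (at (?f y))"
        using log_profile_arg_pos[of y] by (intro DERIV_cdivide DERIV_minus DERIV_ln_divide)
    qed (rule d(1))
    then have "((\<lambda>t. ramp (- ln t / 2)) has_derivative (*) (d * (- (1 / ?f y) / 2))) (at (?f y))"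
      by (simp add: has_field_derivative_def)
    from has_derivative_compose[OF f this]
    have D: "(log_profile a R r has_derivative (\<lambda>h. d * (- (1 / ?f y) / 2) * ((2 * ((y - a) \<bullet> h)) / R\<^sup>2))) (at y)"
      by (simp add: log_profile_def[abs_def])
    have R: "R\<^sup>2 \<noteq> 0" "(norm (y - a))\<^sup>2 + r\<^sup>2 \<noteq> 0" using r log_profile_arg_pos[of y] by auto
    have "d * (- (1 / ?f y) / 2) * ((2 * ((y - a) \<bullet> h)) / R\<^sup>2) = ((- d / ((norm (y - a))\<^sup>2 + r\<^sup>2)) *\<^sub>R (y - a)) \<bullet> h" for h
    proof -
      have "d * (- (1 / (N / Q)) / 2) * ((2 * v) / Q) = (- d / N) * v" if "Q \<noteq> 0" "N \<noteq> 0" for N Q v :: real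
        using that by (simp add: field_simps)
      from this[OF R] show ?thesis by (simp only: inner_scaleR_left)
    qed
    with D have "(log_profile a R r has_derivative (\<lambda>h. ((- d / ((norm (y - a))\<^sup>2 + r\<^sup>2)) *\<^sub>R (y - a)) \<bullet> h)) (at y)"
      by simp
    then have "gradient (log_profile a R r) y = (- d / ((norm (y - a))\<^sup>2 + r\<^sup>2)) *\<^sub>R (y - a)"
      by (rule gradient_eqI)
    with d(2,3) show thesis by (rule that)
qed

lemma log_profile_eq_0:
  assumes "R \<le> norm (x - a)"
  shows "log_profile a R r x = 0" "gradient (log_profile a R r) x = 0"
proof -
  let ?f = "\<lambda>x. ((norm (x - a))\<^sup>2 + r\<^sup>2) / R\<^sup>2"
  let ?l = "\<lambda>x. - ln (?f x) / 2"
  have "R\<^sup>2 \<le> (norm (x - a))\<^sup>2" using assms r by (intro power_mono) auto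
  moreover have "0 \<le> r\<^sup>2" by simp
  ultimately have "R\<^sup>2 \<le> (norm (x - a))\<^sup>2 + r\<^sup>2" by linarith
  then have "1 \<le> ?f x" using r by simp
  then have l: "?l x \<le> 0" by simp
  then show "log_profile a R r x = 0" by (simp only: log_profile_def ramp_bounds(2))
  show "gradient (log_profile a R r) x = 0" using log_profile_gradient[of x] l by (metis (no_types, lifting) add.inverse_neutral div_0 scaleR_zero_left)
qed

lemma log_profile_gradient_le:
  "norm (gradient (log_profile a R r) y) \<le> norm (y - a) / ((norm (y - a))\<^sup>2 + r\<^sup>2)"
proof -
  obtain d where d: "\<bar>d\<bar> \<le> 1" "gradient (log_profile a R r) y = (- d / ((norm (y - a))\<^sup>2 + r\<^sup>2)) *\<^sub>R (y - a)"
    using log_profile_gradient[of y] by blast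
  have pos: "0 < (norm (y - a))\<^sup>2 + r\<^sup>2" using r by (intro add_nonneg_pos) auto
  have "norm (gradient (log_profile a R r) y) = \<bar>d\<bar> * (norm (y - a) / ((norm (y - a))\<^sup>2 + r\<^sup>2))"
    using pos by (simp add: d(2) abs_divide)
  also have "\<dots> \<le> norm (y - a) / ((norm (y - a))\<^sup>2 + r\<^sup>2)"
    using pos d(1) by (intro mult_left_le_one_le) auto
  finally show "norm (gradient (log_profile a R r) y) \<le> norm (y - a) / ((norm (y - a))\<^sup>2 + r\<^sup>2)" .
qed

lemma log_profile_bounds:
  shows "0 \<le> log_profile a R r x"
    and "x \<noteq> a \<Longrightarrow> norm (x - a) \<le> R \<Longrightarrow> log_profile a R r x \<le> ln (R / norm (x - a))"
    and "norm (x - a) \<le> r \<Longrightarrow> ln (R / r) - 2 \<le> log_profile a R r x"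
proof -
  let ?f = "\<lambda>x. ((norm (x - a))\<^sup>2 + r\<^sup>2) / R\<^sup>2"
  show "0 \<le> log_profile a R r x" by (simp add: log_profile_def ramp_bounds)
  have sq: "ln ((c / R)\<^sup>2) = - 2 * ln (R / c)" if "0 < c" for c
    using that r by (simp add: ln_realpow ln_div)
  show "log_profile a R r x \<le> ln (R / norm (x - a))" if "x \<noteq> a" "norm (x - a) \<le> R"
  proof -
    have "(norm (x - a) / R)\<^sup>2 \<le> ?f x" using r by (simp add: power_divide divide_right_mono)
    then have "ln ((norm (x - a) / R)\<^sup>2) \<le> ln (?f x)"
      using that r by (intro ln_mono) auto
    then have 1: "- ln (?f x) / 2 \<le> ln (R / norm (x - a))" using that by (subst (asm) sq) auto
    have 2: "0 \<le> ln (R / norm (x - a))" using that r by simp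
    show ?thesis
    proof (cases "- ln (?f x) / 2 \<le> 0")
      case True
      then have "log_profile a R r x = 0" unfolding log_profile_def by (rule ramp_bounds(2))
      with 2 show ?thesis by simp
    next
      case False
      then have "log_profile a R r x \<le> - ln (?f x) / 2" unfolding log_profile_def by (intro ramp_bounds(3)) simp
      with 1 show ?thesis by simp
    qed
  qed
  show "ln (R / r) - 2 \<le> log_profile a R r x" if "norm (x - a) \<le> r"
  proof -
    have "(norm (x - a))\<^sup>2 \<le> r\<^sup>2" using that by (intro power_mono) auto
    then have "?f x \<le> 2 * (r / R)\<^sup>2" by (simp add: power_divide divide_right_mono)
    then have "ln (?f x) \<le> ln (2 * (r / R)\<^sup>2)" using log_profile_arg_pos[of x] by (intro ln_mono) auto
    also have "\<dots> = ln 2 - 2 * ln (R / r)" using r by (subst ln_mult) (auto simp: sq)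
    finally have "ln (R / r) - 1 \<le> - ln (?f x) / 2" using ln_2_less_1 by linarith
    with ramp_bounds(4)[of "- ln (?f x) / 2"] show ?thesis by (simp add: log_profile_def)
  qed
qed

text \<open>
  The gradient is at most \<open>1 / r\<close> on the ball of radius \<open>r\<close> and at most \<open>1 / |x - a|\<close> on the annulus up to \<open>R\<close>,
  beyond which it vanishes.
\<close>

lemma log_profile_energy:
  "(\<integral>\<^sup>+x. ennreal (norm (gradient (log_profile a R r) x) ^ DIM('a)) \<partial>lborel)
    \<le> ennreal (unit_ball_vol DIM('a) + sphere_area DIM('a) * ln (R / r))"
proof -
  let ?n = "DIM('a)"
  have [measurable]: "cball a r \<in> sets borel" by simp
  have "(\<integral>\<^sup>+x. ennreal (norm (gradient (log_profile a R r) x) ^ ?n) \<partial>lborel)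
    \<le> (\<integral>\<^sup>+x. ennreal (1 / r ^ ?n) * indicator (cball a r) x + indicator {r..R} (norm (x - a)) * ennreal (1 / norm (x - a) ^ ?n) \<partial>lborel)"
  proof (rule nn_integral_mono)
    fix x
    define t where "t = norm (x - a)"
    have t0: "0 \<le> t" by (simp add: t_def)
    consider "t \<le> r" | "r < t" "t \<le> R" | "R < t" by linarith
    then show "ennreal (norm (gradient (log_profile a R r) x) ^ ?n) \<le>
      ennreal (1 / r ^ ?n) * indicator (cball a r) x + indicator {r..R} (norm (x - a)) * ennreal (1 / norm (x - a) ^ ?n)"
    proof cases
      case 1
      have "t * r \<le> r * r" using 1 r by (intro mult_right_mono) auto
      then have "t * r \<le> t\<^sup>2 + r\<^sup>2" by (simp add: power2_eq_square add_increasing)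
      moreover have "0 < t\<^sup>2 + r\<^sup>2" using r by (intro add_nonneg_pos) auto
      ultimately have "t / (t\<^sup>2 + r\<^sup>2) \<le> 1 / r" using r by (simp add: divide_simps mult.commute)
      with log_profile_gradient_le[of x] have "norm (gradient (log_profile a R r) x) \<le> 1 / r"
        by (simp add: t_def[symmetric])
      then have "norm (gradient (log_profile a R r) x) ^ ?n \<le> (1 / r) ^ ?n" by (intro power_mono) auto
      then have "ennreal (norm (gradient (log_profile a R r) x) ^ ?n) \<le> ennreal (1 / r ^ ?n) * indicator (cball a r) x"
        using 1 by (simp add: t_def dist_norm norm_minus_commute power_one_over ennreal_leI)
      then show ?thesis by (rule add_increasing2[rotated]) simp
    next
      case 2
      have "t / (t\<^sup>2 + r\<^sup>2) \<le> t / t\<^sup>2" using 2 r t0 by (intro divide_left_mono) (auto intro!: mult_pos_pos add_pos_nonneg)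
      also have "\<dots> = 1 / t" by (simp add: power2_eq_square)
      finally have "t / (t\<^sup>2 + r\<^sup>2) \<le> 1 / t" .
      with log_profile_gradient_le[of x] have "norm (gradient (log_profile a R r) x) \<le> 1 / t"
        by (simp add: t_def[symmetric])
      then have "norm (gradient (log_profile a R r) x) ^ ?n \<le> (1 / t) ^ ?n" by (intro power_mono) auto
      then have "ennreal (norm (gradient (log_profile a R r) x) ^ ?n) \<le> indicator {r..R} (norm (x - a)) * ennreal (1 / norm (x - a) ^ ?n)"
        using 2 by (simp add: t_def[symmetric] power_one_over ennreal_leI)
      then show ?thesis by (rule add_increasing[rotated]) simp
    next
      case 3
      then show ?thesis by (simp add: log_profile_eq_0 t_def power_0_left)
    qed
  qed
  also have "\<dots> = ennreal (1 / r ^ ?n) * emeasure lborel (cball a r)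
     + (\<integral>\<^sup>+x. indicator {r..R} (norm (x - a)) * ennreal (1 / norm (x - a) ^ ?n) \<partial>lborel)"
    by (simp add: nn_integral_add nn_integral_cmult_indicator)
  also have "(\<integral>\<^sup>+x. indicator {r..R} (norm (x - a)) * ennreal (1 / norm (x - a) ^ ?n) \<partial>lborel)
    = (\<integral>\<^sup>+x. indicator {r..R} (norm x) * ennreal (1 / norm (x::'a) ^ ?n) \<partial>lborel)"
    by (subst nn_integral_lborel_affine[where c = 1 and t = a]) auto
  also have "\<dots> = ennreal (sphere_area ?n * ln (R / r))" using r by (intro nn_integral_inverse_norm_annulus) auto
  also have "ennreal (1 / r ^ ?n) * emeasure lborel (cball a r) = ennreal (unit_ball_vol ?n)"
    using r by (subst emeasure_cball) (auto simp: ennreal_mult[symmetric])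
  also have "ennreal (unit_ball_vol ?n) + ennreal (sphere_area ?n * ln (R / r)) = ennreal (unit_ball_vol ?n + sphere_area ?n * ln (R / r))"
    using r sphere_area_pos[of ?n] by (subst ennreal_plus) auto
  finally show ?thesis .
qed

text \<open>
  With \<open>t = |x - a|\<close>, the inequality \<open>s\<^sup>n \<le> n! exp s\<close> for \<open>s = ln (R / t)\<close> bounds the \<open>n\<close>-th power of the profile
  by \<open>n! R / t\<close>, which for \<open>t \<le> R\<close> is at most a multiple of the Riesz kernel. So the mass stays bounded as
  \<open>r\<close> tends to zero, while the energy grows.
\<close>

lemma log_profile_mass:
  assumes n: "2 \<le> DIM('a)"
  shows "(\<integral>\<^sup>+x. ennreal (\<bar>log_profile a R r x\<bar> ^ DIM('a)) \<partial>lborel)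
    \<le> ennreal (sphere_area DIM('a) * (fact DIM('a) * R ^ DIM('a)))"
proof -
  let ?n = "DIM('a)"
  let ?c = "fact ?n * R ^ (?n - 1)"
  have Rn: "R ^ ?n = R ^ (?n - 1) * R" using n by (cases ?n) auto
  have c: "0 \<le> ?c" using r by simp
  have [measurable]: "cball (0::'a) R \<in> sets borel" by simp
  have "(\<integral>\<^sup>+x. ennreal (\<bar>log_profile a R r x\<bar> ^ ?n) \<partial>lborel) \<le> (\<integral>\<^sup>+x. ennreal ?c * (indicator (cball 0 R) (x - a) * ennreal (1 / norm (x - a) ^ (?n - 1))) \<partial>lborel)"
  proof (intro nn_integral_mono_AE eventually_mono[OF AE_lborel_neq[of a]])
    fix x assume "x \<noteq> a"
    define t where "t = norm (x - a)"
    have t: "0 < t" using \<open>x \<noteq> a\<close> by (simp add: t_def)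
    show "ennreal (\<bar>log_profile a R r x\<bar> ^ ?n) \<le> ennreal ?c * (indicator (cball 0 R) (x - a) * ennreal (1 / norm (x - a) ^ (?n - 1)))"
    proof (cases "t \<le> R")
      case True
      define s where "s = ln (R / t)"
      have s: "0 \<le> s" "exp s = R / t" using True t r by (auto simp: s_def)
      have "s ^ ?n \<le> fact ?n * (R / t)" using power_le_fact_mult_exp[OF s(1), of ?n] s(2) by simp
      also have "R / t \<le> R ^ (?n - 1) / t ^ (?n - 1)"
      proof -
        have "(R / t) ^ 1 \<le> (R / t) ^ (?n - 1)" using True t n by (intro power_increasing) auto
        then show ?thesis by (simp add: power_divide)
      qed
      finally have "s ^ ?n \<le> ?c * (1 / t ^ (?n - 1))" by (simp add: mult_left_mono)
      moreover have "\<bar>log_profile a R r x\<bar> ^ ?n \<le> s ^ ?n"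
        using log_profile_bounds(1,2)[of x] \<open>x \<noteq> a\<close> True by (intro power_mono) (auto simp: s_def t_def)
      ultimately have "\<bar>log_profile a R r x\<bar> ^ ?n \<le> ?c * (1 / t ^ (?n - 1))" by simp
      then have "ennreal (\<bar>log_profile a R r x\<bar> ^ ?n) \<le> ennreal ?c * ennreal (1 / t ^ (?n - 1))"
        using c t by (subst ennreal_mult[symmetric]) (auto intro!: ennreal_leI)
      then show ?thesis using True by (simp add: t_def)
    next
      case False
      then show ?thesis by (simp add: log_profile_eq_0 t_def power_0_left)
    qed
  qed
  also have "\<dots> = ennreal ?c * (\<integral>\<^sup>+x. indicator (cball 0 R) (x - a) * ennreal (1 / norm (x - a) ^ (?n - 1)) \<partial>lborel)"
    by (rule nn_integral_cmult) measurable
  also have "(\<integral>\<^sup>+x. indicator (cball 0 R) (x - a) * ennreal (1 / norm (x - a) ^ (?n - 1)) \<partial>lborel)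
    = (\<integral>\<^sup>+x. indicator (cball 0 R) x * ennreal (1 / norm (x::'a) ^ (?n - 1)) \<partial>lborel)"
    by (subst nn_integral_lborel_affine[where c = 1 and t = a]) auto
  also have "\<dots> = ennreal (sphere_area ?n * R)" using r by (intro nn_integral_riesz_kernel_cball) auto
  also have "ennreal ?c * ennreal (sphere_area ?n * R) = ennreal (sphere_area ?n * (fact ?n * R ^ ?n))"
    using c r sphere_area_pos[of ?n] by (subst ennreal_mult[symmetric]) (auto simp: Rn mult_ac)
  finally show ?thesis .
qed

end

section \<open>Sharpness\<close>

lemma eventually_trunc_exp_ge: "\<forall>\<^sub>F t in at_top. exp t / 2 \<le> trunc_exp n t"
proof -
  have "((\<lambda>t::real. \<Sum>j = 0..n - 2. (t ^ j / exp t) / fact j) \<longlongrightarrow> (\<Sum>j = 0..n - 2. 0 / fact j)) at_top"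
    by (intro tendsto_sum tendsto_divide tendsto_power_div_exp_0 tendsto_const) auto
  then have "((\<lambda>t::real. \<Sum>j = 0..n - 2. (t ^ j / exp t) / fact j) \<longlongrightarrow> 0) at_top" by simp
  then have "\<forall>\<^sub>F t::real in at_top. (\<Sum>j = 0..n - 2. (t ^ j / exp t) / fact j) < 1/2"
    by (rule order_tendstoD(2)) simp
  then show ?thesis
  proof eventually_elim
    case (elim t)
    have "(\<Sum>j = 0..n - 2. (t ^ j / exp t) / fact j) = (\<Sum>j = 0..n - 2. t ^ j / fact j) / exp t"
      by (simp add: sum_divide_distrib divide_divide_eq_left mult.commute)
    with elim have "(\<Sum>j = 0..n - 2. t ^ j / fact j) / exp t < 1/2" by simp
    then have "(\<Sum>j = 0..n - 2. t ^ j / fact j) < (1/2) * exp t" by (subst (asm) pos_divide_less_eq) auto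
    then show ?case by (simp add: trunc_exp_def)
  qed
qed

text \<open>
  Since \<open>n / (n - 1) = 1 + 1 / (n - 1)\<close>, the power on the right is asymptotic to \<open>L\<close>.
\<close>

lemma eventually_concentration_exponent:
  fixes n C :: real
  assumes "1 < \<gamma>" "\<gamma> < \<beta>" "2 \<le> n" "0 < C"
  shows "\<forall>\<^sub>F L in at_top. \<gamma> * L \<le> \<beta> * ((L - 2) / (L + C) powr (1/n)) powr (n / (n - 1))"
proof -
  have "((\<lambda>L::real. inverse L) \<longlongrightarrow> 0) at_top" by (rule tendsto_inverse_0_at_top[OF filterlim_ident])
  then have "((\<lambda>L::real. 1 - 2 * inverse L) \<longlongrightarrow> 1 - 2 * 0) at_top" by (intro tendsto_intros)
  moreover have "filterlim (\<lambda>L. C + L) at_top at_top"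
    by (rule filterlim_tendsto_add_at_top[OF tendsto_const filterlim_ident])
  then have "((\<lambda>L. inverse (L + C)) \<longlongrightarrow> 0) at_top"
    by (intro tendsto_inverse_0_at_top) (simp add: add.commute)
  then have "((\<lambda>L::real. (1 - (2 + C) * inverse (L + C)) powr (1 / (n - 1))) \<longlongrightarrow> (1 - (2 + C) * 0) powr (1 / (n - 1))) at_top"
    by (intro tendsto_powr tendsto_intros) auto
  ultimately have "((\<lambda>L. \<beta> * ((1 - 2 * inverse L) * (1 - (2 + C) * inverse (L + C)) powr (1 / (n - 1)))) \<longlongrightarrow> \<beta> * ((1 - 2 * 0) * (1 - (2 + C) * 0) powr (1 / (n - 1)))) at_top"
    by (intro tendsto_mult tendsto_const)
  then have "((\<lambda>L. \<beta> * ((1 - 2 * inverse L) * (1 - (2 + C) * inverse (L + C)) powr (1 / (n - 1)))) \<longlongrightarrow> \<beta>) at_top" by simp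
  then have "\<forall>\<^sub>F L in at_top. \<gamma> < \<beta> * ((1 - 2 * inverse L) * (1 - (2 + C) * inverse (L + C)) powr (1 / (n - 1)))"
    using assms by (intro order_tendstoD(1)) auto
  then show ?thesis using eventually_gt_at_top[of 2]
  proof eventually_elim
    case (elim L)
    define q where "q = n / (n - 1)"
    have q: "q = 1 + 1 / (n - 1)" "q / n = 1 / (n - 1)" using assms by (auto simp: q_def field_simps)
    have L: "0 < L - 2" "0 < L + C" using elim assms by auto
    have "((L - 2) / (L + C) powr (1/n)) powr q = (L - 2) powr q / (L + C) powr (1 / (n - 1))"
      using L by (simp add: powr_divide powr_powr q(2))
    also have "(L - 2) powr q = (L - 2) * (L - 2) powr (1 / (n - 1))"
      unfolding q(1) using L by (simp add: powr_add)
    also have "(L - 2) * (L - 2) powr (1 / (n - 1)) / (L + C) powr (1 / (n - 1)) = (L - 2) * ((L - 2) / (L + C)) powr (1 / (n - 1))"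
      using L by (simp add: powr_divide)
    also have "(L - 2) / (L + C) = 1 - (2 + C) * inverse (L + C)" using L by (simp add: field_simps)
    also have "(L - 2) * (1 - (2 + C) * inverse (L + C)) powr (1 / (n - 1)) = L * (1 - 2 * inverse L) * (1 - (2 + C) * inverse (L + C)) powr (1 / (n - 1))"
      using L by (simp add: algebra_simps)
    finally have eq: "((L - 2) / (L + C) powr (1/n)) powr q = L * ((1 - 2 * inverse L) * (1 - (2 + C) * inverse (L + C)) powr (1 / (n - 1)))"
      by (simp add: mult.assoc)
    have "\<gamma> * L \<le> (\<beta> * ((1 - 2 * inverse L) * (1 - (2 + C) * inverse (L + C)) powr (1 / (n - 1)))) * L"
      using elim L by (intro mult_right_mono) auto
    then show ?case unfolding q_def[symmetric] eq by (simp add: mult_ac)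
  qed
qed

text \<open>
  With \<open>\<beta> = \<alpha> / \<alpha>\<^sub>n > 1\<close>, the normalized profile makes the exponent at least \<open>\<gamma> n L\<close> on the ball of radius
  \<open>r = R exp (- L)\<close>, for some \<open>\<gamma>\<close> between \<open>1\<close> and \<open>\<beta>\<close>. The volume of this ball is proportional to
  \<open>exp (- n L)\<close>, so the integral is at least a multiple of \<open>exp ((\<gamma> - 1) n L)\<close>.
\<close>

proposition moser_sup_eq_infinity:
  fixes \<Omega> :: "'a::euclidean_space set"
  assumes n: "2 \<le> DIM('a)" and \<Omega>: "open \<Omega>" "\<Omega> \<noteq> {}" and \<alpha>: "moser_const TYPE('a) < \<alpha>"
  shows "moser_sup \<alpha> \<Omega> = \<infinity>"
proof -
  let ?n = "DIM('a)"
  define \<omega> q \<beta> \<gamma> where "\<omega> = sphere_area ?n" and "q = real ?n / (real ?n - 1)"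
    and "\<beta> = \<alpha> / moser_alpha ?n" and "\<gamma> = (1 + \<beta>) / 2"
  have \<omega>: "0 < \<omega>" by (simp add: \<omega>_def sphere_area_pos)
  have \<alpha>0: "0 < moser_alpha ?n" by (simp add: moser_alpha_pos)
  have \<beta>: "1 < \<beta>" "\<alpha> = \<beta> * moser_alpha ?n" using \<alpha> \<alpha>0 by (auto simp: \<beta>_def moser_const_eq)
  then have \<gamma>: "1 < \<gamma>" "\<gamma> < \<beta>" by (auto simp: \<gamma>_def)
  obtain a R where R: "0 < R" "cball a R \<subseteq> \<Omega>"
    using \<Omega> open_contains_cball by blast
  define C where "C = 1 / ?n + fact ?n * R ^ ?n"
  have C: "0 < C" using R n by (simp add: C_def add_pos_pos)
  define v where "v = unit_ball_vol (real ?n)"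
  have v: "0 < v" "\<omega> / ?n = v" using n by (auto simp: v_def \<omega>_def sphere_area_def)
  have large: "ennreal B \<le> moser_sup \<alpha> \<Omega>" for B
  proof -
    have exp_large: "filterlim (\<lambda>L. (v * R ^ ?n / 2) * exp ((\<gamma> - 1) * ?n * L)) at_top at_top"
      using v R \<gamma> n
      by (intro filterlim_tendsto_pos_mult_at_top[OF tendsto_const] filterlim_compose[OF exp_at_top]
          filterlim_tendsto_pos_mult_at_top[OF tendsto_const _ filterlim_ident]) auto
    have arg_large: "filterlim (\<lambda>L. (\<gamma> * ?n) * L) at_top at_top"
      using \<gamma> n by (intro filterlim_tendsto_pos_mult_at_top[OF tendsto_const _ filterlim_ident]) auto
    obtain T where T: "\<And>t. T \<le> t \<Longrightarrow> exp t / 2 \<le> trunc_exp ?n t"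
      using eventually_trunc_exp_ge[of ?n] by (auto simp: eventually_at_top_linorder)
    have "\<forall>\<^sub>F L in at_top. 2 < L \<and> \<gamma> * L \<le> \<beta> * ((L - 2) / (L + C) powr (1 / ?n)) powr q
        \<and> B \<le> (v * R ^ ?n / 2) * exp ((\<gamma> - 1) * ?n * L) \<and> T \<le> (\<gamma> * ?n) * L"
      unfolding q_def using n \<gamma> C
      by (intro eventually_conj eventually_gt_at_top eventually_concentration_exponent
          exp_large[unfolded filterlim_at_top, rule_format] arg_large[unfolded filterlim_at_top, rule_format]) auto
    then obtain L where L: "2 < L" "\<gamma> * L \<le> \<beta> * ((L - 2) / (L + C) powr (1 / ?n)) powr q"
      "B \<le> (v * R ^ ?n / 2) * exp ((\<gamma> - 1) * ?n * L)" "T \<le> (\<gamma> * ?n) * L"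
      by (auto dest: eventually_happens simp: trivial_limit_at_top_linorder)
    define r where "r = R * exp (- L)"
    have "R * exp (- L) < R * 1" using R L by (intro mult_strict_left_mono) auto
    then have r: "0 < r" "r < R" using R by (auto simp: r_def)
    have "R / r = exp L" using R by (simp add: r_def exp_minus field_simps)
    then have lnr: "ln (R / r) = L" by simp
    have rn: "r ^ ?n = R ^ ?n * exp (- (?n * L))"
      by (simp add: r_def power_mult_distrib exp_of_nat_mult[symmetric])
    define \<phi> where "\<phi> = log_profile a R r"
    define c where "c = 1 / (\<omega> * (L + C)) powr (1 / ?n)"
    have LC: "0 < \<omega> * (L + C)" using \<omega> L(1) C by simp
    have "(\<omega> * (L + C)) powr (1 / ?n) > 0" using LC by (simp only: powr_gt_zero)
    then have c: "0 < c" by (simp add: c_def)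
    have cn: "c ^ ?n = 1 / (\<omega> * (L + C))"
      using LC \<omega> L C n by (simp add: c_def power_divide powr_realpow[symmetric] powr_powr)
    have \<phi>_test: "\<phi> \<in> test_functions \<Omega>"
    proof (rule test_functionI[OF _ _ compact_cball R(2)])
      show "smooth \<phi>" unfolding \<phi>_def by (rule log_profile_smooth[OF r])
      show "{x. \<phi> x \<noteq> 0} \<subseteq> cball a R"
        using log_profile_eq_0(1)[OF r] by (force simp: \<phi>_def dist_norm norm_minus_commute)
    qed
    note \<phi>_c1 = test_function_c1_compact[OF \<phi>_test]
    note [measurable] = c1_compact_measurable[OF \<phi>_c1]
    have energy: "(\<integral>x. norm (gradient \<phi> x) ^ ?n + \<bar>\<phi> x\<bar> ^ ?n \<partial>lborel) \<le> \<omega> * (L + C)"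
    proof -
      have "ennreal (\<integral>x. norm (gradient \<phi> x) ^ ?n + \<bar>\<phi> x\<bar> ^ ?n \<partial>lborel)
        = (\<integral>\<^sup>+x. ennreal (norm (gradient \<phi> x) ^ ?n + \<bar>\<phi> x\<bar> ^ ?n) \<partial>lborel)"
        by (intro nn_integral_eq_integral[symmetric] sobolev_norm_test_function(2)[OF \<Omega>(1) DIM_positive \<phi>_test]) auto
      also have "\<dots> = (\<integral>\<^sup>+x. ennreal (norm (gradient \<phi> x) ^ ?n) \<partial>lborel) + (\<integral>\<^sup>+x. ennreal (\<bar>\<phi> x\<bar> ^ ?n) \<partial>lborel)"
        by (subst nn_integral_add[symmetric]) auto
      also have "\<dots> \<le> ennreal (v + \<omega> * L) + ennreal (\<omega> * (fact ?n * R ^ ?n))"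
        unfolding \<phi>_def v_def \<omega>_def lnr[symmetric]
        by (intro add_mono log_profile_energy[OF r] log_profile_mass[OF r n])
      also have "\<dots> = ennreal (\<omega> * (L + C))"
        using v \<omega> L R by (subst ennreal_plus[symmetric]) (auto simp: C_def algebra_simps)
      finally show ?thesis using LC by (subst (asm) ennreal_le_iff) auto
    qed
    define u where "u = (\<lambda>x. c * \<phi> x)"
    have u_test: "u \<in> test_functions \<Omega>" unfolding u_def by (rule test_function_scale(1)[OF \<phi>_test])
    have u_norm: "sobolev_norm ?n \<Omega> u \<le> 1"
    proof -
      have "norm (gradient u x) ^ ?n + \<bar>u x\<bar> ^ ?n = c ^ ?n * (norm (gradient \<phi> x) ^ ?n + \<bar>\<phi> x\<bar> ^ ?n)" for x
        unfolding u_def test_function_scale(2)[OF \<phi>_test] using c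
        by (simp add: abs_mult power_mult_distrib algebra_simps)
      then have "(\<integral>x. norm (gradient u x) ^ ?n + \<bar>u x\<bar> ^ ?n \<partial>lborel) = c ^ ?n * (\<integral>x. norm (gradient \<phi> x) ^ ?n + \<bar>\<phi> x\<bar> ^ ?n \<partial>lborel)"
        by simp
      also have "\<dots> \<le> c ^ ?n * (\<omega> * (L + C))" using energy c by (intro mult_left_mono) auto
      also have "\<dots> = 1" using LC \<omega> L(1) C by (simp add: cn)
      finally show ?thesis
        unfolding sobolev_norm_test_function(1)[OF \<Omega>(1) DIM_positive u_test] by simp
    qed
    have u_large: "\<gamma> * ?n * L \<le> \<alpha> * \<bar>u x\<bar> powr q" if "x \<in> cball a r" for x
    proof -
      have q0: "0 < q" using n by (simp add: q_def)
      have "norm (x - a) \<le> r" using that by (simp add: dist_norm norm_minus_commute)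
      then have "L - 2 \<le> \<phi> x" using log_profile_bounds(3)[OF r, of x a] by (simp add: \<phi>_def lnr)
      then have "(L - 2) * c \<le> \<bar>u x\<bar>" using c L by (simp add: u_def abs_mult mult.commute mult_left_mono)
      then have "\<alpha> * ((L - 2) * c) powr q \<le> \<alpha> * \<bar>u x\<bar> powr q"
        using c L q0 \<beta> \<alpha>0 by (intro mult_left_mono powr_mono2) auto
      moreover have "\<alpha> * ((L - 2) * c) powr q = ?n * (\<beta> * ((L - 2) / (L + C) powr (1 / ?n)) powr q)"
      proof -
        have "q / ?n = 1 / (real ?n - 1)" using n by (simp add: q_def field_simps)
        then have root_pow: "(X / \<omega> powr (1 / ?n)) powr q = X powr q / \<omega> powr (1 / (real ?n - 1))" if "0 \<le> X" for X
          using that by (simp add: powr_divide powr_powr)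
        have Lc: "(L - 2) * c = ((L - 2) / (L + C) powr (1 / ?n)) / \<omega> powr (1 / ?n)"
          using \<omega> L C by (simp add: c_def powr_mult)
        have "((L - 2) * c) powr q = ((L - 2) / (L + C) powr (1 / ?n)) powr q / \<omega> powr (1 / (real ?n - 1))"
          unfolding Lc by (rule root_pow) (use L(1) in simp)
        then show ?thesis using \<omega> by (simp add: \<beta>(2) moser_alpha_def \<omega>_def)
      qed
      moreover have "?n * (\<gamma> * L) \<le> ?n * (\<beta> * ((L - 2) / (L + C) powr (1 / ?n)) powr q)"
        using L(2) by (intro mult_left_mono) auto
      ultimately have "?n * (\<gamma> * L) \<le> \<alpha> * \<bar>u x\<bar> powr q" by (metis order_trans)
      then show ?thesis by (simp only: mult_ac)
    qed
    let ?b = "exp (\<gamma> * ?n * L) / 2"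
    have [measurable]: "cball a r \<in> sets borel" by simp
    have "B \<le> ?b * (v * r ^ ?n)"
    proof -
      have "exp ((\<gamma> - 1) * ?n * L) = exp (\<gamma> * ?n * L) * exp (- (?n * L))"
        by (simp add: exp_add[symmetric] algebra_simps)
      then show ?thesis using L(3) by (simp add: rn mult_ac)
    qed
    then have "ennreal B \<le> ennreal (?b * (v * r ^ ?n))" by (rule ennreal_leI)
    also have "\<dots> = ennreal ?b * emeasure lborel (cball a r)"
      using r v by (subst emeasure_cball) (auto simp: v_def[symmetric] ennreal_mult[symmetric])
    also have "\<dots> = (\<integral>\<^sup>+x. ennreal ?b * indicator (cball a r) x \<partial>lborel)"
      by (subst nn_integral_cmult_indicator) auto
    also have "\<dots> = (\<integral>\<^sup>+x. ennreal ?b * indicator (cball a r) x \<partial>lebesgue)"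
      by (simp add: nn_integral_completion)
    also have "\<dots> \<le> (\<integral>\<^sup>+x. ennreal (trunc_exp ?n (\<alpha> * \<bar>u x\<bar> powr q)) * indicator \<Omega> x \<partial>lebesgue)"
    proof (rule nn_integral_mono)
      fix x
      show "ennreal ?b * indicator (cball a r) x \<le> ennreal (trunc_exp ?n (\<alpha> * \<bar>u x\<bar> powr q)) * indicator \<Omega> x"
      proof (cases "x \<in> cball a r")
        case True
        then have "x \<in> \<Omega>" using R r by auto
        have "?b \<le> exp (\<alpha> * \<bar>u x\<bar> powr q) / 2" using u_large[OF True] by simp
        also have "\<dots> \<le> trunc_exp ?n (\<alpha> * \<bar>u x\<bar> powr q)" using u_large[OF True] L(4) by (intro T) simp
        finally show ?thesis using True \<open>x \<in> \<Omega>\<close> by (simp add: ennreal_leI)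
      qed simp
    qed
    also have "\<dots> = (\<integral>\<^sup>+x. ennreal (trunc_exp ?n (\<alpha> * \<bar>u x\<bar> powr q)) \<partial>lebesgue_on \<Omega>)"
      using \<Omega> by (intro nn_integral_restrict_space[symmetric]) auto
    also have "\<dots> \<le> moser_sup \<alpha> \<Omega>"
      unfolding moser_sup_def q_def
      using test_function_in_sobolev_space_0[OF \<Omega>(1) DIM_positive u_test] u_norm by (intro SUP_upper) auto
    finally show ?thesis .
  qed
  show ?thesis
  proof (rule ccontr)
    assume "moser_sup \<alpha> \<Omega> \<noteq> \<infinity>"
    then obtain y where y: "0 \<le> y" "moser_sup \<alpha> \<Omega> = ennreal y" by (cases "moser_sup \<alpha> \<Omega>") auto
    with large[of "y + 1"] show False by simp
  qed
qed

theorem theorem1p1: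
  assumes "CARD('n::finite) \<ge> 2"
  shows "(\<exists>d>0. \<forall>\<Omega> :: (real ^ 'n) set. is_domain \<Omega> \<longrightarrow>
            moser_sup (moser_const TYPE(real ^ 'n)) \<Omega> \<le> ennreal d) \<and>
         (\<forall>\<Omega> :: (real ^ 'n) set. is_domain \<Omega> \<longrightarrow>
            (\<forall>\<alpha> > moser_const TYPE(real ^ 'n). moser_sup \<alpha> \<Omega> = \<infinity>))"
proof -
  have n: "2 \<le> DIM(real ^ 'n)" using assms by simp
  obtain D where "0 < D" "\<And>\<Omega> :: (real ^ 'n) set. open \<Omega> \<Longrightarrow> moser_sup (moser_const TYPE(real ^ 'n)) \<Omega> \<le> ennreal D"
    using moser_sup_bounded[OF n] by blast
  then show ?thesis using moser_sup_eq_infinity[OF n] by (auto simp: is_domain_def)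
qed

end
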